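(* Let $\alpha$ be a self-dual algebra norm of $V$ split by $V=V^0\perp W$, where $V^0$ is a quadratic extension $F'$ of $F$ with ramification index $e$; let $\alpha_W$ be its restriction to $W$. Let $\Phi$ be the hermitian form on $V$ characterized by $f=\mathrm{tr}_{F'/F}\circ\Phi$. (i) For every orthogonal basis $(f_1,f_2,f_3)$ of $W$ over $F'$, $f_1f_2$ is a nonzero ($F'$-)multiple of $f_3$. Call special basis of $W$ any Witt basis $(e_{-1},e_0,e_1)$ over $F'$ such that $Q(e_{-1})=Q(e_1)=0$, $\Phi(e_{-1},e_1)=1$, $e_0=(e_{-1}+e_1)(e_{-1}-e_1)$. The $\mathfrak o_{F'}$-lattices generated by the special bases of $W$ all have the same volume, and if the volume is normalized so that the $\mathfrak o_{F'}$-lattices generated by the special bases of $W$ have volume zero, then the self-dual $F'$-norms of $W$ have volume zero. (ii) The norm $e\,\alpha_W$ is a self-dual $F'$-norm on $W$. (iii) Conversely, let $\alpha'$ be a self-dual $F'$-norm of $W$ and let $\alpha_0$ be the unique self-dual algebra norm of $V^0$. Then $\alpha_0\wedge\frac1e\alpha'$ is a self-dual algebra norm of $V$, the unique such norm split by $V=V^0\perp W$ and extending $\frac1e\alpha'$.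
   Context: $F$ is a non-archimedean local field of residual characteristic $p\notin\{2,3\}$, with normalized valuation $v_F$. $V$ is the (split) octonion algebra over $F$, with unit, multiplicative norm $Q$ and bilinear form $f$ with $f(x,x)=2Q(x)$. $V^0$ is a composition subalgebra of $V$ (unital subalgebra on which $Q$ is nondegenerate) of dimension 2 which is a field $F'$, and $W=(V^0)^\perp$; left multiplication makes $V$ and $W$ vector spaces over $F'$ ($\dim_{F'}W=3$). $v_{F'}$ is the normalized valuation of $F'$. Let $E$ be $F$ or $F'$. A (rational) $E$-norm on an $E$-space $X$ is $\alpha:X\to\mathbb Q\cup\{\infty\}$ with $\alpha(x+y)\ge\inf(\alpha(x),\alpha(y))$, $\alpha(\xi x)=v_E(\xi)+\alpha(x)$ for $\xi\in E$, and $\alpha(x)=\infty\iff x=0$; "norm" means $F$-norm. An $F$-norm on $V$ or a nondegenerate subspace is self-dual if $\alpha(v)=\inf_x(v_F(f(v,x))-\alpha(x))$ for all $v$; an $F'$-norm on $W$ is self-dual if $\alpha(v)=\inf_{x\in W}(v_{F'}(\Phi(v,x))-\alpha(x))$ for all $v\in W$. An algebra norm satisfies $\alpha(xy)\ge\alpha(x)+\alpha(y)$. $(\alpha_1\wedge\alpha_2)(x_1+x_2)=\min\{\alpha_1(x_1),\alpha_2(x_2)\}$; a norm on $X_1\oplus X_2$ is split by the decomposition if it equals the $\wedge$ of its restrictions; a basis splits a norm if the corresponding decomposition into lines does. The volume of an $\mathfrak o_{F'}$-lattice $L$ of $W$ is defined, after choice of a reference lattice $L_0$, by $\mathrm{vol}(L)=v_{F'}(\det_{F'}g)$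 if $gL_0=L$; the volume of an $F'$-norm $\alpha$ is $\mathrm{vol}\,L-\sum_i\alpha(e_i)$, where $(e_i)$ is an $F'$-basis splitting $\alpha$ and generating the lattice $L$ (independent of the splitting basis). *)

theory Defs
  imports "HOL-Analysis.Analysis"
begin

section \<open>Non-archimedean local fields\<close>

text \<open>Valuations and norms are \<^typ>\<open>ereal\<close>-valued; the values actually allowed
  (\<open>\<int> \<union> {\<infinity>}\<close>, resp.\ \<open>\<rat> \<union> {\<infinity>}\<close>) are part of the definitions.\<close>

definition normalized_valuation :: "('k::field \<Rightarrow> ereal) \<Rightarrow> bool" where
  "normalized_valuation v \<longleftrightarrow>
     (\<forall>x. v x = \<infinity> \<longleftrightarrow> x = 0) \<and>
     (\<forall>x y. v (x * y) = v x + v y) \<and>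
     (\<forall>x y. v (x + y) \<ge> min (v x) (v y)) \<and>
     v ` (UNIV - {0}) = range (\<lambda>n::int. ereal (of_int n))"

definition valuation_complete :: "('k::field \<Rightarrow> ereal) \<Rightarrow> bool" where
  "valuation_complete v \<longleftrightarrow>
     (\<forall>X::nat \<Rightarrow> 'k.
        (\<forall>M::nat. \<exists>N. \<forall>m\<ge>N. \<forall>n\<ge>N. v (X m - X n) \<ge> ereal (real M)) \<longrightarrow>
        (\<exists>l. \<forall>M::nat. \<exists>N. \<forall>n\<ge>N. v (X n - l) \<ge> ereal (real M)))"

definition residue_classes :: "('k::field \<Rightarrow> ereal) \<Rightarrow> 'k set set" where
  "residue_classes v =
     {x. v x \<ge> 0} // {(x, y). v x \<ge> 0 \<and> v y \<ge> 0 \<and> v (x - y) > 0}"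

definition nonarch_local_field :: "('k::field \<Rightarrow> ereal) \<Rightarrow> bool" where
  "nonarch_local_field v \<longleftrightarrow>
     normalized_valuation v \<and> valuation_complete v \<and> finite (residue_classes v)"

definition residue_char :: "('k::field \<Rightarrow> ereal) \<Rightarrow> nat" where
  "residue_char v = (LEAST p. 0 < p \<and> v (of_nat p) > 0)"


section \<open>Composition algebras\<close>

text \<open>The polar form of \<open>Q\<close>; it satisfies \<open>polar Q x x = 2 * Q x\<close>.\<close>

definition polar :: "('v::ab_group_add \<Rightarrow> 'f::field) \<Rightarrow> 'v \<Rightarrow> 'v \<Rightarrow> 'f" where
  "polar Q x y = Q (x + y) - Q x - Q y"

definition nondegenerate_on :: "('v::ab_group_add \<Rightarrow> 'f::field) \<Rightarrow> 'v set \<Rightarrow> bool" where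
  "nondegenerate_on Q X \<longleftrightarrow> (\<forall>x\<in>X. (\<forall>y\<in>X. polar Q x y = 0) \<longrightarrow> x = 0)"

definition orth_complement :: "('v::ab_group_add \<Rightarrow> 'f::field) \<Rightarrow> 'v set \<Rightarrow> 'v set" where
  "orth_complement Q X = {x. \<forall>y\<in>X. polar Q x y = 0}"

text \<open>The multiplication is not assumed to be associative.\<close>

definition composition_algebra ::
  "('f::field \<Rightarrow> 'v \<Rightarrow> 'v::{ab_group_add,times,one}) \<Rightarrow> ('v \<Rightarrow> 'f) \<Rightarrow> bool" where
  "composition_algebra sc Q \<longleftrightarrow>
     vector_space sc \<and>
     (\<forall>y. Vector_Spaces.linear sc sc (\<lambda>x. x * y)) \<and>
     (\<forall>x. Vector_Spaces.linear sc sc (\<lambda>y. x * y)) \<and>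
     (\<forall>x::'v. 1 * x = x \<and> x * 1 = x) \<and>
     (\<forall>a x. Q (sc a x) = a\<^sup>2 * Q x) \<and>
     (\<forall>y. Vector_Spaces.linear sc (*) (\<lambda>x. polar Q x y)) \<and>
     nondegenerate_on Q UNIV \<and>
     (\<forall>x y. Q (x * y) = Q x * Q y)"

definition split_octonion_algebra ::
  "('f::field \<Rightarrow> 'v \<Rightarrow> 'v::{ab_group_add,times,one}) \<Rightarrow> ('v \<Rightarrow> 'f) \<Rightarrow> bool" where
  "split_octonion_algebra sc Q \<longleftrightarrow>
     composition_algebra sc Q \<and> vector_space.dim sc UNIV = 8 \<and> (\<exists>x. x \<noteq> 0 \<and> Q x = 0)"

text \<open>The quadratic extension \<open>F'\<close> of \<open>F\<close> is a type \<^typ>\<open>'e\<close> with structure map \<open>\<iota>\<close> from \<open>F\<close>,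
  and \<open>j\<close> is the inclusion of \<open>F'\<close> in the algebra, so that the composition subalgebra
  \<open>V\<^sup>0\<close> is \<open>range j\<close>.\<close>

definition quadratic_composition_subfield ::
  "('f::field \<Rightarrow> 'v \<Rightarrow> 'v::{ab_group_add,times,one}) \<Rightarrow> ('v \<Rightarrow> 'f) \<Rightarrow>
   ('f \<Rightarrow> 'e::field) \<Rightarrow> ('e \<Rightarrow> 'v) \<Rightarrow> bool" where
  "quadratic_composition_subfield sc Q \<iota> j \<longleftrightarrow>
     (\<forall>a b. j (a + b) = j a + j b) \<and>
     (\<forall>a b. j (a * b) = j a * j b) \<and>
     j 1 = 1 \<and>
     (\<forall>a. j (\<iota> a) = sc a 1) \<and>
     module.subspace sc (range j) \<and>
     vector_space.dim sc (range j) = 2 \<and>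
     nondegenerate_on Q (range j)"

definition nontrivial_automorphism ::
  "('f::field \<Rightarrow> 'e::field) \<Rightarrow> ('e \<Rightarrow> 'e) \<Rightarrow> bool" where
  "nontrivial_automorphism \<iota> \<sigma> \<longleftrightarrow>
     bij \<sigma> \<and>
     (\<forall>a b. \<sigma> (a + b) = \<sigma> a + \<sigma> b) \<and>
     (\<forall>a b. \<sigma> (a * b) = \<sigma> a * \<sigma> b) \<and>
     (\<forall>a. \<sigma> (\<iota> a) = \<iota> a) \<and>
     \<sigma> \<noteq> id"

text \<open>The trace of the quadratic Galois extension \<open>F'/F\<close> with Galois group \<open>{id, \<sigma>}\<close>.\<close>

definition quadratic_trace ::
  "('f::field \<Rightarrow> 'e::field) \<Rightarrow> ('e \<Rightarrow> 'e) \<Rightarrow> 'e \<Rightarrow> 'f" where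
  "quadratic_trace \<iota> \<sigma> c = (THE t. \<iota> t = c + \<sigma> c)"

text \<open>Linear in the first variable. The opposite convention replaces \<open>\<Phi> x y\<close> by \<open>\<Phi> y x = \<sigma> (\<Phi> x y)\<close>,
  which has the same trace and the same valuation.\<close>

definition hermitian_form ::
  "('e::field \<Rightarrow> 'v \<Rightarrow> 'v::ab_group_add) \<Rightarrow> ('e \<Rightarrow> 'e) \<Rightarrow> ('v \<Rightarrow> 'v \<Rightarrow> 'e) \<Rightarrow> bool" where
  "hermitian_form s \<sigma> \<Phi> \<longleftrightarrow>
     (\<forall>y. Vector_Spaces.linear s (*) (\<lambda>x. \<Phi> x y)) \<and> (\<forall>x y. \<Phi> y x = \<sigma> (\<Phi> x y))"


section \<open>Norms\<close>

text \<open>A norm on a subspace \<open>X\<close> is a function on the ambient type; only its values on \<open>X\<close> matter.\<close>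

definition rational_norm ::
  "('k::field \<Rightarrow> ereal) \<Rightarrow> ('k \<Rightarrow> 'v \<Rightarrow> 'v::ab_group_add) \<Rightarrow> 'v set \<Rightarrow> ('v \<Rightarrow> ereal) \<Rightarrow> bool" where
  "rational_norm v s X \<alpha> \<longleftrightarrow>
     (\<forall>x\<in>X. \<alpha> x = \<infinity> \<or> (\<exists>q::rat. \<alpha> x = ereal (of_rat q))) \<and>
     (\<forall>x\<in>X. \<forall>y\<in>X. \<alpha> (x + y) \<ge> min (\<alpha> x) (\<alpha> y)) \<and>
     (\<forall>c. \<forall>x\<in>X. \<alpha> (s c x) = v c + \<alpha> x) \<and>
     (\<forall>x\<in>X. \<alpha> x = \<infinity> \<longleftrightarrow> x = 0)"

text \<open>The vector \<open>0\<close> is left out of the infimum, where its term would read \<open>\<infinity> - \<infinity>\<close>.\<close>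

definition self_dual ::
  "('k::field \<Rightarrow> ereal) \<Rightarrow> ('v \<Rightarrow> 'v \<Rightarrow> 'k) \<Rightarrow> 'v::ab_group_add set \<Rightarrow> ('v \<Rightarrow> ereal) \<Rightarrow> bool" where
  "self_dual v h X \<alpha> \<longleftrightarrow> (\<forall>x\<in>X. \<alpha> x = (INF y\<in>X - {0}. v (h x y) - \<alpha> y))"

definition self_dual_norm ::
  "('k::field \<Rightarrow> ereal) \<Rightarrow> ('k \<Rightarrow> 'v \<Rightarrow> 'v::ab_group_add) \<Rightarrow> ('v \<Rightarrow> 'v \<Rightarrow> 'k) \<Rightarrow> 'v set \<Rightarrow>
   ('v \<Rightarrow> ereal) \<Rightarrow> bool" where
  "self_dual_norm v s h X \<alpha> \<longleftrightarrow> rational_norm v s X \<alpha> \<and> self_dual v h X \<alpha>"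

definition self_dual_algebra_norm ::
  "('f::field \<Rightarrow> ereal) \<Rightarrow> ('f \<Rightarrow> 'v \<Rightarrow> 'v::{ab_group_add,times,one}) \<Rightarrow> ('v \<Rightarrow> 'f) \<Rightarrow> 'v set \<Rightarrow>
   ('v \<Rightarrow> ereal) \<Rightarrow> bool" where
  "self_dual_algebra_norm v sc Q X \<alpha> \<longleftrightarrow>
     self_dual_norm v sc (polar Q) X \<alpha> \<and> (\<forall>x\<in>X. \<forall>y\<in>X. \<alpha> (x * y) \<ge> \<alpha> x + \<alpha> y)"

text \<open>Only meaningful if the ambient space is the direct sum of \<open>X1\<close> and \<open>X2\<close>.\<close>

definition norm_wedge ::
  "'v::ab_group_add set \<Rightarrow> 'v set \<Rightarrow> ('v \<Rightarrow> ereal) \<Rightarrow> ('v \<Rightarrow> ereal) \<Rightarrow> 'v \<Rightarrow> ereal" where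
  "norm_wedge X1 X2 \<alpha>1 \<alpha>2 x =
     (THE r. \<exists>x1\<in>X1. \<exists>x2\<in>X2. x = x1 + x2 \<and> r = min (\<alpha>1 x1) (\<alpha>2 x2))"

definition split_by ::
  "'v::ab_group_add set \<Rightarrow> 'v set \<Rightarrow> ('v \<Rightarrow> ereal) \<Rightarrow> bool" where
  "split_by X1 X2 \<alpha> \<longleftrightarrow> (\<forall>x1\<in>X1. \<forall>x2\<in>X2. \<alpha> (x1 + x2) = min (\<alpha> x1) (\<alpha> x2))"


section \<open>Bases, lattices and volumes in a three-dimensional space\<close>

definition basis3 ::
  "('e::field \<Rightarrow> 'v \<Rightarrow> 'v::ab_group_add) \<Rightarrow> 'v set \<Rightarrow> (3 \<Rightarrow> 'v) \<Rightarrow> bool" where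
  "basis3 s W b \<longleftrightarrow>
     inj b \<and> \<not> module.dependent s (range b) \<and> module.span s (range b) = W"

definition orthogonal_basis3 ::
  "('e::field \<Rightarrow> 'v \<Rightarrow> 'v::ab_group_add) \<Rightarrow> ('v \<Rightarrow> 'v \<Rightarrow> 'e) \<Rightarrow> 'v set \<Rightarrow> (3 \<Rightarrow> 'v) \<Rightarrow> bool" where
  "orthogonal_basis3 s \<Phi> W b \<longleftrightarrow> basis3 s W b \<and> (\<forall>i k. i \<noteq> k \<longrightarrow> \<Phi> (b i) (b k) = 0)"

text \<open>The basis \<open>(e\<^sub>-\<^sub>1, e\<^sub>0, e\<^sub>1)\<close> is indexed as \<open>(b 1, b 2, b 3)\<close>. A Witt basis consists of a
  hyperbolic pair \<open>e\<^sub>-\<^sub>1, e\<^sub>1\<close> and a vector \<open>e\<^sub>0\<close> orthogonal to it.\<close>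

definition special_basis ::
  "('e::field \<Rightarrow> 'v \<Rightarrow> 'v::{ab_group_add,times,one}) \<Rightarrow> ('v \<Rightarrow> 'f::field) \<Rightarrow> ('v \<Rightarrow> 'v \<Rightarrow> 'e) \<Rightarrow>
   'v set \<Rightarrow> (3 \<Rightarrow> 'v) \<Rightarrow> bool" where
  "special_basis s Q \<Phi> W b \<longleftrightarrow>
     basis3 s W b \<and>
     \<Phi> (b 2) (b 1) = 0 \<and> \<Phi> (b 2) (b 3) = 0 \<and>
     Q (b 1) = 0 \<and> Q (b 3) = 0 \<and>
     \<Phi> (b 1) (b 3) = 1 \<and>
     b 2 = (b 1 + b 3) * (b 1 - b 3)"

definition basis_splits ::
  "('e::field \<Rightarrow> 'v \<Rightarrow> 'v::ab_group_add) \<Rightarrow> (3 \<Rightarrow> 'v) \<Rightarrow> ('v \<Rightarrow> ereal) \<Rightarrow> bool" where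
  "basis_splits s b \<alpha> \<longleftrightarrow>
     (\<forall>c::3 \<Rightarrow> 'e. \<alpha> (\<Sum>i\<in>UNIV. s (c i) (b i)) = Min (range (\<lambda>i. \<alpha> (s (c i) (b i)))))"

definition lattice_of ::
  "('e::field \<Rightarrow> ereal) \<Rightarrow> ('e \<Rightarrow> 'v \<Rightarrow> 'v::ab_group_add) \<Rightarrow> (3 \<Rightarrow> 'v) \<Rightarrow> 'v set" where
  "lattice_of v s b = {\<Sum>i\<in>UNIV. s (c i) (b i) | c. \<forall>i. v (c i) \<ge> 0}"

definition is_lattice ::
  "('e::field \<Rightarrow> ereal) \<Rightarrow> ('e \<Rightarrow> 'v \<Rightarrow> 'v::ab_group_add) \<Rightarrow> 'v set \<Rightarrow> 'v set \<Rightarrow> bool" where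
  "is_lattice v s W L \<longleftrightarrow> (\<exists>b. basis3 s W b \<and> L = lattice_of v s b)"

definition linear_automorphism_on ::
  "('e::field \<Rightarrow> 'v \<Rightarrow> 'v::ab_group_add) \<Rightarrow> 'v set \<Rightarrow> ('v \<Rightarrow> 'v) \<Rightarrow> bool" where
  "linear_automorphism_on s W g \<longleftrightarrow>
     bij_betw g W W \<and>
     (\<forall>x\<in>W. \<forall>y\<in>W. g (x + y) = g x + g y) \<and>
     (\<forall>c. \<forall>x\<in>W. g (s c x) = s c (g x))"

definition endo_matrix ::
  "('e::field \<Rightarrow> 'v \<Rightarrow> 'v::ab_group_add) \<Rightarrow> (3 \<Rightarrow> 'v) \<Rightarrow> ('v \<Rightarrow> 'v) \<Rightarrow> 'e^3^3" where
  "endo_matrix s b g = (\<chi> i k. module.representation s (range b) (g (b k)) (b i))"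

text \<open>The volume of \<open>L\<close> with respect to the reference lattice \<open>L0\<close>: the valuation of \<open>det g\<close>, where
  \<open>g L0 = L\<close> and \<open>det g\<close> is computed in an arbitrary basis of \<open>W\<close>.\<close>

definition lattice_volume ::
  "('e::field \<Rightarrow> ereal) \<Rightarrow> ('e \<Rightarrow> 'v \<Rightarrow> 'v::ab_group_add) \<Rightarrow> 'v set \<Rightarrow> 'v set \<Rightarrow> 'v set \<Rightarrow> ereal" where
  "lattice_volume v s W L0 L =
     (THE n. \<exists>g b. linear_automorphism_on s W g \<and> g ` L0 = L \<and> basis3 s W b \<and>
                   n = v (det (endo_matrix s b g)))"

definition norm_volume ::
  "('e::field \<Rightarrow> ereal) \<Rightarrow> ('e \<Rightarrow> 'v \<Rightarrow> 'v::ab_group_add) \<Rightarrow> 'v set \<Rightarrow> 'v set \<Rightarrow>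
   ('v \<Rightarrow> ereal) \<Rightarrow> ereal" where
  "norm_volume v s W L0 \<alpha> =
     (THE n. \<exists>b. basis3 s W b \<and> basis_splits s b \<alpha> \<and>
                 n = lattice_volume v s W L0 (lattice_of v s b) - (\<Sum>i\<in>UNIV. \<alpha> (b i)))"

end

theory Submission
  imports Defs
begin

text \<open>For \<open>x, y \<in> W\<close> write \<open>x y = - \<Phi>(x, y) + x \<times> y\<close> with \<open>x \<times> y \<in> W\<close>. The product \<open>\<times>\<close> is alternating
  and antilinear in both variables, and satisfies \<open>(x \<times> y) \<times> z = \<Phi>(x, z) y - \<Phi>(y, z) x\<close>; hence the norm
  of \<open>\<Phi>(x \<times> y, z)\<close> is the Gram determinant of \<open>x, y, z\<close>. For a self-dual norm this bounds the valuation of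
  \<open>\<Phi>(x \<times> y, z)\<close> by \<open>\<alpha>(x) + \<alpha>(y) + \<alpha>(z)\<close>, so that \<open>\<alpha>(x \<times> y) \<ge> \<alpha>(x) + \<alpha>(y)\<close> by duality, which is the
  multiplicativity in (iii). Gram determinants also control volumes: a special basis has Gram
  determinant 4, a unit, and a basis splitting a self-dual norm has one of valuation
  \<open>2 \<Sum>\<alpha>(e\<^sub>i)\<close>. On \<open>V\<^sup>0\<close> the only self-dual norm is \<open>v\<^sub>F\<^sub>'/e\<close>, because \<open>v\<^sub>F\<^sub>'\<close> is invariant under \<open>\<sigma>\<close> and 2
  is a unit.\<close>

section \<open>Valued fields\<close>

text \<open>The volume of a norm is a definite description over its splitting bases, so one such
  basis must be produced, and over a general valued field the norm axioms do not provide it.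
  Self-duality does: by the Gram determinants the sum of the norms of a basis is at most its volume
  relative to a special basis, and this bound makes a basis of minimal defect exist. A special basis
  has to be constructed as well, because the isotropic vector of the split algebra need not lie in
  \<open>W\<close>.

  Infima are avoided: self-duality is used as the equivalence of \<open>m \<le> \<alpha> x\<close>
  with the inequalities \<open>m + \<alpha> y \<le> v (h x y)\<close>. Identities for the F-valued
  form \<open>B\<close> become identities for \<Phi> by checking that the trace of c times the
  difference of the two sides vanishes for every c. The valuation \<open>vE\<close> is known only
  through its normalization and its restriction to F; its invariance under \<sigma> therefore has to
  be derived, and this is where the completeness of F enters.\<close>

locale valued_field =
  fixes v :: "'k::field \<Rightarrow> ereal"
  assumes normalized: "normalized_valuation v"
begin

lemma val_eq_PInfty_iff: "v x = \<infinity> \<longleftrightarrow> x = 0"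
  using normalized by (simp add: normalized_valuation_def)

lemma val_0 [simp]: "v 0 = \<infinity>"
  by (simp add: val_eq_PInfty_iff)

lemma val_mult: "v (x * y) = v x + v y"
  using normalized by (simp add: normalized_valuation_def)

lemma val_add: "min (v x) (v y) \<le> v (x + y)"
  using normalized by (simp add: normalized_valuation_def)

lemma val_finite:
  assumes "x \<noteq> 0" obtains n :: int where "v x = ereal (of_int n)"
proof -
  have "v x \<in> v ` (UNIV - {0})" using assms by auto
  then show ?thesis using normalized that by (auto simp: normalized_valuation_def)
qed

lemma val_1 [simp]: "v 1 = 0"
proof -
  obtain n where n: "v 1 = ereal (of_int n)" by (rule val_finite[of 1]) auto
  have "v 1 = v 1 + v 1" by (metis val_mult mult_1)
  then show ?thesis by (simp add: n)
qed

lemma val_minus [simp]: "v (- x) = v x"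
proof -
  obtain n where n: "v (-1) = ereal (of_int n)" by (rule val_finite[of "-1"]) auto
  have "v (-1) + v (-1) = v 1" by (metis val_mult mult_minus1 minus_minus)
  then have "v (-1) = 0" by (simp add: n)
  then show ?thesis by (metis val_mult mult_minus1 add_0)
qed

lemma val_ge_add: "m \<le> v x \<Longrightarrow> m \<le> v y \<Longrightarrow> m \<le> v (x + y)"
  using val_add[of x y] by (meson min.bounded_iff order_trans)

lemma val_ge_diff: "m \<le> v x \<Longrightarrow> m \<le> v y \<Longrightarrow> m \<le> v (x - y)"
  using val_ge_add[of m x "- y"] by simp

lemma val_inverse: "x \<noteq> 0 \<Longrightarrow> v (inverse x) = - v x"
proof -
  assume x: "x \<noteq> 0"
  obtain n where n: "v x = ereal (of_int n)" using val_finite[OF x] .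
  obtain m where m: "v (inverse x) = ereal (of_int m)" 
    by (rule val_finite[of "inverse x"]) (use x in auto)
  have "v x + v (inverse x) = 0" using x by (metis val_mult right_inverse val_1)
  then show ?thesis by (simp add: n m)
qed

lemma val_of_nat_nonneg: "0 \<le> v (of_nat n)"
  by (induction n) (auto intro: val_ge_add)

end

text \<open>The residue characteristic is used in this form: 2 is a unit, so halving a trace does
  not change valuations.\<close>

lemma val_2_eq_0:
  assumes "normalized_valuation v" "residue_char v \<noteq> 2"
  shows "v (2::'k::field) = 0"
proof -
  interpret valued_field v using assms by unfold_locales
  have 1: "0 \<le> v 2" using val_of_nat_nonneg[of 2] by simp
  moreover have "\<not> 0 < v 2"
  proof
    assume v2: "0 < v 2"
    have "residue_char v = 2"
      unfolding residue_char_def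
    proof (rule Least_equality)
      show "0 < (2::nat) \<and> 0 < v (of_nat 2)" using v2 by simp
      fix p assume p: "0 < p \<and> 0 < v (of_nat p)"
      show "2 \<le> p" using p by (cases "p = 1") auto
    qed
    with assms show False by simp
  qed
  ultimately show ?thesis by simp
qed

text \<open>On the ball \<open>1 \<le> v y\<close> the map from \<open>y\<close> to
  \<open>u + y\<^sup>2\<close> is contracting, since \<open>y\<^sup>2 - z\<^sup>2\<close> has the
  factor \<open>y + z\<close> of valuation at least 1. This is Hensel's lemma for a quadratic
  polynomial with simple root 0 modulo the maximal ideal.\<close>

lemma quadratic_root_by_contraction:
  fixes v :: "'k::field \<Rightarrow> ereal"
  assumes nv: "normalized_valuation v" and compl: "valuation_complete v" and u: "1 \<le> v u"
  obtains y where "y = u + y\<^sup>2"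
proof -
  interpret valued_field v using nv by unfold_locales
  define Y where "Y = rec_nat 0 (\<lambda>_ y. u + y\<^sup>2)"
  have Y0: "Y 0 = 0" and YS: "Y (Suc n) = u + (Y n)\<^sup>2" for n by (simp_all add: Y_def)
  have sq: "1 \<le> v (y\<^sup>2)" if "1 \<le> v y" for y
  proof -
    have "(1::ereal) + 0 \<le> v y + v y" using that by (intro add_mono) (auto intro: order_trans[of 0 1])
    then show ?thesis by (simp add: power2_eq_square val_mult)
  qed
  have Y1: "1 \<le> v (Y n)" for n
    by (induction n) (auto simp: Y0 YS intro!: val_ge_add u sq)
  have step: "v (y - z) + 1 \<le> v (y\<^sup>2 - z\<^sup>2)" if "1 \<le> v y" "1 \<le> v z" for y z
  proof -
    have "y\<^sup>2 - z\<^sup>2 = (y - z) * (y + z)" by (simp add: power2_eq_square algebra_simps)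
    then show ?thesis using val_ge_add[OF that] by (auto simp: val_mult intro: add_left_mono)
  qed
  have dif: "ereal (real n) \<le> v (Y (Suc n) - Y n)" for n
  proof (induction n)
    case 0 then show ?case using order_trans[OF _ Y1[of "Suc 0"], of 0] by (simp add: Y0 zero_ereal_def[symmetric])
  next
    case (Suc n)
    have "ereal (real (Suc n)) \<le> v (Y (Suc n) - Y n) + 1"
      using add_right_mono[OF Suc, of 1] by (simp add: one_ereal_def add.commute)
    also have "\<dots> \<le> v (Y (Suc (Suc n)) - Y (Suc n))"
      using step[OF Y1 Y1, of "Suc n" n] by (simp only: YS[of "Suc n"] YS[of n]) (simp add: algebra_simps)
    finally show ?case .
  qed
  have far: "ereal (real M) \<le> v (Y n - Y M)" if "M \<le> n" for M n
    using that
  proof (induction n rule: dec_induct)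
    case (step n)
    have "ereal (real M) \<le> v ((Y (Suc n) - Y n) + (Y n - Y M))"
      using step order_trans[OF _ dif[of n], of "ereal (real M)"] by (intro val_ge_add) auto
    then show ?case by simp
  qed simp
  have "\<forall>M::nat. \<exists>N. \<forall>m\<ge>N. \<forall>n\<ge>N. v (Y m - Y n) \<ge> ereal (real M)"
  proof (intro allI exI impI)
    fix M m n :: nat assume "M \<le> m" "M \<le> n"
    then have "ereal (real M) \<le> v ((Y m - Y M) - (Y n - Y M))" by (intro val_ge_diff far)
    then show "ereal (real M) \<le> v (Y m - Y n)" by simp
  qed
  then obtain l where l: "\<And>M::nat. \<exists>N. \<forall>n\<ge>N. v (Y n - l) \<ge> ereal (real M)"
    using compl unfolding valuation_complete_def by blast
  have lY: "ereal (real M) \<le> v (Y M - l)" for M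
  proof -
    obtain N where N: "\<And>n. n \<ge> N \<Longrightarrow> v (Y n - l) \<ge> ereal (real M)" using l by blast
    have "ereal (real M) \<le> v ((Y (max M N) - l) - (Y (max M N) - Y M))"
      by (intro val_ge_diff far N) auto
    then show ?thesis by simp
  qed
  \<comment> \<open>The limit stays in the ball, so the contraction estimate applies to
    \<open>l\<close> and \<open>Y M\<close> as well.\<close>
  have l1: "1 \<le> v l"
    using val_ge_diff[OF Y1[of 1], of "Y 1 - l"] lY[of 1] by (simp add: one_ereal_def)
  have big: "ereal (real M) \<le> v (u + l\<^sup>2 - l)" for M
  proof -
    have "v (l - Y M) + 1 \<le> v (l\<^sup>2 - (Y M)\<^sup>2)" by (rule step[OF l1 Y1])
    moreover have "v (l - Y M) = v (Y M - l)" by (metis minus_diff_eq val_minus)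
    moreover have "ereal (real M) + 0 \<le> v (Y M - l) + 1" by (intro add_mono lY) simp
    ultimately have 1: "ereal (real M) \<le> v (l\<^sup>2 - (Y M)\<^sup>2)" by simp
    have "ereal (real M) \<le> ereal (real (Suc M))" by simp
    then have 2: "ereal (real M) \<le> v (Y (Suc M) - l)" using lY order_trans by blast
    have "ereal (real M) \<le> v ((Y (Suc M) - l) + (l\<^sup>2 - (Y M)\<^sup>2))" by (intro val_ge_add 1 2)
    then show ?thesis by (simp add: YS algebra_simps)
  qed
  have "u + l\<^sup>2 - l = 0"
  proof (rule ccontr)
    assume "u + l\<^sup>2 - l \<noteq> 0"
    then obtain n where n: "v (u + l\<^sup>2 - l) = ereal (of_int n)" by (rule val_finite)
    show False using big[of "nat (n + 1)"] unfolding n by (cases "n \<ge> 0") auto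
  qed
  then show thesis using that[of l] by (simp add: algebra_simps)
qed

section \<open>Bases of three-dimensional spaces\<close>

text \<open>The columns of \<open>A\<close> are the coordinates of the new vectors. Successive
  changes of basis then multiply on the right, and \<open>A\<close> is also the matrix in the basis
  \<open>b\<close> of the endomorphism carrying \<open>b\<close> to the new family.\<close>

definition transform ::
  "('e::field \<Rightarrow> 'v \<Rightarrow> 'v::ab_group_add) \<Rightarrow> (3 \<Rightarrow> 'v) \<Rightarrow> 'e^3^3 \<Rightarrow> 3 \<Rightarrow> 'v" where
  "transform s b A k = (\<Sum>i\<in>UNIV. s (A$i$k) (b i))"

context vector_space
begin

lemma basis3_coords:
  assumes "basis3 scale W b" "x \<in> W"
  obtains c where "x = (\<Sum>i\<in>UNIV. scale (c i) (b i))"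
proof -
  have inj: "inj b" and "x \<in> span (range b)" using assms by (auto simp: basis3_def)
  then obtain u where "x = (\<Sum>y\<in>range b. scale (u y) y)"
    by (auto simp: span_finite)
  then have "x = (\<Sum>i\<in>UNIV. scale (u (b i)) (b i))" by (simp add: sum.reindex[OF inj])
  then show ?thesis by (rule that[of "\<lambda>i. u (b i)"])
qed

lemma basis3_indep:
  assumes "basis3 scale W b" "(\<Sum>i\<in>UNIV. scale (c i) (b i)) = 0"
  shows "c k = 0"
proof -
  have inj: "inj b" and ind: "independent (range b)" using assms by (auto simp: basis3_def)
  have "(\<Sum>y\<in>range b. scale (c (inv b y)) y) = (\<Sum>i\<in>UNIV. scale (c i) (b i))"
    by (simp add: sum.reindex[OF inj] inv_f_f[OF inj])
  then have "c (inv b (b k)) = 0" using assms(2)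
    independentD[OF ind, of "range b" "\<lambda>y. c (inv b y)" "b k"] by auto
  then show ?thesis by (simp add: inv_f_f[OF inj])
qed

lemma basis3_coords_unique:
  assumes "basis3 scale W b"
    "(\<Sum>i\<in>UNIV. scale (c i) (b i)) = (\<Sum>i\<in>UNIV. scale (d i) (b i))"
  shows "c = d"
proof
  fix k
  have "(\<Sum>i\<in>UNIV. scale (c i - d i) (b i)) = 0"
    using assms(2) by (simp add: scale_left_diff_distrib sum_subtractf)
  from basis3_indep[OF assms(1) this, of k] show "c k = d k" by simp
qed

lemma basis3_sum_mem: "basis3 scale W b \<Longrightarrow> (\<Sum>i\<in>UNIV. scale (c i) (b i)) \<in> W"
  unfolding basis3_def by (blast intro: span_sum span_scale span_base)

lemma basis3_mem: "basis3 scale W b \<Longrightarrow> b i \<in> W"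
  unfolding basis3_def by (blast intro: span_base)

lemma basis3_representation:
  assumes "basis3 scale W b"
  shows "representation (range b) (\<Sum>i\<in>UNIV. scale (c i) (b i)) (b k) = c k"
proof -
  have ind: "independent (range b)" and inj: "inj b" using assms by (auto simp: basis3_def)
  have sp: "b i \<in> span (range b)" for i by (auto intro: span_base)
  have "representation (range b) (\<Sum>i\<in>UNIV. scale (c i) (b i)) (b k)
      = (\<Sum>i\<in>UNIV. c i * (if b k = b i then 1 else 0))"
    using sp by (subst representation_sum[OF ind])
      (auto intro!: span_scale sum.cong simp: representation_scale[OF ind] representation_basis[OF ind])
  also have "\<dots> = c k" using inj by (simp add: inj_eq if_distrib cong: if_cong)
  finally show ?thesis .
qed

text \<open>Independence of the family includes injectivity, which independence of the range would
  miss: \<open>b i = b k\<close> yields a relation with coefficients 1 and -1.\<close>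

lemma basis3I:
  assumes "\<And>c k. (\<Sum>i\<in>UNIV. scale (c i) (b i)) = 0 \<Longrightarrow> c k = 0" "span (range b) = W"
  shows "basis3 scale W b"
proof -
  have inj: "inj b"
  proof (rule injI, rule ccontr)
    fix i k assume *: "b i = b k" "i \<noteq> k"
    define c where "c = (\<lambda>l. if l = i then 1 else if l = k then - 1 else 0::'a)"
    have "(\<Sum>l\<in>UNIV. scale (c l) (b l)) = (\<Sum>l\<in>{i,k}. scale (c l) (b l))"
      by (rule sum.mono_neutral_right) (auto simp: c_def)
    also have "\<dots> = 0" using * by (simp add: c_def)
    finally have "c i = 0" using assms(1) by blast
    then show False by (simp add: c_def)
  qed
  have "independent (range b)"
  proof
    assume "dependent (range b)"
    then obtain u i where "(\<Sum>v\<in>range b. scale (u v) v) = 0" "u (b i) \<noteq> 0"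
      unfolding dependent_finite[OF finite_imageI[OF finite]] by blast
    then have "(\<Sum>i\<in>UNIV. scale (u (b i)) (b i)) = 0" by (simp add: sum.reindex[OF inj])
    then show False using assms(1)[of "\<lambda>i. u (b i)"] \<open>u (b i) \<noteq> 0\<close> by blast
  qed
  then show ?thesis using inj assms(2) by (simp add: basis3_def)
qed

lemma sum_transform:
  "(\<Sum>k\<in>UNIV. scale (c k) (transform scale b A k)) = (\<Sum>i\<in>UNIV. scale ((A *v (\<chi> k. c k))$i) (b i))"
proof -
  have "(\<Sum>k\<in>UNIV. scale (c k) (transform scale b A k))
      = (\<Sum>k\<in>UNIV. \<Sum>i\<in>UNIV. scale (A$i$k * c k) (b i))"
    by (simp add: transform_def scale_sum_right mult.commute)
  also have "\<dots> = (\<Sum>i\<in>UNIV. \<Sum>k\<in>UNIV. scale (A$i$k * c k) (b i))" by (rule sum.swap)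
  also have "\<dots> = (\<Sum>i\<in>UNIV. scale ((A *v (\<chi> k. c k))$i) (b i))"
    by (simp add: scale_sum_left matrix_vector_mult_def)
  finally show ?thesis .
qed

lemma transform_transform: "transform scale (transform scale b A) B = transform scale b (A ** B)"
proof
  fix k
  have "transform scale (transform scale b A) B k = (\<Sum>i\<in>UNIV. scale ((A *v (\<chi> l. B$l$k))$i) (b i))"
    by (simp only: transform_def[of _ "transform scale b A"] sum_transform)
  then show "transform scale (transform scale b A) B k = transform scale b (A ** B) k"
    by (simp add: transform_def matrix_matrix_mult_def matrix_vector_mult_def)
qed

lemma transform_mat_1 [simp]: "transform scale b (mat 1) = b"
  by (rule ext) (simp add: transform_def mat_def if_distribR if_distrib[of "\<lambda>c. scale c _"] cong: if_cong)

lemma transform_cong_iff: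
  assumes "basis3 scale W b"
  shows "transform scale b A = transform scale b B \<longleftrightarrow> A = B"
proof
  assume *: "transform scale b A = transform scale b B"
  show "A = B"
  proof (simp add: vec_eq_iff, intro allI)
    fix i k
    have "(\<lambda>i. A$i$k) = (\<lambda>i. B$i$k)"
      by (rule basis3_coords_unique[OF assms]) (use fun_cong[OF *, of k] in \<open>simp add: transform_def\<close>)
    then show "A$i$k = B$i$k" by meson
  qed
qed simp

lemma obtain_transform:
  assumes "basis3 scale W b" "\<And>i. c i \<in> W"
  obtains A where "c = transform scale b A"
proof -
  have "\<exists>d. c k = (\<Sum>i\<in>UNIV. scale (d i) (b i))" for k
    using basis3_coords[OF assms(1) assms(2)[of k]] by blast
  then obtain d where "\<And>k. c k = (\<Sum>i\<in>UNIV. scale (d k i) (b i))" by metis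
  then have "c = transform scale b (\<chi> i k. d k i)" by (auto simp: transform_def)
  then show ?thesis using that by blast
qed

lemma obtain_basis_change:
  assumes "basis3 scale W b" "basis3 scale W c"
  obtains A B where "c = transform scale b A" "b = transform scale c B" "A ** B = mat 1" "B ** A = mat 1"
proof -
  obtain A where A: "c = transform scale b A"
    using obtain_transform[OF assms(1)] basis3_mem[OF assms(2)] by metis
  obtain B where B: "b = transform scale c B"
    using obtain_transform[OF assms(2)] basis3_mem[OF assms(1)] by metis
  have "transform scale b (A ** B) = transform scale b (mat 1)"
    using A B by (metis transform_transform transform_mat_1)
  moreover have "transform scale c (B ** A) = transform scale c (mat 1)"
    using A B by (metis transform_transform transform_mat_1)
  ultimately show ?thesis using that A B transform_cong_iff assms by blast
qed

lemma basis3_transform: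
  assumes b: "basis3 scale W b" and det: "det A \<noteq> 0"
  shows "basis3 scale W (transform scale b A)"
proof (rule basis3I)
  obtain B where AB: "A ** B = mat 1" and BA: "B ** A = mat 1"
    using det by (auto simp: invertible_det_nz[symmetric] invertible_def)
  fix c k assume "(\<Sum>i\<in>UNIV. scale (c i) (transform scale b A i)) = 0"
  then have "\<And>i. (A *v (\<chi> k. c k))$i = 0"
    using basis3_indep[OF b] by (simp only: sum_transform)
  then have "A *v (\<chi> k. c k) = 0" by (simp add: vec_eq_iff)
  then have "(B ** A) *v (\<chi> k. c k) = 0"
    by (metis matrix_vector_mul_assoc matrix_vector_mult_0_right)
  then show "c k = 0" by (simp add: BA vec_eq_iff)
next
  obtain B where AB: "A ** B = mat 1" and BA: "B ** A = mat 1"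
    using det by (auto simp: invertible_det_nz[symmetric] invertible_def)
  have W: "span (range b) = W" using b by (simp add: basis3_def)
  have 1: "range (transform scale c A) \<subseteq> span (range c)" for A c
    by (clarsimp simp: transform_def) (intro span_sum span_scale span_base rangeI)
  have "b = transform scale (transform scale b A) B" by (simp add: transform_transform AB)
  then have "range b \<subseteq> span (range (transform scale b A))" using 1 by metis
  then have "span (range b) \<subseteq> span (range (transform scale b A))" by (meson span_minimal subspace_span)
  moreover have "span (range (transform scale b A)) \<subseteq> span (range b)"
    using 1 by (meson span_minimal subspace_span)
  ultimately show "span (range (transform scale b A)) = W" using W by blast
qed

lemma endo_matrix_eq:
  assumes "basis3 scale W b" "g \<circ> b = transform scale b A"
  shows "endo_matrix scale b g = A"
proof -
  have "g (b k) = (\<Sum>i\<in>UNIV. scale (A$i$k) (b i))" for k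
    using fun_cong[OF assms(2), of k] by (simp add: transform_def)
  then show ?thesis
    by (simp add: endo_matrix_def vec_eq_iff basis3_representation[OF assms(1), of "\<lambda>i. A$i$_"])
qed

end

section \<open>Norms, lattices and splitting bases\<close>

lemma ereal_le_minus_real_iff: "m \<le> a - ereal r \<longleftrightarrow> m + ereal r \<le> a"
  by (cases m; cases a) auto

lemma ereal_mult_distrib_pos: "0 < r \<Longrightarrow> ereal r * (a + b) = ereal r * a + ereal r * b"
  by (cases a; cases b) (auto simp: algebra_simps)

lemma ereal_mult_le_cancel_pos: "0 < r \<Longrightarrow> ereal r * a \<le> ereal r * b \<longleftrightarrow> a \<le> b"
  by (cases a; cases b) auto

lemma ereal_mult_inverse_pos: "0 < r \<Longrightarrow> ereal (1 / r) * (ereal r * a) = a"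
  "0 < r \<Longrightarrow> ereal r * (ereal (1 / r) * a) = a"
  by (cases a; simp)+

lemma frac_eq_if_diff_Ints: "x - y \<in> \<int> \<Longrightarrow> frac x = frac (y::real)"
  by (elim Ints_cases) (simp add: frac_def diff_eq_eq)

text \<open>Finitely many fractional parts play the role of discreteness: below a fixed element only
  finitely many integer parts occur, and a number is determined by its two parts.\<close>

lemma bounded_below_finite_frac_has_min:
  fixes S :: "real set"
  assumes "S \<noteq> {}" "finite (frac ` S)" and below: "\<And>s. s \<in> S \<Longrightarrow> m \<le> s"
  shows "\<exists>s\<in>S. \<forall>t\<in>S. s \<le> t"
proof -
  obtain s0 where s0: "s0 \<in> S" using assms by blast
  define T where "T = {s \<in> S. s \<le> s0}"
  have inj: "inj_on (\<lambda>s. (\<lfloor>s\<rfloor>, frac s)) T" by (auto simp: inj_on_def frac_def)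
  have "(\<lambda>s. (\<lfloor>s\<rfloor>, frac s)) ` T \<subseteq> {\<lfloor>m\<rfloor>..\<lfloor>s0\<rfloor>} \<times> frac ` S"
    by (auto simp: T_def intro!: floor_mono below)
  then have "finite ((\<lambda>s. (\<lfloor>s\<rfloor>, frac s)) ` T)"
    by (rule finite_subset) (simp add: assms(2))
  then have fin: "finite T" using inj by (rule finite_imageD)
  have ne: "T \<noteq> {}" using s0 by (auto simp: T_def)
  have "Min T \<in> S" using Min_in[OF fin ne] by (simp add: T_def)
  moreover have "Min T \<le> t" if "t \<in> S" for t
    using Min_le[OF fin, of t] Min_le[OF fin, of s0] s0 that by (cases "t \<le> s0") (auto simp: T_def)
  ultimately show ?thesis by blast
qed

section \<open>Rational norms and duality\<close>

lemma rational_norm_finite: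
  assumes "rational_norm v s X \<alpha>" "x \<in> X" "x \<noteq> 0"
  obtains r where "\<alpha> x = ereal r"
proof -
  have "\<alpha> x = \<infinity> \<or> (\<exists>q::rat. \<alpha> x = ereal (of_rat q))" "\<alpha> x \<noteq> \<infinity>"
    using assms unfolding rational_norm_def by blast+
  then show ?thesis using that by blast
qed

lemma rational_norm_neq_MInfty:
  assumes "rational_norm v s X \<alpha>" "x \<in> X" shows "\<alpha> x \<noteq> -\<infinity>"
proof -
  have "\<alpha> x = \<infinity> \<or> (\<exists>q::rat. \<alpha> x = ereal (of_rat q))"
    using assms unfolding rational_norm_def by blast
  then show ?thesis by auto
qed

lemma rational_norm_add:
  "rational_norm v s X \<alpha> \<Longrightarrow> x \<in> X \<Longrightarrow> y \<in> X \<Longrightarrow> m \<le> \<alpha> x \<Longrightarrow> m \<le> \<alpha> y \<Longrightarrow> m \<le> \<alpha> (x + y)"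
  unfolding rational_norm_def by (meson min.boundedI order_trans)

lemma rational_norm_scale: "rational_norm v s X \<alpha> \<Longrightarrow> x \<in> X \<Longrightarrow> \<alpha> (s c x) = v c + \<alpha> x"
  unfolding rational_norm_def by blast

lemma rational_norm_eq_PInfty_iff: "rational_norm v s X \<alpha> \<Longrightarrow> x \<in> X \<Longrightarrow> \<alpha> x = \<infinity> \<longleftrightarrow> x = 0"
  unfolding rational_norm_def by blast

lemma rational_norm_rational:
  "rational_norm v s X \<alpha> \<Longrightarrow> x \<in> X \<Longrightarrow> \<alpha> x = \<infinity> \<or> (\<exists>q::rat. \<alpha> x = ereal (of_rat q))"
  unfolding rational_norm_def by blast

text \<open>Only the scaling law mentions the scalars, so it alone has to be checked again when
  passing to a subspace or to another field. This is how F-norms on \<open>W\<close> become norms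
  over the quadratic extension.\<close>

lemma rational_norm_transfer:
  assumes A: "rational_norm v s X \<alpha>" and YX: "Y \<subseteq> X"
    and scale: "\<And>c x. x \<in> Y \<Longrightarrow> \<alpha> (t c x) = w c + \<alpha> x"
  shows "rational_norm w t Y \<alpha>"
  unfolding rational_norm_def
proof (intro conjI ballI allI)
  fix x assume xY: "x \<in> Y"
  then have x: "x \<in> X" using YX by blast
  show "\<alpha> x = \<infinity> \<or> (\<exists>q::rat. \<alpha> x = ereal (of_rat q))" by (rule rational_norm_rational[OF A x])
  show "\<alpha> x = \<infinity> \<longleftrightarrow> x = 0" by (rule rational_norm_eq_PInfty_iff[OF A x])
  show "\<alpha> (t c x) = w c + \<alpha> x" for c by (rule scale[OF xY])
  fix y assume "y \<in> Y"
  then have y: "y \<in> X" using YX by blast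
  show "min (\<alpha> x) (\<alpha> y) \<le> \<alpha> (x + y)" by (rule rational_norm_add[OF A x y]) auto
qed

text \<open>An extended real is determined by its lower bounds, and \<open>\<alpha> y\<close> is
  finite for nonzero \<open>y\<close>, so the subtraction can be moved to the other side.\<close>

lemma self_dual_iff:
  assumes N: "rational_norm v s X \<alpha>"
  shows "self_dual v h X \<alpha> \<longleftrightarrow> (\<forall>x\<in>X. \<forall>m. m \<le> \<alpha> x \<longleftrightarrow> (\<forall>y\<in>X - {0}. m + \<alpha> y \<le> v (h x y)))"
proof -
  have le: "m \<le> (INF y\<in>X - {0}. v (h x y) - \<alpha> y) \<longleftrightarrow> (\<forall>y\<in>X - {0}. m + \<alpha> y \<le> v (h x y))" for m x
  proof -
    have "m \<le> v (h x y) - \<alpha> y \<longleftrightarrow> m + \<alpha> y \<le> v (h x y)" if y: "y \<in> X - {0}" for y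
    proof -
      obtain r where "\<alpha> y = ereal r" by (rule rational_norm_finite[OF N]) (use y in auto)
      then show ?thesis by (simp add: ereal_le_minus_real_iff)
    qed
    then show ?thesis by (simp add: le_INF_iff)
  qed
  have eq: "a = b \<longleftrightarrow> (\<forall>m. m \<le> a \<longleftrightarrow> m \<le> b)" for a b :: ereal
    by (meson antisym order_refl)
  show ?thesis unfolding self_dual_def by (subst eq) (simp only: le)
qed

lemma self_dual_le_iff:
  "self_dual_norm v s h X \<alpha> \<Longrightarrow> x \<in> X \<Longrightarrow> m \<le> \<alpha> x \<longleftrightarrow> (\<forall>y\<in>X - {0}. m + \<alpha> y \<le> v (h x y))"
  unfolding self_dual_norm_def using self_dual_iff by blast

lemma self_dual_add_le:
  "self_dual_norm v s h X \<alpha> \<Longrightarrow> x \<in> X \<Longrightarrow> y \<in> X \<Longrightarrow> y \<noteq> 0 \<Longrightarrow> \<alpha> x + \<alpha> y \<le> v (h x y)"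
  using self_dual_le_iff[of v s h X \<alpha> x "\<alpha> x"] by blast

text \<open>Valuation and norm are multiplied by the same factor, so every duality inequality is
  just multiplied by it. The factor is rational in order that the values remain rational.\<close>

lemma self_dual_norm_rescale:
  fixes q :: rat
  assumes q: "0 < q" and N: "self_dual_norm v s h X \<alpha>"
  shows "self_dual_norm (\<lambda>a. ereal (of_rat q) * v a) s h X (\<lambda>x. ereal (of_rat q) * \<alpha> x)"
proof -
  let ?r = "of_rat q :: real"
  have r: "0 < ?r" using q by simp
  have A: "rational_norm v s X \<alpha>" using N by (simp add: self_dual_norm_def)
  have R: "rational_norm (\<lambda>a. ereal ?r * v a) s X (\<lambda>x. ereal ?r * \<alpha> x)"
    unfolding rational_norm_def
  proof (intro conjI ballI allI)
    fix x assume x: "x \<in> X"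
    show "ereal ?r * \<alpha> x = \<infinity> \<or> (\<exists>q::rat. ereal ?r * \<alpha> x = ereal (of_rat q))"
      using rational_norm_rational[OF A x] r by (auto simp: of_rat_mult[symmetric])
    show "ereal ?r * \<alpha> (s c x) = ereal ?r * v c + ereal ?r * \<alpha> x" for c
      using r by (simp add: rational_norm_scale[OF A x] ereal_mult_distrib_pos)
    show "ereal ?r * \<alpha> x = \<infinity> \<longleftrightarrow> x = 0"
      using rational_norm_eq_PInfty_iff[OF A x] r rational_norm_neq_MInfty[OF A x]
      by (cases "\<alpha> x") auto
    fix y assume y: "y \<in> X"
    have "min (\<alpha> x) (\<alpha> y) \<le> \<alpha> (x + y)" by (rule rational_norm_add[OF A x y]) auto
    then show "min (ereal ?r * \<alpha> x) (ereal ?r * \<alpha> y) \<le> ereal ?r * \<alpha> (x + y)"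
      using r by (simp add: min_def ereal_mult_le_cancel_pos split: if_splits)
  qed
  have "self_dual (\<lambda>a. ereal ?r * v a) h X (\<lambda>x. ereal ?r * \<alpha> x)"
    unfolding self_dual_iff[OF R]
  proof (intro ballI allI)
    fix x m assume x: "x \<in> X"
    define m' where "m' = ereal (1 / ?r) * m"
    have m: "m = ereal ?r * m'" using r by (simp add: m'_def ereal_mult_inverse_pos del: times_ereal.simps)
    show "m \<le> ereal ?r * \<alpha> x \<longleftrightarrow> (\<forall>y\<in>X - {0}. m + ereal ?r * \<alpha> y \<le> ereal ?r * v (h x y))"
      unfolding m ereal_mult_distrib_pos[OF r, symmetric] ereal_mult_le_cancel_pos[OF r]
      by (rule self_dual_le_iff[OF N x])
  qed
  then show ?thesis using R by (simp add: self_dual_norm_def)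
qed

context valued_field
begin

lemma val_mult3_ge:
  assumes "ereal p \<le> v a" "ereal q \<le> v b" "ereal r \<le> v c"
  shows "ereal (p + q + r) \<le> v (a * b * c)"
  using add_mono[OF add_mono[OF assms(1,2)] assms(3)] by (simp add: val_mult)

text \<open>Each of the six products in the determinant takes one entry from every row and every
  column, so its bound is the sum of all \<open>x i\<close> and \<open>y k\<close>.\<close>

lemma val_det_ge:
  fixes A :: "'k^3^3"
  assumes "\<And>i k. ereal (x i + y k) \<le> v (A$i$k)"
  shows "ereal (sum x UNIV + sum y UNIV) \<le> v (det A)"
proof -
  have t: "ereal (sum x UNIV + sum y UNIV) \<le> v (A$1$a * A$2$b * A$3$c)"
    if "y a + y b + y c = sum y UNIV" for a b c
  proof -
    have "sum x UNIV + sum y UNIV = (x 1 + y a) + (x 2 + y b) + (x 3 + y c)"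
      using that by (simp add: sum_3)
    then show ?thesis using val_mult3_ge[OF assms assms assms, of 1 a 2 b 3 c] by simp
  qed
  show ?thesis unfolding det_3
    by (intro val_ge_add val_ge_diff t) (simp_all add: sum_3)
qed

end

lemma det_mat_inverse:
  fixes A :: "'k::field^'n^'n"
  assumes "A ** B = mat 1"
  shows "det A * det B = 1" "det A \<noteq> 0"
proof -
  show *: "det A * det B = 1" using assms by (metis det_mul det_I)
  then show "det A \<noteq> 0" by auto
qed

section \<open>Volumes of lattices under change of basis\<close>

locale valued_vector_space = valued_field v + vector_space s
  for v :: "'k::field \<Rightarrow> ereal" and s :: "'k \<Rightarrow> 'v \<Rightarrow> 'v::ab_group_add"
begin

lemma lattice_of_eq_transform:
  assumes "\<And>i. b i \<in> lattice_of v s c"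
  obtains U where "b = transform s c U" "0 \<le> v (det U)"
proof -
  have "\<exists>d. b k = (\<Sum>i\<in>UNIV. s (d i) (c i)) \<and> (\<forall>i. v (d i) \<ge> 0)" for k
    using assms[of k] by (auto simp: lattice_of_def)
  then obtain d where d: "\<And>k. b k = (\<Sum>i\<in>UNIV. s (d k i) (c i))" "\<And>k i. v (d k i) \<ge> 0"
    by metis
  define U :: "'k^3^3" where "U = (\<chi> i k. d k i)"
  have "b = transform s c U" using d by (auto simp: transform_def U_def)
  moreover have "0 \<le> v (det U)"
    using val_det_ge[of "\<lambda>_. 0" "\<lambda>_. 0" U] d by (simp add: U_def zero_ereal_def)
  ultimately show ?thesis by (rule that)
qed

lemma mem_lattice_of: "b k \<in> lattice_of v s b"
proof -
  have "b k = (\<Sum>i\<in>UNIV. s (if i = k then 1 else 0) (b i))"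
    by (simp add: if_distrib[of "\<lambda>c. s c _"] cong: if_cong)
  moreover have "\<forall>i. 0 \<le> v (if i = k then 1 else 0)" by simp
  ultimately show ?thesis unfolding lattice_of_def mem_Collect_eq
    by (intro exI[of _ "\<lambda>i. if i = k then 1 else 0"] conjI)
qed

lemma linear_automorphism_sum:
  assumes g: "linear_automorphism_on s W g" and b: "\<And>i. b i \<in> W" and W: "subspace W"
  shows "g (\<Sum>i\<in>(UNIV::3 set). s (c i) (b i)) = (\<Sum>i\<in>UNIV. s (c i) (g (b i)))"
proof -
  have "s (c i) (b i) \<in> W" for i using b W by (simp add: subspace_scale)
  then show ?thesis using g b subspace_add[OF W]
    by (simp add: sum_3 linear_automorphism_on_def)
qed

lemma subspace_basis3: "basis3 s W b \<Longrightarrow> subspace W"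
  by (auto simp: basis3_def)

lemma ex_linear_automorphism:
  assumes b: "basis3 s W b" and c: "basis3 s W c"
  obtains g where "linear_automorphism_on s W g" "\<And>i. g (b i) = c i"
proof -
  define g where "g x = (\<Sum>i\<in>UNIV. s (representation (range b) x (b i)) (c i))" for x
  have g: "g (\<Sum>i\<in>UNIV. s (d i) (b i)) = (\<Sum>i\<in>UNIV. s (d i) (c i))" for d
    by (simp add: g_def basis3_representation[OF b])
  have gb: "g (b k) = c k" for k
    using g[of "\<lambda>i. if i = k then 1 else 0"]
    by (simp add: if_distrib[of "\<lambda>c. s c _"] cong: if_cong)
  have inj: "inj_on g W"
  proof (rule inj_onI)
    fix x y assume xy: "x \<in> W" "y \<in> W" "g x = g y"
    obtain d where d: "x = (\<Sum>i\<in>UNIV. s (d i) (b i))" by (rule basis3_coords[OF b xy(1)])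
    obtain d' where d': "y = (\<Sum>i\<in>UNIV. s (d' i) (b i))" by (rule basis3_coords[OF b xy(2)])
    from d d'  have "d = d'" using xy(3) basis3_coords_unique[OF c, of d d'] by (simp add: g)
    then show "x = y" by (simp add: d d')
  qed
  have "g ` W = W"
  proof (intro equalityI subsetI)
    fix y assume "y \<in> g ` W" then show "y \<in> W" using basis3_sum_mem[OF c] by (auto simp: g_def)
  next
    fix y assume "y \<in> W"
    then obtain d where "y = (\<Sum>i\<in>UNIV. s (d i) (c i))" by (rule basis3_coords[OF c])
    then have "y = g (\<Sum>i\<in>UNIV. s (d i) (b i))" by (simp add: g)
    then show "y \<in> g ` W" using basis3_sum_mem[OF b] by blast
  qed
  moreover have "g (x + y) = g x + g y" if mem: "x \<in> W" "y \<in> W" for x y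
  proof -
    obtain d where d: "x = (\<Sum>i\<in>UNIV. s (d i) (b i))" by (rule basis3_coords[OF b mem(1)])
    obtain d' where d': "y = (\<Sum>i\<in>UNIV. s (d' i) (b i))" by (rule basis3_coords[OF b mem(2)])
    have "x + y = (\<Sum>i\<in>UNIV. s (d i + d' i) (b i))"
      by (simp add: d d' sum.distrib scale_left_distrib)
    then have "g (x + y) = (\<Sum>i\<in>UNIV. s (d i + d' i) (c i))" by (simp only: g)
    also have "\<dots> = g x + g y" by (simp add: d d' g sum.distrib scale_left_distrib)
    finally show ?thesis .
  qed
  moreover have "g (s a x) = s a (g x)" if mem: "x \<in> W" for a x
  proof -
    obtain d where d: "x = (\<Sum>i\<in>UNIV. s (d i) (b i))" by (rule basis3_coords[OF b mem])
    have "s a x = (\<Sum>i\<in>UNIV. s (a * d i) (b i))" by (simp add: d scale_sum_right)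
    then have "g (s a x) = (\<Sum>i\<in>UNIV. s (a * d i) (c i))" by (simp only: g)
    also have "\<dots> = s a (g x)" by (simp add: d g scale_sum_right)
    finally show ?thesis .
  qed
  ultimately have "linear_automorphism_on s W g"
    using inj by (simp add: linear_automorphism_on_def bij_betw_def)
  then show ?thesis using gb that by blast
qed

lemma lattice_of_image:
  assumes "linear_automorphism_on s W g" "basis3 s W b"
  shows "g ` lattice_of v s b = lattice_of v s (g \<circ> b)"
proof -
  have *: "g (\<Sum>i\<in>UNIV. s (c i) (b i)) = (\<Sum>i\<in>UNIV. s (c i) ((g \<circ> b) i))" for c
    using linear_automorphism_sum[OF assms(1) basis3_mem subspace_basis3, OF assms(2,2)] by simp
  have "lattice_of v s d = (\<lambda>c. \<Sum>i\<in>UNIV. s (c i) (d i)) ` {c. \<forall>i. v (c i) \<ge> 0}" for d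
    by (auto simp: lattice_of_def)
  then show ?thesis by (simp add: image_image *)
qed

text \<open>In \<open>lattice_volume\<close> the basis used for the determinant is arbitrary; a
  change of basis conjugates the matrix.\<close>

lemma det_endo_matrix:
  assumes g: "linear_automorphism_on s W g" and b: "basis3 s W b" and c: "basis3 s W c"
    and G: "g \<circ> b = transform s b G"
  shows "det (endo_matrix s c g) = det G"
proof -
  obtain P P' where P: "c = transform s b P" "b = transform s c P'" "P ** P' = mat 1" "P' ** P = mat 1"
    by (rule obtain_basis_change[OF b c])
  have "(g \<circ> c) k = transform s (g \<circ> b) P k" for k
    using linear_automorphism_sum[OF g basis3_mem subspace_basis3, OF b b]
    by (simp add: P(1) transform_def)
  then have "g \<circ> c = transform s (transform s b G) P" by (auto simp: G)
  also have "\<dots> = transform s b (G ** P)" by (rule transform_transform)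
  also have "\<dots> = transform s c (P' ** (G ** P))" by (subst P(2)) (rule transform_transform)
  finally have "endo_matrix s c g = P' ** (G ** P)" by (rule endo_matrix_eq[OF c])
  then have "det (endo_matrix s c g) = det G * (det P' * det P)" by (simp add: det_mul)
  then show ?thesis using det_mat_inverse[OF P(4)] by simp
qed

text \<open>Two automorphisms carrying the reference lattice to the same lattice differ by a matrix
  that is integral with integral inverse. Its determinant has valuation 0, which makes the definite
  description unambiguous.\<close>

lemma lattice_volume_transform:
  assumes b: "basis3 s W b" and A: "det A \<noteq> 0"
  shows "lattice_volume v s W (lattice_of v s b) (lattice_of v s (transform s b A)) = v (det A)"
  unfolding lattice_volume_def
proof (rule the_equality)
  let ?c = "transform s b A"
  have c: "basis3 s W ?c" by (rule basis3_transform[OF b A])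
  obtain g where g: "linear_automorphism_on s W g" "\<And>i. g (b i) = ?c i"
    using ex_linear_automorphism[OF b c] by blast
  have gb: "g \<circ> b = ?c" using g by auto
  show "\<exists>g d. linear_automorphism_on s W g \<and> g ` lattice_of v s b = lattice_of v s ?c \<and>
      basis3 s W d \<and> v (det A) = v (det (endo_matrix s d g))"
    using g(1) b lattice_of_image[OF g(1) b] det_endo_matrix[OF g(1) b b gb] by (metis gb)
  fix n
  assume "\<exists>g d. linear_automorphism_on s W g \<and> g ` lattice_of v s b = lattice_of v s ?c \<and>
      basis3 s W d \<and> n = v (det (endo_matrix s d g))"
  then obtain g d where g: "linear_automorphism_on s W g"
    and im: "g ` lattice_of v s b = lattice_of v s ?c" and d: "basis3 s W d"
    and n: "n = v (det (endo_matrix s d g))" by blast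
  have L: "lattice_of v s (g \<circ> b) = lattice_of v s ?c"
    using lattice_of_image[OF g b] im by simp
  obtain U where U: "g \<circ> b = transform s ?c U" "0 \<le> v (det U)"
    using lattice_of_eq_transform[of "g \<circ> b" ?c] mem_lattice_of L by metis
  obtain U' where U': "?c = transform s (g \<circ> b) U'" "0 \<le> v (det U')"
    using lattice_of_eq_transform[of ?c "g \<circ> b"] mem_lattice_of L by metis
  have "transform s ?c (U ** U') = transform s ?c (mat 1)"
    using U U' by (metis transform_transform transform_mat_1)
  then have "U ** U' = mat 1" using transform_cong_iff[OF c] by blast
  note UU = det_mat_inverse[OF this]
  then obtain m where m: "v (det U) = ereal (of_int m)" by (meson val_finite)
  have "v (det U) + v (det U') = 0" using UU by (metis val_mult val_1)
  then have "v (det U) = 0" using U(2) U'(2) m by (cases "v (det U')") auto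
  moreover have "g \<circ> b = transform s b (A ** U)" using U by (simp add: transform_transform)
  then have "det (endo_matrix s d g) = det (A ** U)" by (rule det_endo_matrix[OF g b d])
  ultimately show "n = v (det A)" by (simp add: n det_mul val_mult)
qed

section \<open>Norm classes modulo the integers and splitting bases\<close>

lemma norm_add_neq:
  assumes N: "rational_norm v s X \<alpha>" and X: "subspace X" and xy: "x \<in> X" "y \<in> X" "\<alpha> x < \<alpha> y"
  shows "\<alpha> (x + y) = \<alpha> x"
proof (rule antisym)
  show "\<alpha> x \<le> \<alpha> (x + y)" by (rule rational_norm_add[OF N]) (use xy in auto)
  have my: "\<alpha> (- y) = \<alpha> y" using rational_norm_scale[OF N xy(2), of "- 1"] by simp
  show "\<alpha> (x + y) \<le> \<alpha> x"
  proof (rule ccontr)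
    assume *: "\<not> \<alpha> (x + y) \<le> \<alpha> x"
    have "min (\<alpha> (x + y)) (\<alpha> y) \<le> \<alpha> ((x + y) + - y)"
      using xy X my by (intro rational_norm_add[OF N, of "x + y"]) (auto simp: subspace_add subspace_neg)
    then show False using * xy by (simp add: min_def split: if_splits)
  qed
qed

lemma norm_sum_distinct:
  assumes N: "rational_norm v s X \<alpha>" and X: "subspace X"
    and A: "finite A" "A \<noteq> {}" "\<And>a. a \<in> A \<Longrightarrow> g a \<in> X" "inj_on (\<lambda>a. \<alpha> (g a)) A"
  shows "\<alpha> (sum g A) \<in> (\<lambda>a. \<alpha> (g a)) ` A"
  using A
proof (induction A rule: finite_ne_induct)
  case (insert a A)
  then have "\<alpha> (sum g A) \<in> (\<lambda>a. \<alpha> (g a)) ` A" by simp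
  then obtain b where b: "b \<in> A" "\<alpha> (sum g A) = \<alpha> (g b)" by blast
  then have neq: "\<alpha> (g a) \<noteq> \<alpha> (sum g A)" using insert by (auto simp: inj_on_def)
  have mem: "g a \<in> X" "sum g A \<in> X" using insert.prems X by (auto intro: subspace_sum)
  have "\<alpha> (g a + sum g A) = \<alpha> (g a) \<or> \<alpha> (g a + sum g A) = \<alpha> (sum g A)"
    using neq norm_add_neq[OF N X mem] norm_add_neq[OF N X mem(2,1)]
    by (metis add.commute linorder_neqE)
  then show ?case using insert.hyps b by auto
qed simp

text \<open>Vectors whose norms are pairwise incongruent modulo \<open>\<int>\<close> are linearly independent.\<close>

lemma finite_norm_classes:
  assumes b: "basis3 s W b" and N: "rational_norm v s W \<alpha>"
  shows "finite ((\<lambda>x. frac (real_of_ereal (\<alpha> x))) ` (W - {0}))"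
proof (rule ccontr)
  let ?f = "\<lambda>x. frac (real_of_ereal (\<alpha> x))"
  assume "infinite (?f ` (W - {0}))"
  \<comment> \<open>Four is one more than the dimension of \<open>W\<close>.\<close>
  then obtain T where T: "T \<subseteq> ?f ` (W - {0})" "finite T" "card T = 4"
    by (rule infinite_arbitrarily_large[THEN exE]) blast
  obtain Y where Y: "Y \<subseteq> W - {0}" "inj_on ?f Y" "T = ?f ` Y"
    using T(1) by (metis subset_image_inj)
  have fin: "finite Y" using T(2) Y(2,3) by (simp add: finite_image_iff)
  have card: "card Y = 4" using T(3) Y(2,3) by (simp add: card_image)
  have W: "subspace W" by (rule subspace_basis3[OF b])
  have "independent Y"
    unfolding dependent_finite[OF fin]
  proof
    assume "\<exists>u. (\<exists>v\<in>Y. u v \<noteq> 0) \<and> (\<Sum>v\<in>Y. s (u v) v) = 0"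
    then obtain u where u: "\<exists>y\<in>Y. u y \<noteq> 0" "(\<Sum>y\<in>Y. s (u y) y) = 0" by blast
    define Z where "Z = {y \<in> Y. u y \<noteq> 0}"
    have Z: "finite Z" "Z \<noteq> {}" using fin u by (auto simp: Z_def)
    have sum: "(\<Sum>y\<in>Z. s (u y) y) = 0"
      using u(2) sum.mono_neutral_right[OF fin, of Z "\<lambda>y. s (u y) y"] by (auto simp: Z_def)
    have mem: "s (u y) y \<in> W" if "y \<in> Z" for y
      using that Y(1) W by (auto simp: Z_def intro: subspace_scale)
    have cls: "?f (s (u y) y) = ?f y" if "y \<in> Z" for y
    proof -
      have y: "y \<in> W" "y \<noteq> 0" "u y \<noteq> 0" using that Y(1) by (auto simp: Z_def)
      obtain r where r: "\<alpha> y = ereal r" using rational_norm_finite[OF N y(1,2)] .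
      obtain n where n: "v (u y) = ereal (of_int n)" using val_finite[OF y(3)] .
      show ?thesis using y
        by (intro frac_eq_if_diff_Ints) (simp add: rational_norm_scale[OF N] r n)
    qed
    have inj: "inj_on (\<lambda>y. \<alpha> (s (u y) y)) Z"
    proof (rule inj_onI)
      fix y z assume yz: "y \<in> Z" "z \<in> Z" "\<alpha> (s (u y) y) = \<alpha> (s (u z) z)"
      then have "?f y = ?f z" using cls by metis
      then show "y = z" using Y(2) yz by (auto simp: Z_def inj_on_def)
    qed
    \<comment> \<open>Terms with distinct norms cannot cancel: the sum has the norm of one of them,
      so a vanishing sum would contain a vanishing term.\<close>
    have "\<alpha> 0 \<in> (\<lambda>y. \<alpha> (s (u y) y)) ` Z"
      using norm_sum_distinct[OF N W Z mem inj] by (simp add: sum)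
    then obtain y where y: "y \<in> Z" "\<alpha> 0 = \<alpha> (s (u y) y)" by blast
    then have "\<alpha> (s (u y) y) = \<infinity>" using rational_norm_eq_PInfty_iff[OF N subspace_0[OF W]] by simp
    then have "s (u y) y = 0" using rational_norm_eq_PInfty_iff[OF N mem[OF y(1)]] by simp
    then show False using y Y(1) by (auto simp: Z_def)
  qed
  moreover have "Y \<subseteq> span (range b)" using Y(1) b by (auto simp: basis3_def)
  ultimately have "card Y \<le> card (range b)"
    using independent_span_bound[of "range b" Y] by simp
  also have "\<dots> \<le> card (UNIV :: 3 set)" by (rule card_image_le) simp
  finally show False using card by simp
qed

lemma basis3_of_independent:
  assumes b: "basis3 s W b" and c: "\<And>i. c i \<in> W"
    and ind: "\<And>x k. (\<Sum>i\<in>UNIV. s (x i) (c i)) = 0 \<Longrightarrow> x k = 0"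
  shows "basis3 s W c"
proof -
  obtain A where A: "c = transform s b A" using obtain_transform[OF b c] .
  have "x = 0" if "A *v x = 0" for x
  proof -
    have "(\<Sum>i\<in>UNIV. s (x$i) (c i)) = 0" by (simp add: A sum_transform that)
    then show ?thesis using ind[of "($) x"] by (simp add: vec_eq_iff)
  qed
  then have "det A \<noteq> 0"
    by (metis matrix_left_invertible_ker invertible_left_inverse invertible_det_nz)
  then show ?thesis unfolding A by (rule basis3_transform[OF b])
qed

text \<open>Right multiplication by this matrix exchanges the i-th basis vector for the combination
  with coefficients \<open>c\<close>.\<close>

lemma det_replace_column:
  "det (\<chi> l k. if k = i then c l else if l = k then 1 else 0 :: 'k^3^3) = c i"
proof -
  have "i = 1 \<or> i = 2 \<or> i = 3" by (rule exhaust_3)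
  then show ?thesis by (auto simp: det_3)
qed

text \<open>A basis \<open>b A\<close> for which the defect \<open>v (det A) - \<Sum>i. \<alpha> (b A i)\<close> is minimal splits \<open>\<alpha>\<close>: if a
  combination of the basis had a larger norm than its terms predict, exchanging it for a basis
  vector would lower the defect. The values of the defect are discrete by
  finiteness of the norm classes, so the minimum exists as soon as the defect is bounded below.\<close>

lemma ex_splitting_basis:
  assumes b: "basis3 s W b" and N: "rational_norm v s W \<alpha>"
    and below: "\<And>A. det A \<noteq> 0 \<Longrightarrow> (\<Sum>i\<in>UNIV. \<alpha> (transform s b A i)) \<le> v (det A)"
  obtains c where "basis3 s W c" "basis_splits s c \<alpha>"
proof -
  let ?r = "\<lambda>x. real_of_ereal (\<alpha> x)"
  define \<delta> where "\<delta> A = real_of_ereal (v (det A)) - (\<Sum>i\<in>UNIV. ?r (transform s b A i))" for A :: "'k^3^3"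
  let ?R = "(\<lambda>x. frac (?r x)) ` (W - {0})"
  have nz: "transform s b A i \<in> W - {0}" if "det A \<noteq> 0" for A i
  proof -
    have c: "basis3 s W (transform s b A)" by (rule basis3_transform[OF b that])
    then have "independent (range (transform s b A))" by (simp add: basis3_def)
    then have "transform s b A i \<noteq> 0" using dependent_zero by (metis rangeI)
    then show ?thesis using basis3_mem[OF c] by blast
  qed
  have val: "\<alpha> x = ereal (?r x)" if mem: "x \<in> W - {0}" for x
  proof -
    obtain r where "\<alpha> x = ereal r" by (rule rational_norm_finite[OF N, of x]) (use mem in auto)
    then show ?thesis by simp
  qed
  have valv: "v a = ereal (real_of_ereal (v a))" if "a \<noteq> 0" for a
    by (rule val_finite[OF that]) simp
  let ?S = "\<delta> ` {A. det A \<noteq> 0}"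
  \<comment> \<open>The valuation of the determinant is an integer, so modulo 1 the defect depends
    only on the classes of three norms.\<close>
  have "frac ` ?S \<subseteq> (\<lambda>(x, y, z). frac (- (x + y + z))) ` (?R \<times> ?R \<times> ?R)"
  proof clarify
    fix A :: "'k^3^3" assume A: "det A \<noteq> 0"
    let ?x = "\<lambda>i. ?r (transform s b A i)"
    obtain n where n: "v (det A) = ereal (of_int n)" by (rule val_finite[OF A])
    have "\<delta> A - - (frac (?x 1) + frac (?x 2) + frac (?x 3)) = of_int (n - \<lfloor>?x 1\<rfloor> - \<lfloor>?x 2\<rfloor> - \<lfloor>?x 3\<rfloor>)"
      by (simp add: \<delta>_def n sum_3 frac_def)
    then have "frac (\<delta> A) = frac (- (frac (?x 1) + frac (?x 2) + frac (?x 3)))"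
      by (intro frac_eq_if_diff_Ints) (metis Ints_of_int)
    moreover have "frac (?x i) \<in> ?R" for i using nz[OF A, of i] by blast
    ultimately show "frac (\<delta> A) \<in> (\<lambda>(x, y, z). frac (- (x + y + z))) ` (?R \<times> ?R \<times> ?R)"
      by (intro image_eqI[of _ _ "(frac (?x 1), frac (?x 2), frac (?x 3))"]) auto
  qed
  then have fin: "finite (frac ` ?S)"
    using finite_norm_classes[OF b N] by (meson finite_SigmaI finite_imageI finite_subset)
  have "det (mat 1 :: 'k^3^3) \<noteq> 0" by simp
  then have ne: "?S \<noteq> {}" by blast
  have low: "0 \<le> d" if d: "d \<in> ?S" for d
  proof -
    obtain A where A: "det A \<noteq> 0" "d = \<delta> A" using d by blast
    have "ereal (\<Sum>i\<in>UNIV. ?r (transform s b A i)) \<le> v (det A)"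
      unfolding sum_ereal[symmetric] val[OF nz[OF A(1)], symmetric] by (rule below[OF A(1)])
    then have "ereal (\<Sum>i\<in>UNIV. ?r (transform s b A i)) \<le> ereal (real_of_ereal (v (det A)))"
      using valv[OF A(1)] by metis
    then show ?thesis by (simp add: A(2) \<delta>_def)
  qed
  obtain d where d: "d \<in> ?S" "\<forall>t\<in>?S. d \<le> t"
    using bounded_below_finite_frac_has_min[OF ne fin low] by metis
  from d(1) obtain A where A: "det A \<noteq> 0" "d = \<delta> A" by blast
  have min: "\<delta> A \<le> \<delta> B" if "det B \<noteq> 0" for B
    using d(2) that A(2) by simp
  define c where "c = transform s b A"
  have c: "basis3 s W c" unfolding c_def by (rule basis3_transform[OF b A(1)])
  have "basis_splits s c \<alpha>"
    unfolding basis_splits_def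
  proof
    fix a
    let ?x = "\<Sum>i\<in>UNIV. s (a i) (c i)"
    let ?M = "Min (range (\<lambda>i. \<alpha> (s (a i) (c i))))"
    have W: "subspace W" by (rule subspace_basis3[OF b])
    have mem: "s (a i) (c i) \<in> W" for i using basis3_mem[OF c] W by (simp add: subspace_scale)
    have M: "?M \<le> \<alpha> (s (a i) (c i))" for i by (rule Min_le) auto
    have "?M \<le> \<alpha> ?x"
      unfolding sum_3 using mem M subspace_add[OF W] by (intro rational_norm_add[OF N]) auto
    moreover have "\<not> ?M < \<alpha> ?x"
    proof
      assume less: "?M < \<alpha> ?x"
      have "?M \<in> range (\<lambda>i. \<alpha> (s (a i) (c i)))" by (rule Min_in) auto
      then obtain i where "?M = \<alpha> (s (a i) (c i))" by blast
      with less have i: "\<alpha> (s (a i) (c i)) < \<alpha> ?x" by (simp only:)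
      have ai: "a i \<noteq> 0"
        using i rational_norm_eq_PInfty_iff[OF N subspace_0[OF W]] by auto
      define E :: "'k^3^3" where "E = (\<chi> l k. if k = i then a l else if l = k then 1 else 0)"
      have detE: "det E = a i" unfolding E_def by (rule det_replace_column)
      have cE: "transform s c E = c(i := ?x)"
        by (auto simp: transform_def E_def if_distrib[of "\<lambda>c. s c _"] cong: if_cong)
      have AE: "transform s b (A ** E) = c(i := ?x)" using cE by (simp only: c_def transform_transform)
      have dAE: "det (A ** E) \<noteq> 0" using A(1) ai by (simp add: det_mul detE)
      have x0: "?x \<in> W - {0}" using nz[OF dAE, of i] by (simp add: AE)
      have ci: "c i \<in> W - {0}" using nz[OF A(1), of i] by (simp add: c_def)
      obtain n m where n: "v (det A) = ereal (of_int n)" and m: "v (a i) = ereal (of_int m)"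
        using val_finite[OF A(1)] val_finite[OF ai] by metis
      have "(\<Sum>k\<in>UNIV. ?r ((c(i := ?x)) k)) = ?r ?x + (\<Sum>k\<in>UNIV - {i}. ?r (c k))"
        by (simp add: sum.remove[of UNIV i])
      moreover have "(\<Sum>k\<in>UNIV. ?r (c k)) = ?r (c i) + (\<Sum>k\<in>UNIV - {i}. ?r (c k))"
        by (simp add: sum.remove[of UNIV i])
      \<comment> \<open>The determinant gains the factor \<open>a i\<close> and the norm of
        \<open>c i\<close> gives way to that of \<open>?x\<close>. The defect changes by the norm of
        the i-th term minus the norm of \<open>?x\<close>, which is negative by the choice of
        \<open>i\<close>.\<close>
      ultimately have "\<delta> (A ** E) = \<delta> A + of_int m + ?r (c i) - ?r ?x"
        by (simp only: \<delta>_def AE) (simp add: det_mul detE val_mult n m c_def)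
      moreover have "of_int m + ?r (c i) < ?r ?x"
      proof -
        have "\<alpha> (s (a i) (c i)) = ereal (of_int m) + \<alpha> (c i)"
          using ci by (simp add: rational_norm_scale[OF N] m)
        also have "\<dots> = ereal (of_int m + ?r (c i))" by (subst val[OF ci]) simp
        finally have "\<alpha> (s (a i) (c i)) = ereal (of_int m + ?r (c i))" .
        then show ?thesis using i val[OF x0] by (metis ereal_less(2) less_ereal.simps(1))
      qed
      ultimately show False using min[OF dAE] by simp
    qed
    ultimately show "\<alpha> ?x = ?M" by auto
  qed
  then show ?thesis using c that by blast
qed

end

section \<open>Composition algebras with a quadratic subfield\<close>

locale composition_alg =
  fixes sc :: "'f::field \<Rightarrow> 'v \<Rightarrow> 'v::{ab_group_add,times,one}" and Q :: "'v \<Rightarrow> 'f"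
  assumes composition: "composition_algebra sc Q"
    and nontrivial: "\<exists>x::'v. x \<noteq> 0"
begin

abbreviation B :: "'v \<Rightarrow> 'v \<Rightarrow> 'f" where "B \<equiv> polar Q"

sublocale vector_space sc
  using composition by (simp add: composition_algebra_def)

lemma mult_add_left: "(x + y) * z = x * z + y * z" for x y z :: 'v
proof -
  interpret Vector_Spaces.linear sc sc "\<lambda>x. x * z" using composition by (simp add: composition_algebra_def)
  show ?thesis by (rule add)
qed

lemma mult_add_right: "z * (x + y) = z * x + z * y" for x y z :: 'v
proof -
  interpret Vector_Spaces.linear sc sc "\<lambda>x. z * x" using composition by (simp add: composition_algebra_def)
  show ?thesis by (rule add)
qed

lemma mult_sc_left: "sc a x * z = sc a (x * z)"
proof -
  interpret Vector_Spaces.linear sc sc "\<lambda>x. x * z" using composition by (simp add: composition_algebra_def)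
  show ?thesis by (rule scale)
qed

lemma mult_sc_right: "z * sc a x = sc a (z * x)"
proof -
  interpret Vector_Spaces.linear sc sc "\<lambda>x. z * x" using composition by (simp add: composition_algebra_def)
  show ?thesis by (rule scale)
qed

lemma mult_one [simp]: "1 * x = x" "x * 1 = x" for x :: 'v
  using composition by (auto simp: composition_algebra_def)

lemma Q_scale: "Q (sc a x) = a\<^sup>2 * Q x" and Q_mult: "Q (x * y) = Q x * Q y"
  using composition by (auto simp: composition_algebra_def)

lemma mult_zero [simp]: "0 * x = 0" "x * 0 = 0" for x :: 'v
  using mult_add_left[of 0 0 x] mult_add_right[of x 0 0] by auto

lemma mult_minus_left: "(- x) * y = - (x * y)" for x y :: 'v
  using mult_add_left[of x "- x" y] by (simp add: eq_neg_iff_add_eq_0 add.commute)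

lemma mult_minus_right: "x * (- y) = - (x * y)" for x y :: 'v
  using mult_add_right[of x y "- y"] by (simp add: eq_neg_iff_add_eq_0 add.commute)

lemma mult_diff_left: "(x - y) * z = x * z - y * z" for x y z :: 'v
  using mult_add_left[of x "- y" z] by (simp add: mult_minus_left)

lemma mult_diff_right: "z * (x - y) = z * x - z * y" for x y z :: 'v
  using mult_add_right[of z x "- y"] by (simp add: mult_minus_right)

lemmas mult_distribs = mult_add_left mult_add_right mult_diff_left mult_diff_right
  mult_minus_left mult_minus_right mult_sc_left mult_sc_right

lemma polar_commute: "B x y = B y x"
  by (simp add: polar_def add.commute)

lemma polar_add_left: "B (x + y) z = B x z + B y z"
proof -
  interpret Vector_Spaces.linear sc "(*)" "\<lambda>x. B x z" using composition by (simp add: composition_algebra_def)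
  show ?thesis by (rule add)
qed

lemma polar_scale_left: "B (sc a x) z = a * B x z"
proof -
  interpret Vector_Spaces.linear sc "(*)" "\<lambda>x. B x z" using composition by (simp add: composition_algebra_def)
  show ?thesis by (rule scale)
qed

lemma polar_add_right: "B z (x + y) = B z x + B z y"
  using polar_add_left[of x y z] by (simp add: polar_commute[of z])

lemma polar_scale_right: "B z (sc a x) = a * B z x"
  using polar_scale_left[of a x z] by (simp add: polar_commute[of z])

lemma polar_zero [simp]: "B 0 x = 0" "B x 0 = 0"
  using polar_scale_left[of 0 0 x] polar_scale_right[of x 0 0] by auto

lemma polar_minus_left: "B (- x) y = - B x y"
  using polar_add_left[of x "- x" y] by (simp add: eq_neg_iff_add_eq_0 add.commute)

lemma polar_minus_right: "B x (- y) = - B x y"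
  using polar_minus_left[of y x] by (simp add: polar_commute[of x])

lemma polar_diff_left: "B (x - y) z = B x z - B y z"
  using polar_add_left[of x "- y" z] by (simp add: polar_minus_left)

lemma polar_diff_right: "B z (x - y) = B z x - B z y"
  using polar_diff_left[of x y z] by (simp add: polar_commute[of z])

lemmas polar_distribs = polar_add_left polar_add_right polar_diff_left polar_diff_right
  polar_minus_left polar_minus_right polar_scale_left polar_scale_right

lemma Q_add: "Q (x + y) = Q x + Q y + B x y"
  by (simp add: polar_def)

lemma polar_self: "B x x = 2 * Q x"
proof -
  have "x + x = sc 2 x" by (metis one_add_one scale_left_distrib scale_one)
  then have "Q (x + x) = 4 * Q x" by (simp add: Q_scale)
  then show ?thesis by (simp add: polar_def)
qed

lemma polar_eqI: "(\<And>z. B x z = B y z) \<Longrightarrow> x = y"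
proof -
  assume "\<And>z. B x z = B y z"
  then have "\<forall>z. B (x - y) z = 0" by (simp add: polar_diff_left)
  then have "x - y = 0"
    using composition unfolding composition_algebra_def nondegenerate_on_def by blast
  then show ?thesis by simp
qed

lemma Q_one: "Q 1 = 1"
proof -
  obtain x :: 'v where "x \<noteq> 0" using nontrivial ..
  then obtain y where "B x y \<noteq> 0" using polar_eqI[of x 0] by auto
  then obtain z where "Q z \<noteq> 0" by (metis polar_def diff_zero)
  moreover have "Q (1 * z) = Q 1 * Q z" by (rule Q_mult)
  ultimately show ?thesis by simp
qed

lemma polar_mult_left: "B (x * y) (x * z) = Q x * B y z"
  using Q_mult[of x "y + z"] by (simp add: mult_distribs Q_add Q_mult algebra_simps)

lemma polar_mult_right: "B (x * z) (y * z) = B x y * Q z"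
  using Q_mult[of "x + y" z] by (simp add: mult_distribs Q_add Q_mult algebra_simps)

text \<open>Polarization of the multiplicativity of \<open>Q\<close> in both factors. Setting one
  argument to 1 makes multiplication by \<open>conjugate x\<close> adjoint to multiplication by
  \<open>x\<close>.\<close>

lemma polar_mult_exchange: "B (x * y) (w * z) + B (w * y) (x * z) = B x w * B y z"
  using polar_mult_left[of "x + w" y z] polar_commute[of w x]
  by (simp add: mult_distribs polar_distribs Q_add polar_mult_left algebra_simps)

definition conjugate :: "'v \<Rightarrow> 'v" where "conjugate x = sc (B x 1) 1 - x"

lemma polar_mult_adjoint_left: "B (x * y) z = B y (conjugate x * z)"
  using polar_mult_exchange[of x y 1 z]
  by (simp add: conjugate_def mult_distribs polar_distribs algebra_simps)

lemma polar_mult_adjoint_right: "B (x * y) z = B x (z * conjugate y)"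
  using polar_mult_exchange[of x y z 1] polar_commute[of "z * y" x]
  by (simp add: conjugate_def mult_distribs polar_distribs algebra_simps)

lemma conj_conj [simp]: "conjugate (conjugate x) = x"
  by (simp add: conjugate_def polar_distribs polar_self Q_one scale_left_diff_distrib scale_left_distrib)

lemma polar_conj: "B (conjugate x) y = B x (conjugate y)"
  using polar_commute[of y 1] by (simp add: conjugate_def polar_distribs)

text \<open>By adjointness, pairing the left side with \<open>z\<close> gives
  \<open>B (x * y) (x * z)\<close>, and nondegeneracy concludes. Expanding
  \<open>conjugate x\<close> here yields the quadratic equation of \<open>x\<close> and the left
  alternative law, which replace associativity.\<close>

lemma conj_mult_cancel: "conjugate x * (x * y) = sc (Q x) y"
  by (rule polar_eqI)
    (simp add: polar_mult_adjoint_left[of "conjugate x"] polar_mult_left polar_scale_left)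

lemma mult_conj_cancel: "(y * x) * conjugate x = sc (Q x) y"
  by (rule polar_eqI)
    (simp add: polar_mult_adjoint_right[of _ "conjugate x"] polar_mult_right polar_scale_left mult.commute)

lemma conj_mult: "conjugate (x * y) = conjugate y * conjugate x"
proof (rule polar_eqI)
  fix z
  have "B (conjugate y * conjugate x) z = B (conjugate x) (y * z)"
    by (simp add: polar_mult_adjoint_left[of "conjugate y"])
  also have "\<dots> = B (y * z) (conjugate x)" by (rule polar_commute)
  also have "\<dots> = B y (conjugate x * conjugate z)" by (rule polar_mult_adjoint_right)
  also have "\<dots> = B (conjugate x * conjugate z) y" by (rule polar_commute)
  also have "\<dots> = B z (conjugate (x * y))"
    by (simp add: polar_mult_adjoint_left[of "conjugate x"] polar_conj)
  finally show "B (conjugate (x * y)) z = B (conjugate y * conjugate x) z" by (simp add: polar_commute[of z])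
qed

lemma mult_self: "x * x = sc (B x 1) x - sc (Q x) 1"
  using conj_mult_cancel[of x 1] by (simp add: conjugate_def mult_distribs algebra_simps)

lemma left_alternative: "x * (x * z) = (x * x) * z" for x z :: 'v
  using conj_mult_cancel[of x z] by (simp add: mult_self conjugate_def mult_distribs algebra_simps)

lemma right_alternative: "(z * x) * x = z * (x * x)" for x z :: 'v
  using mult_conj_cancel[of z x] by (simp add: mult_self conjugate_def mult_distribs algebra_simps)

lemma left_alternative_linearized: "x * (y * z) + y * (x * z) = (x * y + y * x) * z" for x y z :: 'v
  using left_alternative[of "x + y" z]
  by (simp add: mult_distribs left_alternative algebra_simps)

end

section \<open>Trace, norm and hermitian form of the quadratic subfield\<close>

locale hermitian_composition_alg = composition_alg sc Q
  for sc :: "'f::field \<Rightarrow> 'v \<Rightarrow> 'v::{ab_group_add,times,one}" and Q :: "'v \<Rightarrow> 'f" +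
  fixes vF :: "'f \<Rightarrow> ereal"
    and \<iota> :: "'f \<Rightarrow> 'e::field"
    and j :: "'e \<Rightarrow> 'v"
    and vE :: "'e \<Rightarrow> ereal"
    and e :: nat
    and \<sigma> :: "'e \<Rightarrow> 'e"
    and \<Phi> :: "'v \<Rightarrow> 'v \<Rightarrow> 'e"
    and V0 W :: "'v set"
    and scE :: "'e \<Rightarrow> 'v \<Rightarrow> 'v"
  assumes local_field: "nonarch_local_field vF"
    and residue_char_neq_2: "residue_char vF \<noteq> 2"
    and subfield: "quadratic_composition_subfield sc Q \<iota> j"
    and V0_def: "V0 = range j"
    and W_def: "W = orth_complement Q V0"
    and scE_def: "scE = (\<lambda>c x. j c * x)"
    and vE_normalized: "normalized_valuation vE"
    and vE_\<iota>: "vE (\<iota> a) = ereal (real e) * vF a"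
    and automorphism: "nontrivial_automorphism \<iota> \<sigma>"
    and hermitian: "hermitian_form scE \<sigma> \<Phi>"
    and trace_form: "B x y = quadratic_trace \<iota> \<sigma> (\<Phi> x y)"
begin

sublocale F: valued_field vF
  using local_field by unfold_locales (simp add: nonarch_local_field_def)

sublocale E: valued_field vE
  by unfold_locales (rule vE_normalized)

sublocale EV: valued_vector_space vE scE
proof -
  \<comment> \<open>Linearity of \<Phi> comprises the vector space axioms for \<open>scE\<close>, in
    particular the associativity \<open>j_assoc\<close> in the nonassociative algebra.\<close>
  have "Vector_Spaces.linear scE (*) (\<lambda>x. \<Phi> x y)" for y
    using hermitian unfolding hermitian_form_def by blast
  then have "vector_space scE" by (simp add: Vector_Spaces.linear_def)
  then show "valued_vector_space vE scE"
    by (simp add: valued_vector_space_def E.valued_field_axioms)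
qed

lemma j_add: "j (a + b) = j a + j b" and j_mult: "j (a * b) = j a * j b"
  and j_1 [simp]: "j 1 = 1" and j_\<iota>: "j (\<iota> d) = sc d 1"
  using subfield by (auto simp: quadratic_composition_subfield_def)

lemma j_0 [simp]: "j 0 = 0"
  using j_add[of 0 0] by simp

lemma j_minus: "j (- a) = - j a"
  using j_add[of a "- a"] by (simp add: eq_neg_iff_add_eq_0 add.commute)

lemma j_diff: "j (a - b) = j a - j b"
  using j_add[of a "- b"] by (simp add: j_minus)

lemma one_neq_0: "(1::'v) \<noteq> 0"
  using nontrivial mult_one(1) mult_zero(1) by metis

lemma j_eq_0_iff [simp]: "j a = 0 \<longleftrightarrow> a = 0"
proof
  assume "j a = 0"
  then have "j (a * inverse a) = 0" by (simp add: j_mult)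
  then show "a = 0" using one_neq_0 by (cases "a = 0") auto
qed simp

lemma j_eq_iff [simp]: "j a = j b \<longleftrightarrow> a = b"
  using j_eq_0_iff[of "a - b"] by (simp add: j_diff del: j_eq_0_iff)

lemma \<iota>_add: "\<iota> (a + b) = \<iota> a + \<iota> b" and \<iota>_diff: "\<iota> (a - b) = \<iota> a - \<iota> b"
  and \<iota>_mult: "\<iota> (a * b) = \<iota> a * \<iota> b" and \<iota>_1 [simp]: "\<iota> 1 = 1" and \<iota>_0 [simp]: "\<iota> 0 = 0"
  by (simp_all flip: j_eq_iff add: j_add j_diff j_mult j_\<iota> scale_left_distrib
      scale_left_diff_distrib mult_sc_left)

lemma \<iota>_eq_iff [simp]: "\<iota> a = \<iota> b \<longleftrightarrow> a = b"
  by (simp flip: j_eq_iff add: j_\<iota> one_neq_0)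

lemma \<iota>_eq_0_iff [simp]: "\<iota> a = 0 \<longleftrightarrow> a = 0"
  using \<iota>_eq_iff[of a 0] by (simp del: \<iota>_eq_iff)

lemma \<iota>_2: "\<iota> 2 = 2"
  by (metis \<iota>_add \<iota>_1 one_add_one)

lemma j_\<iota>_mult: "j (\<iota> a) * x = sc a x"
  by (simp add: j_\<iota> mult_sc_left)

lemma e_pos: "0 < e"
proof (rule ccontr)
  assume "\<not> 0 < e"
  then have "vE (\<iota> 0) = 0" by (simp only: vE_\<iota>) simp
  then show False by simp
qed

lemma vE_2: "vE 2 = 0"
  using vE_\<iota>[of 2] val_2_eq_0[OF F.normalized residue_char_neq_2] by (simp add: \<iota>_2)

lemma two_neq_0: "(2::'e) \<noteq> 0"
  using vE_2 by auto

lemma scE: "scE c x = j c * x"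
  by (simp add: scE_def)

lemma j_assoc: "j a * (j b * x) = j (a * b) * x"
  using EV.scale_scale[of a b x] by (simp add: scE)

lemma quadratic_relation: "c * c = \<iota> (B (j c) 1) * c - \<iota> (Q (j c))"
  by (simp flip: j_eq_iff add: j_mult j_diff j_\<iota> mult_self[of "j c"] mult_sc_left)

lemma \<sigma>_add: "\<sigma> (a + b) = \<sigma> a + \<sigma> b" and \<sigma>_mult: "\<sigma> (a * b) = \<sigma> a * \<sigma> b"
  and \<sigma>_\<iota> [simp]: "\<sigma> (\<iota> d) = \<iota> d"
  using automorphism by (auto simp: nontrivial_automorphism_def)

lemma \<sigma>_0 [simp]: "\<sigma> 0 = 0" and \<sigma>_1 [simp]: "\<sigma> 1 = 1"
  using \<sigma>_\<iota>[of 0] \<sigma>_\<iota>[of 1] by simp_all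

lemma \<sigma>_minus: "\<sigma> (- a) = - \<sigma> a"
  using \<sigma>_add[of a "- a"] by (simp add: eq_neg_iff_add_eq_0 add.commute)

lemma \<sigma>_diff: "\<sigma> (a - b) = \<sigma> a - \<sigma> b"
  using \<sigma>_add[of a "- b"] by (simp add: \<sigma>_minus)

lemma \<sigma>_moves: obtains a where "\<sigma> a \<noteq> a"
  using automorphism unfolding nontrivial_automorphism_def by (metis eq_id_iff)

text \<open>If \<sigma> moves \<open>c\<close>, then \<open>c\<close> and \<open>\<sigma> c\<close>
  are the two roots of the quadratic equation of \<open>c\<close>, and the trace is read off its
  coefficients. A fixed \<open>c\<close> is the difference of the moved elements
  \<open>a + c\<close> and \<open>a\<close>.\<close>

lemma trace: "c + \<sigma> c = \<iota> (B (j c) 1)"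
proof -
  have moved: "c + \<sigma> c = \<iota> (B (j c) 1)" if "\<sigma> c \<noteq> c" for c
  proof -
    have "\<sigma> c * \<sigma> c = \<iota> (B (j c) 1) * \<sigma> c - \<iota> (Q (j c))"
      using arg_cong[OF quadratic_relation, of \<sigma> c] by (simp add: \<sigma>_mult \<sigma>_diff)
    then have "(c - \<sigma> c) * (c + \<sigma> c - \<iota> (B (j c) 1)) = 0"
      using quadratic_relation[of c] by algebra
    then show ?thesis using that by simp
  qed
  show ?thesis
  proof (cases "\<sigma> c = c")
    case True
    obtain a where a: "\<sigma> a \<noteq> a" by (rule \<sigma>_moves)
    have eqs: "\<iota> (B (j (a + c)) 1) = (a + c) + \<sigma> (a + c)" "\<iota> (B (j a) 1) = a + \<sigma> a"
      by (rule moved[symmetric], simp add: \<sigma>_add a True)+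
    have "\<iota> (B (j c) 1) = \<iota> (B (j (a + c)) 1) - \<iota> (B (j a) 1)"
      by (simp add: j_add polar_distribs \<iota>_add)
    also have "\<dots> = c + \<sigma> c" by (simp only: eqs) (simp add: \<sigma>_add)
    finally show ?thesis by simp
  qed (rule moved)
qed

text \<open>The trace of \<open>c\<close> comes from F and is fixed by \<sigma>, so
  \<open>\<sigma> c\<close> has the same trace as \<open>c\<close>.\<close>

lemma \<sigma>_\<sigma> [simp]: "\<sigma> (\<sigma> c) = c"
proof -
  have "\<sigma> c + \<sigma> (\<sigma> c) = c + \<sigma> c" by (metis trace \<sigma>_add \<sigma>_\<iota>)
  then show ?thesis by (simp add: add.commute)
qed

lemma \<sigma>_eq_0_iff [simp]: "\<sigma> c = 0 \<longleftrightarrow> c = 0"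
  by (metis \<sigma>_0 \<sigma>_\<sigma>)

lemma norm: "c * \<sigma> c = \<iota> (Q (j c))"
proof -
  have "c * \<sigma> c = (c + \<sigma> c) * c - c * c" by (simp add: algebra_simps)
  also have "\<dots> = \<iota> (Q (j c))" unfolding trace quadratic_relation[of c] by simp
  finally show ?thesis .
qed

lemma \<iota>_polar: "\<iota> (B x y) = \<Phi> x y + \<sigma> (\<Phi> x y)"
  using trace[of "\<Phi> x y"] by (simp add: trace_form quadratic_trace_def)

lemma \<Phi>_linear: "Vector_Spaces.linear scE (*) (\<lambda>x. \<Phi> x y)"
  and \<Phi>_commute: "\<Phi> y x = \<sigma> (\<Phi> x y)"
  using hermitian unfolding hermitian_form_def by blast+

lemma \<Phi>_add_left: "\<Phi> (x + y) z = \<Phi> x z + \<Phi> y z"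
proof -
  interpret L: Vector_Spaces.linear scE "(*)" "\<lambda>x. \<Phi> x z" by (rule \<Phi>_linear)
  show ?thesis by (rule L.add)
qed

lemma \<Phi>_mult_left: "\<Phi> (j c * x) z = c * \<Phi> x z"
proof -
  interpret L: Vector_Spaces.linear scE "(*)" "\<lambda>x. \<Phi> x z" by (rule \<Phi>_linear)
  show ?thesis using L.scale by (simp add: scE)
qed

lemma \<Phi>_add_right: "\<Phi> z (x + y) = \<Phi> z x + \<Phi> z y"
  by (metis \<Phi>_commute \<Phi>_add_left \<sigma>_add)

lemma \<Phi>_mult_right: "\<Phi> z (j c * x) = \<sigma> c * \<Phi> z x"
  by (metis \<Phi>_commute \<Phi>_mult_left \<sigma>_mult)

lemma \<Phi>_zero [simp]: "\<Phi> 0 x = 0" "\<Phi> x 0 = 0"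
  using \<Phi>_mult_left[of 0 0 x] \<Phi>_mult_right[of x 0 0] by auto

lemma \<Phi>_minus_left: "\<Phi> (- x) y = - \<Phi> x y"
  using \<Phi>_add_left[of x "- x" y] by (simp add: eq_neg_iff_add_eq_0 add.commute)

lemma \<Phi>_minus_right: "\<Phi> x (- y) = - \<Phi> x y"
  using \<Phi>_add_right[of x y "- y"] by (simp add: eq_neg_iff_add_eq_0 add.commute)

lemma \<Phi>_diff_left: "\<Phi> (x - y) z = \<Phi> x z - \<Phi> y z"
  using \<Phi>_add_left[of x "- y" z] by (simp add: \<Phi>_minus_left)

lemma \<Phi>_diff_right: "\<Phi> z (x - y) = \<Phi> z x - \<Phi> z y"
  using \<Phi>_add_right[of z x "- y"] by (simp add: \<Phi>_minus_right)

lemma \<Phi>_sum_left: "\<Phi> (sum f A) z = (\<Sum>i\<in>A. \<Phi> (f i) z)"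
  by (induction A rule: infinite_finite_induct) (auto simp: \<Phi>_add_left)

lemma \<Phi>_sum_right: "\<Phi> z (sum f A) = (\<Sum>i\<in>A. \<Phi> z (f i))"
  by (induction A rule: infinite_finite_induct) (auto simp: \<Phi>_add_right)

lemmas \<Phi>_distribs = \<Phi>_add_left \<Phi>_add_right \<Phi>_diff_left \<Phi>_diff_right
  \<Phi>_minus_left \<Phi>_minus_right \<Phi>_mult_left \<Phi>_mult_right

lemma \<Phi>_self: "\<Phi> x x = \<iota> (Q x)"
proof -
  have "2 * \<iota> (Q x) = \<Phi> x x + \<sigma> (\<Phi> x x)" by (metis \<iota>_polar polar_self \<iota>_mult \<iota>_2)
  also have "\<sigma> (\<Phi> x x) = \<Phi> x x" by (rule \<Phi>_commute[symmetric])
  finally have "2 * \<Phi> x x = 2 * \<iota> (Q x)" by (metis mult_2)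
  from mult_left_cancel[OF two_neq_0, THEN iffD1, OF this] show ?thesis .
qed

lemma \<Phi>_j: "\<Phi> (j a) (j b) = a * \<sigma> b"
  using \<Phi>_mult_left[of a 1 "j b"] \<Phi>_mult_right[of 1 b 1] by (simp add: \<Phi>_self Q_one)

text \<open>At \<open>c = \<sigma> d\<close> the trace is twice the norm of \<open>d\<close>. This
  lemma is the device for passing from \<open>B\<close> to \<Phi>.\<close>

lemma trace_nondegenerate:
  assumes "\<And>c. c * d + \<sigma> (c * d) = 0" shows "d = 0"
  using assms[of "\<sigma> d"] two_neq_0 by (simp add: \<sigma>_mult mult.commute mult_2[symmetric])

lemma conj_j: "conjugate (j c) = j (\<sigma> c)"
proof -
  have "\<sigma> c = \<iota> (B (j c) 1) - c" using trace[of c] by (simp add: algebra_simps)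
  then show ?thesis by (simp add: conjugate_def j_diff j_\<iota>)
qed

text \<open>As \<open>V0\<close> is the line spanned by 1 over the extension, orthogonality to it
  for \<open>B\<close> is the vanishing of the traces of all multiples of
  \<open>\<Phi> w 1\<close>.\<close>

lemma W_iff: "w \<in> W \<longleftrightarrow> \<Phi> w 1 = 0"
proof
  assume w: "w \<in> W"
  show "\<Phi> w 1 = 0"
  proof (rule trace_nondegenerate)
    fix c
    have "B w (j (\<sigma> c)) = 0" using w by (auto simp: W_def V0_def orth_complement_def)
    then have "\<Phi> w (j (\<sigma> c) * 1) + \<sigma> (\<Phi> w (j (\<sigma> c) * 1)) = 0" using \<iota>_polar[of w "j (\<sigma> c)"] by simp
    then show "c * \<Phi> w 1 + \<sigma> (c * \<Phi> w 1) = 0" by (simp only: \<Phi>_mult_right) simp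
  qed
next
  assume w: "\<Phi> w 1 = 0"
  have "B w (j c) = 0" for c
  proof -
    have "\<Phi> w (j c * 1) = 0" using w by (simp only: \<Phi>_mult_right) simp
    then have "\<iota> (B w (j c)) = \<iota> 0" by (simp add: \<iota>_polar)
    then show ?thesis by simp
  qed
  then show "w \<in> W" by (auto simp: W_def V0_def orth_complement_def)
qed

lemma W_0 [simp]: "0 \<in> W" and W_add: "x \<in> W \<Longrightarrow> y \<in> W \<Longrightarrow> x + y \<in> W"
  and W_diff: "x \<in> W \<Longrightarrow> y \<in> W \<Longrightarrow> x - y \<in> W" and W_mult: "x \<in> W \<Longrightarrow> j c * x \<in> W"
  by (simp_all add: W_iff \<Phi>_distribs)

lemma \<Phi>_W_j: "w \<in> W \<Longrightarrow> \<Phi> w (j c) = 0" and \<Phi>_j_W: "w \<in> W \<Longrightarrow> \<Phi> (j c) w = 0"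
proof -
  assume "w \<in> W"
  then show "\<Phi> w (j c) = 0" using \<Phi>_mult_right[of w c 1] by (simp add: W_iff)
  then show "\<Phi> (j c) w = 0" by (simp add: \<Phi>_commute[of "j c" w])
qed

lemma decompose: obtains w where "w \<in> W" "x = j (\<Phi> x 1) + w"
proof
  show "x - j (\<Phi> x 1) \<in> W"
    using \<Phi>_j[of "\<Phi> x 1" 1] by (simp add: W_iff \<Phi>_distribs)
qed simp

lemma polar_W_1: "w \<in> W \<Longrightarrow> B w 1 = 0"
  using \<iota>_polar[of w 1] \<iota>_eq_iff[of "B w 1" 0] by (simp add: W_iff)

lemma conj_W: "w \<in> W \<Longrightarrow> conjugate w = - w"
  by (simp add: conjugate_def polar_W_1)

text \<open>Conjugation is -1 on \<open>W\<close> and \<sigma> on \<open>V0\<close>, and it reverses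
  the product \<open>j (\<sigma> c) * w\<close>, which lies in \<open>W\<close>.\<close>

lemma mult_W_j: "w \<in> W \<Longrightarrow> w * j c = j (\<sigma> c) * w"
  using conj_mult[of "j (\<sigma> c)" w] by (simp add: conj_W W_mult conj_j mult_minus_left)

lemma \<Phi>_nondegenerate: "(\<And>y. y \<in> W \<Longrightarrow> \<Phi> x y = 0) \<Longrightarrow> x \<in> W \<Longrightarrow> x = 0"
proof (rule polar_eqI)
  fix z assume *: "\<And>y. y \<in> W \<Longrightarrow> \<Phi> x y = 0" "x \<in> W"
  obtain w where w: "w \<in> W" "z = j (\<Phi> z 1) + w" by (rule decompose)
  have "\<Phi> x z = 0" by (subst w(2)) (simp add: \<Phi>_add_right \<Phi>_W_j * w(1))
  then show "B x z = B 0 z" using \<iota>_polar[of x z] \<iota>_eq_iff[of "B x z" 0] by simp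
qed

text \<open>The adjoint of right multiplication by \<open>y\<close> is right multiplication by
  \<open>- y\<close>; applied against \<open>j (\<sigma> c)\<close> this compares the traces of all
  multiples of both sides.\<close>

lemma \<Phi>_mult_1: 
  assumes "x \<in> W" "y \<in> W" shows "\<Phi> (x * y) 1 = - \<Phi> x y"
proof -
  have "\<Phi> (x * y) 1 + \<Phi> x y = 0"
  proof (rule trace_nondegenerate)
    fix c
    have "B (x * y) (j (\<sigma> c)) = - B x (j (\<sigma> c) * y)"
      using assms by (simp add: polar_mult_adjoint_right[of x y] conj_W mult_minus_right polar_minus_right)
    then have "\<iota> (B (x * y) (j (\<sigma> c))) + \<iota> (B x (j (\<sigma> c) * y)) = 0"
      by (simp flip: \<iota>_add)
    then show "c * (\<Phi> (x * y) 1 + \<Phi> x y) + \<sigma> (c * (\<Phi> (x * y) 1 + \<Phi> x y)) = 0"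
      using \<Phi>_mult_right[of "x * y" "\<sigma> c" 1]
      by (simp add: \<iota>_polar \<Phi>_mult_right \<sigma>_add \<sigma>_mult algebra_simps)
  qed
  then show ?thesis by (simp add: eq_neg_iff_add_eq_0)
qed

section \<open>The antilinear vector product on \<open>W\<close>\<close>

definition cross :: "'v \<Rightarrow> 'v \<Rightarrow> 'v" where "cross x y = x * y + j (\<Phi> x y)"

lemma cross_mem: "x \<in> W \<Longrightarrow> y \<in> W \<Longrightarrow> cross x y \<in> W"
  using \<Phi>_j[of "\<Phi> x y" 1] \<Phi>_mult_1[of x y] unfolding W_iff[of "cross x y"]
  by (simp add: cross_def \<Phi>_add_left)

lemma mult_eq_cross: "x * y = cross x y - j (\<Phi> x y)"
  by (simp add: cross_def)

lemma cross_add_left: "cross (x + y) z = cross x z + cross y z"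
  and cross_add_right: "cross z (x + y) = cross z x + cross z y"
  by (simp_all add: cross_def mult_distribs \<Phi>_distribs j_add algebra_simps)

text \<open>In the linearized left alternative law for \<open>j c\<close> and \<open>x\<close>, the
  anticommutator is \<open>j c + j (\<sigma> c)\<close> times \<open>x\<close>, that is, a scalar
  from F times \<open>x\<close>. This scalar can be pulled out of the product with \<open>y\<close>,
  and subtracting \<open>j c * (x * y)\<close> leaves the factor \<open>\<sigma> c\<close>.\<close>

lemma cross_mult_right: "x \<in> W \<Longrightarrow> cross x (j c * y) = j (\<sigma> c) * cross x y"
proof -
  assume x: "x \<in> W"
  have sig: "j (\<sigma> c) * z = sc (B (j c) 1) z - j c * z" for z
  proof -
    have "\<sigma> c = \<iota> (B (j c) 1) - c" using trace[of c] by (simp add: algebra_simps)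
    then show ?thesis by (simp add: j_diff mult_diff_left j_\<iota>_mult)
  qed
  have "j c * (x * y) + x * (j c * y) = (j c * x + j (\<sigma> c) * x) * y"
    using left_alternative_linearized[of "j c" x y] by (simp add: mult_W_j[OF x])
  also have "\<dots> = sc (B (j c) 1) (x * y)" by (simp add: sig mult_sc_left)
  finally have "x * (j c * y) = j (\<sigma> c) * (x * y)" by (simp add: sig algebra_simps)
  then show ?thesis by (simp add: cross_def mult_add_right \<Phi>_mult_right j_mult)
qed

lemma cross_commute: "x \<in> W \<Longrightarrow> y \<in> W \<Longrightarrow> cross y x = - cross x y"
proof -
  assume *: "x \<in> W" "y \<in> W"
  have "conjugate (x * y) = y * x" using * by (simp add: conj_mult conj_W mult_distribs)
  moreover have "conjugate (a - b) = conjugate a - conjugate b" for a b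
    by (simp add: conjugate_def polar_distribs scale_left_diff_distrib)
  then have "conjugate (x * y) = - cross x y - j (\<sigma> (\<Phi> x y))"
    by (simp add: mult_eq_cross conj_W cross_mem * conj_j)
  ultimately have "y * x = - cross x y - j (\<sigma> (\<Phi> x y))" by simp
  then show ?thesis by (simp add: cross_def[of y x] \<Phi>_commute[of y x])
qed

lemma cross_mult_left: "x \<in> W \<Longrightarrow> y \<in> W \<Longrightarrow> cross (j c * x) y = j (\<sigma> c) * cross x y"
  using cross_commute[of y x] cross_commute[of y "j c * x"] 
  by (simp add: W_mult cross_mult_right mult_minus_right)

text \<open>Left multiplication by \<open>x\<close> is skew for \<open>B\<close> because
  \<open>conjugate x = - x\<close>. Replacing \<open>y\<close> by its multiples lifts this to
  \<Phi>, so that \<open>\<Phi> (cross x y) z\<close> is alternating.\<close>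

lemma \<Phi>_cross_swap:
  assumes "x \<in> W" "y \<in> W" "z \<in> W" shows "\<Phi> (cross x y) z = - \<Phi> (cross x z) y"
proof -
  have swap: "B (cross x y) z = - B y (cross x z)" if "y \<in> W" "z \<in> W" for y z
  proof -
    have \<Phi>0: "B (j a) w = 0" "B w (j a) = 0" if "w \<in> W" for a w
      using that \<iota>_polar[of w "j a"] \<iota>_polar[of "j a" w] \<iota>_eq_iff[of _ 0] by (auto simp: \<Phi>_W_j \<Phi>_j_W)
    have "B (x * y) z = - B y (x * z)"
      using assms by (simp add: polar_mult_adjoint_left[of x] conj_W mult_minus_left polar_minus_right)
    then show ?thesis using that by (simp add: cross_def polar_distribs \<Phi>0)
  qed
  have "\<Phi> (cross x y) z + \<Phi> (cross x z) y = 0"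
  proof (rule trace_nondegenerate)
    fix c
    have "B (cross x (j (\<sigma> c) * y)) z = - B (j (\<sigma> c) * y) (cross x z)"
      using assms by (intro swap) (simp_all add: W_mult)
    then have "\<iota> (B (cross x (j (\<sigma> c) * y)) z) + \<iota> (B (j (\<sigma> c) * y) (cross x z)) = 0"
      by (simp flip: \<iota>_add)
    then show "c * (\<Phi> (cross x y) z + \<Phi> (cross x z) y)
        + \<sigma> (c * (\<Phi> (cross x y) z + \<Phi> (cross x z) y)) = 0"
      using assms by (simp add: \<iota>_polar cross_mult_right \<Phi>_mult_left \<sigma>_add \<sigma>_mult
          \<Phi>_commute[of y "cross x z"] algebra_simps)
  qed
  then show ?thesis by (simp add: eq_neg_iff_add_eq_0)
qed

lemma \<Phi>_cross_right: "x \<in> W \<Longrightarrow> y \<in> W \<Longrightarrow> \<Phi> (cross x y) y = 0"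
proof -
  assume "x \<in> W" "y \<in> W"
  then have "\<Phi> (cross x y) y + \<Phi> (cross x y) y = 0"
    by (intro eq_neg_iff_add_eq_0[THEN iffD1] \<Phi>_cross_swap)
  then have "2 * \<Phi> (cross x y) y = 0" by (simp only: mult_2)
  then show ?thesis using two_neq_0 by simp
qed

lemma \<Phi>_cross_left: "x \<in> W \<Longrightarrow> y \<in> W \<Longrightarrow> \<Phi> (cross x y) x = 0"
  using \<Phi>_cross_right[of y x] cross_commute[of x y] by (simp add: \<Phi>_minus_left)

text \<open>The product \<open>(x * y) * y\<close> is computed twice: by the right alternative law,
  and by splitting each product into its components in \<open>V0\<close> and
  \<open>W\<close>.\<close>

lemma cross_cross_same:
  assumes "x \<in> W" "y \<in> W"
  shows "cross (cross x y) y = j (\<Phi> x y) * y - j (\<Phi> y y) * x"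
proof -
  have "(x * y) * y = - sc (Q y) x"
    using assms by (simp add: right_alternative mult_self[of y] polar_W_1 mult_minus_right mult_sc_right)
  moreover have "(x * y) * y = cross (cross x y) y - j (\<Phi> x y) * y"
    using assms by (simp add: mult_eq_cross[of x y] mult_diff_left mult_eq_cross[of "cross x y" y] \<Phi>_cross_right)
  ultimately show ?thesis by (simp add: \<Phi>_self j_\<iota>_mult algebra_simps)
qed

text \<open>Both sides are linear in \<open>y\<close> and antilinear in \<open>z\<close>, and a sesquilinear map that vanishes
  on the diagonal is zero because \<open>\<sigma> \<noteq> id\<close>.\<close>

lemma cross_cross:
  assumes "x \<in> W" "y \<in> W" "z \<in> W"
  shows "cross (cross x y) z = j (\<Phi> x z) * y - j (\<Phi> y z) * x"
proof -
  define D where "D = (\<lambda>y z. cross (cross x y) z - (j (\<Phi> x z) * y - j (\<Phi> y z) * x))"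
  have D_add: "D (y + y') z = D y z + D y' z" "D z (y + y') = D z y + D z y'" for y y' z
    by (simp_all add: D_def cross_add_left cross_add_right mult_distribs \<Phi>_distribs j_add algebra_simps)
  have D_left: "D (j c * y) z = j c * D y z" if "y \<in> W" "z \<in> W" for c y z
    using that assms by (simp add: D_def cross_mult_right cross_mult_left cross_mem mult_distribs \<Phi>_distribs
        j_assoc mult.commute)
  have D_right: "D y (j c * z) = j (\<sigma> c) * D y z" if "y \<in> W" "z \<in> W" for c y z
    using that assms by (simp add: D_def cross_mult_right cross_mem mult_distribs \<Phi>_distribs j_assoc)
  have D_same: "D y y = 0" if "y \<in> W" for y
    using that assms by (simp add: D_def cross_cross_same)
  have anti: "D y z + D z y = 0" if "y \<in> W" "z \<in> W" for y z
    using D_same[of "y + z"] D_same[of y] D_same[of z] that by (simp add: D_add W_add add.commute)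
  obtain c where c: "\<sigma> c \<noteq> c" by (rule \<sigma>_moves)
  have "j c * D y z + j (\<sigma> c) * D z y = 0"
    using anti[of "j c * y" z] assms by (simp add: D_left D_right W_mult)
  moreover have "D z y = - D y z" using anti assms by (simp add: eq_neg_iff_add_eq_0 add.commute)
  ultimately have "j (c - \<sigma> c) * D y z = 0" by (simp add: mult_distribs j_diff)
  then have "scE (c - \<sigma> c) (D y z) = 0" by (simp add: scE)
  then have "D y z = 0" using c by (simp del: scE)
  then show ?thesis by (simp add: D_def)
qed

text \<open>Multiplicativity of \<open>Q\<close> on \<open>x * y\<close>, whose components in
  \<open>V0\<close> and \<open>W\<close> are orthogonal.\<close>

lemma \<Phi>_cross_cross:
  assumes "x \<in> W" "y \<in> W"
  shows "\<Phi> (cross x y) (cross x y) = \<Phi> x x * \<Phi> y y - \<Phi> x y * \<sigma> (\<Phi> x y)"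
proof -
  have "\<Phi> (x * y) (x * y) = \<Phi> x x * \<Phi> y y" by (simp add: \<Phi>_self Q_mult \<iota>_mult)
  moreover have "\<Phi> (x * y) (x * y) = \<Phi> (cross x y) (cross x y) + \<Phi> x y * \<sigma> (\<Phi> x y)"
    using cross_mem[OF assms] by (simp add: mult_eq_cross \<Phi>_distribs \<Phi>_W_j \<Phi>_j_W \<Phi>_j)
  ultimately show ?thesis by (metis add_diff_cancel_right')
qed

text \<open>An element of norm 1 and positive valuation would be a root of \<open>X\<^sup>2 - t X + 1\<close> with
  \<open>v t < 0\<close>, a polynomial which splits over the complete field \<open>F\<close>.\<close>

lemma vE_\<sigma>: "vE (\<sigma> c) = vE c"
proof -
  \<comment> \<open>To be applied to quotients of \<open>c\<close> and \<open>\<sigma> c\<close>,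
    which have norm 1.\<close>
  have no_pos: "\<not> 0 < vE b" if b: "b * \<sigma> b = 1" for b
  proof
    assume pos: "0 < vE b"
    have b0: "b \<noteq> 0" using b by auto
    then obtain n where n: "vE b = ereal (of_int n)" by (rule E.val_finite)
    then have n0: "0 < n" using pos by simp
    have \<sigma>b: "\<sigma> b = inverse b" using b b0 by (metis inverse_unique)
    define t where "t = B (j b) 1"
    have t: "\<iota> t = b + \<sigma> b" by (simp add: t_def trace)
    have "vE (b * b) = vE b + vE b" by (rule E.val_mult)
    moreover have "vE (1 + b * b) = 0"
    proof -
      have 1: "0 < vE (b * b)" using n n0 by (simp add: E.val_mult)
      have "0 \<le> vE (1 + b * b)" using 1 by (intro E.val_ge_add) auto
      moreover have "\<not> 0 < vE (1 + b * b)"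
      proof
        assume "0 < vE (1 + b * b)"
        then have "0 < min (vE (1 + b * b)) (vE (b * b))" using 1 by simp
        also have "\<dots> \<le> vE ((1 + b * b) - b * b)" by (intro E.val_ge_diff) auto
        finally show False by simp
      qed
      ultimately show ?thesis by simp
    qed
    moreover have "\<iota> t = (1 + b * b) * inverse b" using b0 by (simp add: t \<sigma>b field_simps)
    ultimately have vt: "vE (\<iota> t) = - vE b" using b0 by (simp add: E.val_mult E.val_inverse)
    then have t0: "t \<noteq> 0" using n by auto
    then obtain m where m: "vF t = ereal (of_int m)" by (rule F.val_finite)
    have "real e * of_int m = - of_int n" using vt by (simp add: vE_\<iota> m n)
    then have m0: "m < 0"
    proof -
      have "real e * of_int m < 0" using \<open>real e * of_int m = - of_int n\<close> n0 by simp
      then show ?thesis by (simp add: mult_less_0_iff)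
    qed
    \<comment> \<open>Substituting \<open>X = t * y\<close> turns the equation of \<open>b\<close>
      into \<open>y = u + y\<^sup>2\<close> with \<open>u\<close> the inverse square of
      \<open>t\<close>, to which the contraction applies.\<close>
    have "(1::ereal) \<le> vF (inverse t * inverse t)"
      using m0 t0 by (simp add: F.val_mult F.val_inverse m one_ereal_def)
    then obtain y where y: "y = inverse t * inverse t + y\<^sup>2"
      using quadratic_root_by_contraction[OF F.normalized] local_field
      unfolding nonarch_local_field_def by metis
    define r where "r = t * y"
    have "t * t * y = t * t * (inverse t * inverse t + y\<^sup>2)" using y by (rule arg_cong)
    also have "\<dots> = 1 + t * t * (y * y)" using t0 by (simp add: field_simps power2_eq_square)
    finally have "t * t * y = 1 + t * t * (y * y)" .
    then have "r * r = t * r - 1" by (simp add: r_def algebra_simps)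
    then have "\<iota> (r * r) = \<iota> (t * r - 1)" by simp
    then have r: "\<iota> r * \<iota> r = \<iota> t * \<iota> r - 1" by (simp add: \<iota>_mult \<iota>_diff)
    have bb: "b * b = \<iota> t * b - 1" using b0 by (simp add: t \<sigma>b algebra_simps)
    \<comment> \<open>Both roots lie in F, so \<sigma> fixes \<open>b\<close>; then
      \<open>b * b = 1\<close>, against the positive valuation.\<close>
    have "(b - \<iota> r) * (b - \<iota> (t - r)) = 0"
      using r bb unfolding \<iota>_diff by algebra
    then have "b = \<iota> r \<or> b = \<iota> (t - r)" by auto
    then have "\<sigma> b = b" by auto
    then have "vE (b * b) = 0" using b by simp
    then show False using n n0 by (simp add: E.val_mult)
  qed
  have ge: "vE c \<le> vE (\<sigma> c)" if c: "c \<noteq> 0" for c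
  proof -
    obtain n m where n: "vE c = ereal (of_int n)" "vE (\<sigma> c) = ereal (of_int m)"
      using E.val_finite[OF c] E.val_finite[of "\<sigma> c"] c by (metis \<sigma>_eq_0_iff)
    have inv: "\<sigma> (inverse (\<sigma> c)) = inverse c"
      using c by (metis \<sigma>_1 \<sigma>_\<sigma> \<sigma>_eq_0_iff \<sigma>_mult inverse_unique right_inverse)
    have "\<not> 0 < vE (c * inverse (\<sigma> c))"
      using c by (intro no_pos) (simp add: \<sigma>_mult inv mult.assoc[of c] mult.assoc[of "inverse (\<sigma> c)", symmetric])
    then show ?thesis using c n by (simp add: E.val_mult E.val_inverse)
  qed
  show ?thesis
  proof (cases "c = 0")
    case False then show ?thesis using ge[of c] ge[of "\<sigma> c"] by simp
  qed simp
qed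

subsection \<open>Gram determinants and special bases\<close>

definition gram :: "(3 \<Rightarrow> 'v) \<Rightarrow> 'e^3^3" where "gram b = (\<chi> i k. \<Phi> (b i) (b k))"

lemma gram_transform:
  "gram (transform scE b A) = transpose A ** gram b ** (\<chi> i k. \<sigma> (A$i$k))"
  by (simp add: vec_eq_iff gram_def transform_def matrix_matrix_mult_def transpose_def sum_3 scE
      \<Phi>_distribs algebra_simps)

lemma det_\<sigma>: "det (\<chi> i k. \<sigma> (A$i$k)) = \<sigma> (det A)" for A :: "'e^3^3"
  by (simp add: det_3 \<sigma>_add \<sigma>_diff \<sigma>_mult)

lemma vE_det_gram_transform:
  "vE (det (gram (transform scE b A))) = vE (det (gram b)) + (vE (det A) + vE (det A))"
  by (simp add: gram_transform det_mul det_\<sigma> vE_\<sigma> E.val_mult ac_simps)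

lemma det_gram_nonzero:
  assumes b: "basis3 scE W b" shows "det (gram b) \<noteq> 0"
proof -
  have "x = 0" if x: "gram b *v x = 0" for x
  proof -
    \<comment> \<open>The coefficients are conjugated because \<Phi> is antilinear in its second
      argument; a kernel vector thus gives a vector orthogonal to all of \<open>W\<close>.\<close>
    define y where "y = (\<Sum>k\<in>UNIV. scE (\<sigma> (x$k)) (b k))"
    have y: "y \<in> W" unfolding y_def by (rule EV.basis3_sum_mem[OF b])
    have "\<Phi> (b i) y = (gram b *v x)$i" for i
      by (simp add: y_def \<Phi>_sum_right scE \<Phi>_mult_right gram_def matrix_vector_mult_def mult.commute)
    then have by0: "\<Phi> (b i) y = 0" for i by (simp add: x)
    have "\<Phi> w y = 0" if w: "w \<in> W" for w
    proof -
      obtain c where "w = (\<Sum>i\<in>UNIV. scE (c i) (b i))" by (rule EV.basis3_coords[OF b w])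
      then show ?thesis by (simp add: \<Phi>_sum_left scE \<Phi>_mult_left by0)
    qed
    then have "\<Phi> y w = 0" if "w \<in> W" for w using that by (simp add: \<Phi>_commute[of y])
    then have "y = 0" using y by (rule \<Phi>_nondegenerate)
    then have "\<sigma> (x$k) = 0" for k unfolding y_def by (rule EV.basis3_indep[OF b])
    then show ?thesis by (simp add: vec_eq_iff)
  qed
  then show ?thesis
    by (metis matrix_left_invertible_ker invertible_left_inverse invertible_det_nz)
qed

lemma self_dual_W_add_le:
  "self_dual_norm vE scE \<Phi> W \<beta> \<Longrightarrow> x \<in> W \<Longrightarrow> y \<in> W \<Longrightarrow> \<beta> x + \<beta> y \<le> vE (\<Phi> x y)"
  using self_dual_add_le[of vE scE \<Phi> W \<beta> x y] by (cases "y = 0") auto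

lemma det_gram_ge:
  assumes N: "self_dual_norm vE scE \<Phi> W \<beta>" and b: "\<And>i. b i \<in> W" "\<And>i. \<beta> (b i) = ereal (r i)"
  shows "ereal (sum r UNIV + sum r UNIV) \<le> vE (det (gram b))"
  by (rule E.val_det_ge) (use self_dual_W_add_le[OF N b(1) b(1)] in \<open>simp add: gram_def b(2)\<close>)

lemma basis3_nonzero: "basis3 scE W b \<Longrightarrow> b i \<noteq> 0"
  unfolding basis3_def using EV.dependent_zero by (metis rangeI)

text \<open>The dual basis of a splitting basis has opposite norms; its Gram matrix is the conjugate
  transpose of the inverse, so the lower bound for both Gram determinants gives equality.\<close>

lemma det_gram_splitting_basis:
  assumes N: "self_dual_norm vE scE \<Phi> W \<beta>" and b: "basis3 scE W b"
    and splits: "basis_splits scE b \<beta>" and r: "\<And>i. \<beta> (b i) = ereal (r i)"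
  shows "vE (det (gram b)) = ereal (sum r UNIV + sum r UNIV)"
proof (rule antisym)
  have R: "rational_norm vE scE W \<beta>" using N by (simp add: self_dual_norm_def)
  obtain H where H: "H ** gram b = mat 1"
    using det_gram_nonzero[OF b] by (metis invertible_det_nz invertible_left_inverse)
  define d where "d i = (\<Sum>k\<in>UNIV. scE (H$i$k) (b k))" for i
  have dW: "d i \<in> W" for i unfolding d_def by (rule EV.basis3_sum_mem[OF b])
  have db: "\<Phi> (d i) (b m) = (if i = m then 1 else 0)" for i m
  proof -
    have "\<Phi> (d i) (b m) = (H ** gram b)$i$m"
      by (simp add: d_def \<Phi>_sum_left scE \<Phi>_mult_left gram_def matrix_matrix_mult_def)
    then show ?thesis by (simp add: H mat_def)
  qed
  have dd: "\<Phi> (d i) (d m) = \<sigma> (H$m$i)" for i m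
  proof -
    have "\<Phi> (d i) (d m) = (\<Sum>k\<in>UNIV. \<sigma> (H$m$k) * \<Phi> (d i) (b k))"
      by (subst (2) d_def) (simp add: \<Phi>_sum_right scE \<Phi>_mult_right)
    then show ?thesis by (simp add: db if_distrib cong: if_cong)
  qed
  \<comment> \<open>Pairing \<open>d i\<close> with \<open>y\<close> picks out the conjugate of the
    i-th coordinate of \<open>y\<close>. Because the basis splits \<beta>, the i-th term has norm at
    least \<open>\<beta> y\<close>.\<close>
  have \<beta>d: "ereal (- r i) \<le> \<beta> (d i)" for i
    unfolding self_dual_le_iff[OF N dW]
  proof
    fix y assume "y \<in> W - {0}"
    then obtain c where y: "y = (\<Sum>k\<in>UNIV. scE (c k) (b k))" using EV.basis3_coords[OF b] by blast
    have "\<beta> y \<le> \<beta> (scE (c i) (b i))"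
      using splits unfolding basis_splits_def y by (auto intro: Min_le)
    then have le: "\<beta> y \<le> vE (c i) + ereal (r i)"
      using rational_norm_scale[OF R EV.basis3_mem[OF b]] by (simp add: r)
    have "\<Phi> (d i) y = \<sigma> (c i)"
      by (simp add: y \<Phi>_sum_right scE \<Phi>_mult_right db if_distrib cong: if_cong)
    then show "ereal (- r i) + \<beta> y \<le> vE (\<Phi> (d i) y)"
      using le by (cases "\<beta> y"; cases "vE (c i)") (auto simp: vE_\<sigma>)
  qed
  have "ereal (sum (\<lambda>i. - r i) UNIV + sum (\<lambda>i. - r i) UNIV) \<le> vE (det H)"
  proof (rule E.val_det_ge)
    fix i k
    have "ereal (- r k) + ereal (- r i) \<le> \<beta> (d k) + \<beta> (d i)" by (intro add_mono \<beta>d)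
    also have "\<dots> \<le> vE (\<Phi> (d k) (d i))" by (rule self_dual_W_add_le[OF N dW dW])
    finally show "ereal (- r i + - r k) \<le> vE (H$i$k)" by (simp add: dd vE_\<sigma> add.commute)
  qed
  moreover obtain n where n: "vE (det (gram b)) = ereal (of_int n)"
    using E.val_finite[OF det_gram_nonzero[OF b]] .
  moreover have "vE (det H) + vE (det (gram b)) = 0"
    using det_mat_inverse(1)[OF H] by (metis E.val_mult E.val_1)
  ultimately show "vE (det (gram b)) \<le> ereal (sum r UNIV + sum r UNIV)"
    by (cases "vE (det H)") (auto simp: sum_negf)
  show "ereal (sum r UNIV + sum r UNIV) \<le> vE (det (gram b))"
    by (rule det_gram_ge[OF N EV.basis3_mem[OF b] r])
qed

section \<open>Existence and volume of special bases\<close>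

lemma special_basis_\<Phi>:
  assumes "special_basis scE Q \<Phi> W b"
  shows "\<Phi> (b 1) (b 1) = 0" "\<Phi> (b 3) (b 3) = 0" "\<Phi> (b 1) (b 3) = 1" "\<Phi> (b 3) (b 1) = 1"
    "\<Phi> (b 2) (b 1) = 0" "\<Phi> (b 2) (b 3) = 0" "\<Phi> (b 1) (b 2) = 0" "\<Phi> (b 3) (b 2) = 0"
    "\<Phi> (b 2) (b 2) = - 4"
proof -
  have special: "\<Phi> (b 2) (b 1) = 0" "\<Phi> (b 2) (b 3) = 0" "\<Phi> (b 1) (b 3) = 1" "Q (b 1) = 0" "Q (b 3) = 0"
    and b2: "b 2 = (b 1 + b 3) * (b 1 - b 3)"
    using assms unfolding special_basis_def by blast+
  show *: "\<Phi> (b 1) (b 1) = 0" "\<Phi> (b 3) (b 3) = 0" "\<Phi> (b 1) (b 3) = 1" "\<Phi> (b 3) (b 1) = 1"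
    "\<Phi> (b 2) (b 1) = 0" "\<Phi> (b 2) (b 3) = 0" "\<Phi> (b 1) (b 2) = 0" "\<Phi> (b 3) (b 2) = 0"
    by (simp_all add: special \<Phi>_self \<Phi>_commute[of "b 3" "b 1"] \<Phi>_commute[of "b 3" "b 2"]
        \<Phi>_commute[of "b 1" "b 2"])
  \<comment> \<open>The two factors are 2 and -2.\<close>
  have "\<Phi> (b 2) (b 2) = \<Phi> (b 1 + b 3) (b 1 + b 3) * \<Phi> (b 1 - b 3) (b 1 - b 3)"
    by (simp add: b2 \<Phi>_self Q_mult \<iota>_mult)
  then show "\<Phi> (b 2) (b 2) = - 4" by (simp add: \<Phi>_distribs *)
qed

lemma vE_det_gram_special_basis:
  assumes "special_basis scE Q \<Phi> W b" shows "vE (det (gram b)) = 0"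
proof -
  have "det (gram b) = 2 * 2" by (simp add: det_3 gram_def special_basis_\<Phi>[OF assms])
  then show ?thesis by (simp only: E.val_mult vE_2) simp
qed

text \<open>If the component \<open>j a\<close> of \<open>x\<close> is nonzero, dividing the other
  component by \<open>a\<close> gives \<open>y\<close> in \<open>W\<close> with
  \<open>\<Phi> y y = - 1\<close>. For any \<open>u\<close> orthogonal to \<open>y\<close>,
  \<open>cross u y\<close> is orthogonal to \<open>u\<close> and of opposite norm, so
  \<open>u\<close> itself or \<open>u + cross u y\<close> is isotropic.\<close>

lemma ex_isotropic:
  assumes iso: "x \<noteq> 0" "Q x = 0" and b: "basis3 scE W b"
  obtains w where "w \<in> W" "w \<noteq> 0" "\<Phi> w w = 0"
proof -
  obtain w where w: "w \<in> W" "x = j (\<Phi> x 1) + w" by (rule decompose)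
  define a where "a = \<Phi> x 1"
  have x: "x = j a + w" using w by (simp add: a_def)
  have "\<Phi> x x = a * \<sigma> a + \<Phi> w w" by (simp add: x \<Phi>_distribs \<Phi>_j \<Phi>_W_j \<Phi>_j_W w(1))
  then have ww: "a * \<sigma> a + \<Phi> w w = 0" by (simp add: \<Phi>_self[of x] iso)
  show ?thesis
  proof (cases "a = 0")
    case True
    then show ?thesis using that[of w] w(1) ww x iso by simp
  next
    case False
    define y where "y = j (inverse a) * w"
    have yW: "y \<in> W" using w by (simp add: y_def W_mult)
    have "\<Phi> w w = - (a * \<sigma> a)" using ww by (simp add: eq_neg_iff_add_eq_0 add.commute)
    moreover have "\<sigma> (inverse a) * \<sigma> a = 1" using False by (simp flip: \<sigma>_mult)
    ultimately have yy: "\<Phi> y y = - 1"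
      using False by (simp add: y_def \<Phi>_mult_left \<Phi>_mult_right ac_simps)
    define u where "u i = b i + j (\<Phi> (b i) y) * y" for i
    have uW: "u i \<in> W" and uy: "\<Phi> (u i) y = 0" for i
      using EV.basis3_mem[OF b] yW by (simp_all add: u_def W_add W_mult \<Phi>_distribs yy)
    have "\<exists>i. u i \<noteq> 0"
    proof (rule ccontr)
      assume "\<nexists>i. u i \<noteq> 0"
      then have bi: "b i = - (scE (\<Phi> (b i) y) y)" for i
        by (metis u_def eq_neg_iff_add_eq_0 scE)
      \<comment> \<open>If all projections vanished, every basis vector would be a multiple of
        \<open>y\<close>; this is the resulting relation between the first two.\<close>
      define c :: "3 \<Rightarrow> 'e" where
        "c i = (if i = 1 then \<Phi> (b 2) y else if i = 2 then - \<Phi> (b 1) y else 0)" for i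
      have "(\<Sum>i\<in>UNIV. scE (c i) (b i)) = 0"
        by (subst bi) (simp add: sum_3 c_def mult.commute)
      then have "c 2 = 0" by (rule EV.basis3_indep[OF b])
      then have "b 1 = 0" using bi[of 1] by (simp add: c_def)
      then show False using basis3_nonzero[OF b] by simp
    qed
    then obtain i where i: "u i \<noteq> 0" ..
    define z where "z = cross (u i) y"
    have zW: "z \<in> W" using uW yW by (simp add: z_def cross_mem)
    have zu: "\<Phi> z (u i) = 0" "\<Phi> (u i) z = 0"
      using \<Phi>_cross_left[OF uW yW] \<Phi>_commute[of "u i" z] by (simp_all add: z_def)
    have zz: "\<Phi> z z = - \<Phi> (u i) (u i)"
      using \<Phi>_cross_cross[OF uW yW] by (simp add: z_def uy yy)
    show ?thesis
    proof (cases "\<Phi> (u i) (u i) = 0")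
      case True then show ?thesis using that uW i by blast
    next
      case False
      have "\<Phi> (u i + z) (u i) \<noteq> 0" using False zu by (simp add: \<Phi>_add_left)
      then have "u i + z \<noteq> 0" by auto
      moreover have "\<Phi> (u i + z) (u i + z) = 0" by (simp add: \<Phi>_distribs zu zz)
      ultimately show ?thesis using that uW zW W_add by blast
    qed
  qed
qed

text \<open>An isotropic vector \<open>w\<close> is completed to a hyperbolic pair with
  \<open>z\<close>. The vectors \<open>w + z\<close> and \<open>w - z\<close> are orthogonal, so
  their product is a vector product, orthogonal to both and hence, 2 being invertible, to
  \<open>w\<close> and \<open>z\<close>.\<close>

lemma ex_special_basis:
  assumes "x \<noteq> 0" "Q x = 0" and b: "basis3 scE W b"
  obtains c where "special_basis scE Q \<Phi> W c"
proof -
  obtain w where w: "w \<in> W" "w \<noteq> 0" "\<Phi> w w = 0" using ex_isotropic[OF assms] .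
  obtain y where y: "y \<in> W" "\<Phi> w y \<noteq> 0" using \<Phi>_nondegenerate[of w] w by blast
  define y1 where "y1 = j (\<sigma> (inverse (\<Phi> w y))) * y"
  \<comment> \<open>This value is fixed by \<sigma>, so subtracting \<open>j t * w\<close> lowers
    \<open>\<Phi> y1 y1\<close> by \<open>t + t\<close> and makes \<open>z\<close>
    isotropic.\<close>
  define t where "t = \<Phi> y1 y1 / 2"
  define z where "z = y1 - j t * w"
  have y1: "y1 \<in> W" "\<Phi> w y1 = 1" "\<Phi> y1 w = 1"
    using y by (simp_all add: y1_def W_mult \<Phi>_mult_right \<Phi>_commute[of _ w] )
  have tt: "\<Phi> y1 y1 = t + t" using two_neq_0 by (simp add: t_def field_simps)
  have "\<sigma> t + \<sigma> t = t + t" unfolding \<sigma>_add[symmetric] tt[symmetric] by (rule \<Phi>_commute[symmetric])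
  then have "2 * \<sigma> t = 2 * t" by (simp only: mult_2)
  then have \<sigma>t: "\<sigma> t = t" using two_neq_0 by simp
  have z: "z \<in> W" "\<Phi> w z = 1" "\<Phi> z w = 1" "\<Phi> z z = 0"
    using y1 w by (simp_all add: z_def W_diff W_mult \<Phi>_distribs \<sigma>t tt)
  have wz: "w + z \<in> W" "w - z \<in> W" using w z by (auto intro: W_add W_diff)
  define g where "g = (w + z) * (w - z)"
  have "\<Phi> (w + z) (w - z) = 0" by (simp add: \<Phi>_distribs w z)
  then have g: "g = cross (w + z) (w - z)" by (simp add: g_def cross_def)
  have gW: "g \<in> W" using wz by (simp add: g cross_mem)
  have "\<Phi> g (w + z) = 0" "\<Phi> g (w - z) = 0"
    using wz by (simp_all add: g \<Phi>_cross_left \<Phi>_cross_right)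
  then have gwz: "\<Phi> g w + \<Phi> g z = 0" "\<Phi> g w = \<Phi> g z" by (simp_all add: \<Phi>_distribs)
  then have "2 * \<Phi> g z = 0" by (simp only: mult_2)
  then have gz: "\<Phi> g z = 0" "\<Phi> g w = 0" using two_neq_0 gwz by auto
  have "\<Phi> g g = \<Phi> (w + z) (w + z) * \<Phi> (w - z) (w - z)"
    by (simp add: g_def \<Phi>_self Q_mult \<iota>_mult)
  also have "\<dots> = - (2 * 2)" by (simp add: \<Phi>_distribs w z)
  finally have gg: "\<Phi> g g \<noteq> 0" using two_neq_0 by (metis mult_eq_0_iff neg_equal_0_iff_equal)
  define c :: "3 \<Rightarrow> 'v" where "c i = (if i = 1 then w else if i = 2 then g else z)" for i
  have c: "c 1 = w" "c 2 = g" "c 3 = z" by (simp_all add: c_def)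
  have "basis3 scE W c"
  proof (rule EV.basis3_of_independent[OF b])
    show "c i \<in> W" for i using w z gW by (simp add: c_def)
    fix a k assume "(\<Sum>i\<in>UNIV. scE (a i) (c i)) = 0"
    then have 0: "j (a 1) * w + j (a 2) * g + j (a 3) * z = 0" by (simp add: sum_3 c scE)
    have wg: "\<Phi> w g = 0" "\<Phi> z g = 0" using gz by (simp_all add: \<Phi>_commute[of _ g])
    have "a 1 = 0" using arg_cong[OF 0, of "\<lambda>x. \<Phi> x z"] by (simp add: \<Phi>_distribs w z gz)
    moreover have "a 3 = 0" using arg_cong[OF 0, of "\<lambda>x. \<Phi> x w"] by (simp add: \<Phi>_distribs w z gz)
    moreover have "a 2 = 0" using arg_cong[OF 0, of "\<lambda>x. \<Phi> x g"] gg by (simp add: \<Phi>_distribs wg)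
    ultimately show "a k = 0" using exhaust_3[of k] by auto
  qed
  moreover have "Q w = 0" "Q z = 0" using w(3) z(4) by (simp_all add: \<Phi>_self)
  ultimately have "special_basis scE Q \<Phi> W c"
    by (simp add: special_basis_def c z g_def gz[unfolded g_def])
  then show ?thesis by (rule that)
qed

text \<open>The product of two orthogonal vectors is their vector product, orthogonal to both. It is
  nonzero by multiplicativity of \<open>Q\<close>, because an isotropic vector in an orthogonal
  basis would lie in the radical.\<close>

lemma orthogonal_basis_mult:
  assumes "orthogonal_basis3 scE \<Phi> W f"
  shows "\<exists>c. c \<noteq> 0 \<and> f 1 * f 2 = scE c (f 3)"
proof -
  have b: "basis3 scE W f" and orth: "\<And>i k. i \<noteq> k \<Longrightarrow> \<Phi> (f i) (f k) = 0"
    using assms by (auto simp: orthogonal_basis3_def)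
  note mem = EV.basis3_mem[OF b]
  have nz: "\<Phi> (f i) (f i) \<noteq> 0" for i
  proof
    assume *: "\<Phi> (f i) (f i) = 0"
    have fi: "\<Phi> (f i) (f k) = 0" for k by (cases "i = k") (use * orth in auto)
    have "\<Phi> (f i) y = 0" if "y \<in> W" for y
      using EV.basis3_coords[OF b that] by (metis (no_types, lifting) \<Phi>_sum_right \<Phi>_mult_right fi mult_zero_right scE sum.neutral)
    then have "f i = 0" using mem by (rule \<Phi>_nondegenerate)
    then show False using basis3_nonzero[OF b] by simp
  qed
  have eq: "f 1 * f 2 = cross (f 1) (f 2)" by (simp add: cross_def orth)
  then have "f 1 * f 2 \<in> W" using mem by (simp add: cross_mem)
  then obtain c where c: "f 1 * f 2 = (\<Sum>i\<in>UNIV. scE (c i) (f i))"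
    by (rule EV.basis3_coords[OF b])
  have coef: "\<Phi> (f 1 * f 2) (f k) = c k * \<Phi> (f k) (f k)" for k
  proof -
    have "\<Phi> (f 1 * f 2) (f k) = (\<Sum>i\<in>UNIV. if i = k then c k * \<Phi> (f k) (f k) else 0)"
      unfolding c \<Phi>_sum_left by (rule sum.cong) (auto simp: scE \<Phi>_mult_left orth)
    then show ?thesis by simp
  qed
  have "c 1 = 0" "c 2 = 0"
    using coef[of 1] coef[of 2] nz mem by (simp_all add: eq \<Phi>_cross_left \<Phi>_cross_right)
  then have c3: "f 1 * f 2 = scE (c 3) (f 3)" by (simp add: c sum_3)
  have "\<Phi> (f 1 * f 2) (f 1 * f 2) \<noteq> 0"
    using nz[of 1] nz[of 2] by (simp add: \<Phi>_self Q_mult)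
  then have "c 3 \<noteq> 0" using c3 by auto
  then show ?thesis using c3 by blast
qed

text \<open>A change of basis adds twice the valuation of its determinant to that of the Gram
  determinant, and the latter is 0 for every special basis.\<close>

lemma lattice_volume_special_basis:
  assumes L0: "is_lattice vE scE W L0" and b: "special_basis scE Q \<Phi> W b"
    and c: "special_basis scE Q \<Phi> W c"
  shows "lattice_volume vE scE W L0 (lattice_of vE scE b) = lattice_volume vE scE W L0 (lattice_of vE scE c)"
proof -
  obtain b0 where b0: "basis3 scE W b0" and L: "L0 = lattice_of vE scE b0"
    using L0 by (auto simp: is_lattice_def)
  have B: "basis3 scE W b" "basis3 scE W c" using b c by (auto simp: special_basis_def)
  obtain A A' where A: "b = transform scE b0 A" "A ** A' = mat 1"
    using EV.obtain_basis_change[OF b0 B(1)] by metis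
  obtain C C' where C: "c = transform scE b0 C" "C ** C' = mat 1"
    using EV.obtain_basis_change[OF b0 B(2)] by metis
  note dA = det_mat_inverse(2)[OF A(2)] and dC = det_mat_inverse(2)[OF C(2)]
  obtain n where n: "vE (det (gram b0)) = ereal (of_int n)"
    using E.val_finite[OF det_gram_nonzero[OF b0]] .
  obtain p where p: "vE (det A) = ereal (of_int p)" using E.val_finite[OF dA] .
  obtain q where q: "vE (det C) = ereal (of_int q)" using E.val_finite[OF dC] .
  have "vE (det A) = vE (det C)"
    using vE_det_gram_special_basis[OF b] vE_det_gram_special_basis[OF c]
    by (simp add: A(1) C(1) vE_det_gram_transform n p q)
  then show ?thesis
    unfolding L A(1) C(1) by (simp add: EV.lattice_volume_transform[OF b0 dA] EV.lattice_volume_transform[OF b0 dC])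
qed

text \<open>The definite description requires that some splitting basis exists and that each one
  gives 0. Both follow by comparing Gram determinants with that of a special basis
  \<open>b\<close>.\<close>

lemma norm_volume_self_dual:
  assumes iso: "x \<noteq> 0" "Q x = 0" and L0: "is_lattice vE scE W L0"
    and vol: "\<And>b. special_basis scE Q \<Phi> W b \<Longrightarrow> lattice_volume vE scE W L0 (lattice_of vE scE b) = 0"
    and N: "self_dual_norm vE scE \<Phi> W \<beta>"
  shows "norm_volume vE scE W L0 \<beta> = 0"
proof -
  have R: "rational_norm vE scE W \<beta>" using N by (simp add: self_dual_norm_def)
  obtain b0 where b0: "basis3 scE W b0" and L: "L0 = lattice_of vE scE b0"
    using L0 by (auto simp: is_lattice_def)
  obtain b where b: "special_basis scE Q \<Phi> W b" using ex_special_basis[OF iso b0] .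
  have B: "basis3 scE W b" using b by (simp add: special_basis_def)
  obtain S S' where S: "b = transform scE b0 S" "S ** S' = mat 1"
    using EV.obtain_basis_change[OF b0 B] by metis
  note dS = det_mat_inverse(2)[OF S(2)]
  have vS: "vE (det S) = 0"
    using vol[OF b] EV.lattice_volume_transform[OF b0 dS] by (simp add: L S(1))
  have fin: "\<exists>r. \<forall>i. \<beta> (c i) = ereal (r i)" if c: "basis3 scE W c" for c
  proof -
    have "\<exists>r. \<beta> (c i) = ereal r" for i
      using rational_norm_finite[OF R EV.basis3_mem[OF c] basis3_nonzero[OF c]] by blast
    then show ?thesis by metis
  qed
  have gram: "vE (det (gram (transform scE b A))) = vE (det A) + vE (det A)" for A
    by (simp add: vE_det_gram_transform vE_det_gram_special_basis[OF b])
  \<comment> \<open>Half of the Gram inequality; it is the lower bound for the defect in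
    \<open>ex_splitting_basis\<close>.\<close>
  have below: "(\<Sum>i\<in>UNIV. \<beta> (transform scE b A i)) \<le> vE (det A)" if dA: "det A \<noteq> 0" for A
  proof -
    have c: "basis3 scE W (transform scE b A)" by (rule EV.basis3_transform[OF B dA])
    obtain r where r: "\<And>i. \<beta> (transform scE b A i) = ereal (r i)" using fin[OF c] by blast
    obtain n where n: "vE (det A) = ereal (of_int n)" using E.val_finite[OF dA] .
    have "ereal (sum r UNIV + sum r UNIV) \<le> vE (det (gram (transform scE b A)))"
      by (rule det_gram_ge[OF N]) (use EV.basis3_mem[OF c] r in auto)
    then show ?thesis by (simp add: gram n r)
  qed
  obtain c where c: "basis3 scE W c" "basis_splits scE c \<beta>"
    by (rule EV.ex_splitting_basis[OF B R below])
  have zero: "lattice_volume vE scE W L0 (lattice_of vE scE d) - (\<Sum>i\<in>UNIV. \<beta> (d i)) = 0"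
    if d: "basis3 scE W d" "basis_splits scE d \<beta>" for d
  proof -
    obtain A A' where A: "d = transform scE b A" "A ** A' = mat 1"
      using EV.obtain_basis_change[OF B d(1)] by metis
    note dA = det_mat_inverse(2)[OF A(2)]
    obtain n where n: "vE (det A) = ereal (of_int n)" using E.val_finite[OF dA] .
    obtain r where r: "\<And>i. \<beta> (d i) = ereal (r i)" using fin[OF d(1)] by blast
    have "vE (det A) = ereal (sum r UNIV)"
      using det_gram_splitting_basis[OF N d r] gram[of A] by (simp add: A(1)[symmetric] n)
    moreover have "lattice_volume vE scE W L0 (lattice_of vE scE d) = vE (det (S ** A))"
      unfolding L A(1) S(1) EV.transform_transform
      by (rule EV.lattice_volume_transform[OF b0]) (simp add: det_mul dS dA)
    ultimately show ?thesis by (simp add: det_mul E.val_mult vS r)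
  qed
  show ?thesis
    unfolding norm_volume_def by (rule the_equality) (use c zero in force)+
qed

subsection \<open>Self-dual algebra norms\<close>

text \<open>Norms over \<open>F\<close> are multiplied by \<open>e\<close> until the final lemmas, so that all values are on the
  scale of \<open>vE\<close> and no division by \<open>e\<close> occurs.\<close>

abbreviation vF' :: "'f \<Rightarrow> ereal" where "vF' \<equiv> \<lambda>a. vE (\<iota> a)"

lemma vF'_polar_self: "vF' (B (j c) (j c)) = vE c + vE c"
  by (simp add: polar_self \<iota>_mult \<iota>_2 norm[symmetric] E.val_mult vE_2 vE_\<sigma>)

lemma vF'_polar_j: "vE c + vE d \<le> vF' (B (j c) (j d))"
  unfolding \<iota>_polar by (rule E.val_ge_add) (simp_all add: \<Phi>_j E.val_mult vE_\<sigma>)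

text \<open>This is the self-duality of \<open>vE\<close> on \<open>V0\<close>. Testing at
  \<open>d = c\<close> suffices, where the pairing is twice the norm of \<open>c\<close>.\<close>

lemma vE_le_iff: "m \<le> vE c \<longleftrightarrow> (\<forall>d. d \<noteq> 0 \<longrightarrow> m + vE d \<le> vF' (B (j c) (j d)))"
proof
  assume m: "m \<le> vE c"
  show "\<forall>d. d \<noteq> 0 \<longrightarrow> m + vE d \<le> vF' (B (j c) (j d))"
    by (meson m add_right_mono order_trans vF'_polar_j)
next
  assume *: "\<forall>d. d \<noteq> 0 \<longrightarrow> m + vE d \<le> vF' (B (j c) (j d))"
  show "m \<le> vE c"
  proof (cases "c = 0")
    case False
    then obtain n where n: "vE c = ereal (of_int n)" by (rule E.val_finite)
    have "m + vE c \<le> vE c + vE c" using *[rule_format, OF False] by (simp only: vF'_polar_self)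
    then show ?thesis by (cases m) (auto simp: n)
  qed simp
qed

text \<open>Pairing a vector with itself gives \<gamma> at most \<open>vE\<close>; duality reverses
  inequalities, which gives the other one.\<close>

lemma self_dual_norm_V0_unique:
  assumes N: "self_dual_norm vF' sc B V0 \<gamma>" shows "\<gamma> (j c) = vE c"
proof (rule antisym)
  have R: "rational_norm vF' sc V0 \<gamma>" using N by (simp add: self_dual_norm_def)
  have V0: "j d \<in> V0" for d by (simp add: V0_def)
  have le: "\<gamma> (j d) \<le> vE d" for d
  proof (cases "d = 0")
    case False
    then obtain n where n: "vE d = ereal (of_int n)" by (rule E.val_finite)
    have "\<gamma> (j d) + \<gamma> (j d) \<le> vE d + vE d"
      using self_dual_add_le[OF N V0 V0, of d d] False by (simp add: vF'_polar_self)
    then show ?thesis by (cases "\<gamma> (j d)") (auto simp: n)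
  qed simp
  then show "\<gamma> (j c) \<le> vE c" .
  show "vE c \<le> \<gamma> (j c)"
    unfolding self_dual_le_iff[OF N V0]
  proof
    fix y assume "y \<in> V0 - {0}"
    then obtain d where y: "y = j d" by (auto simp: V0_def)
    have "vE c + \<gamma> y \<le> vE c + vE d" unfolding y by (intro add_left_mono le)
    also have "\<dots> \<le> vF' (B (j c) y)" unfolding y by (rule vF'_polar_j)
    finally show "vE c + \<gamma> y \<le> vF' (B (j c) y)" .
  qed
qed

lemma sc_j: "sc a (j c) = j (\<iota> a * c)"
  by (simp add: j_mult j_\<iota>_mult)

lemma vE_rational: "vE c = \<infinity> \<or> (\<exists>q::rat. vE c = ereal (of_rat q))"
proof (cases "c = 0")
  case False
  then obtain n where "vE c = ereal (of_int n)" by (rule E.val_finite)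
  then have "vE c = ereal (of_rat (of_int n))" by simp
  then show ?thesis by blast
qed simp

lemma self_dual_algebra_norm_V0:
  "self_dual_algebra_norm vF' sc Q V0 (\<lambda>x. vE (inv j x))"
proof -
  have inj: "inj j" by (simp add: inj_def)
  have inv: "inv j (j c) = c" for c by (rule inv_f_f[OF inj])
  have R: "rational_norm vF' sc V0 (\<lambda>x. vE (inv j x))"
    unfolding rational_norm_def V0_def
    using vE_rational E.val_add
    by (auto simp: inv sc_j E.val_mult E.val_eq_PInfty_iff simp flip: j_add)
  have "self_dual vF' B V0 (\<lambda>x. vE (inv j x))"
    unfolding self_dual_iff[OF R]
  proof (intro ballI allI)
    fix x m assume "x \<in> V0"
    then obtain c where x: "x = j c" by (auto simp: V0_def)
    have "V0 - {0} = j ` {d. d \<noteq> 0}" by (auto simp: V0_def)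
    then show "m \<le> vE (inv j x) \<longleftrightarrow> (\<forall>y\<in>V0 - {0}. m + vE (inv j y) \<le> vF' (B x y))"
      by (simp add: x inv vE_le_iff[of m c])
  qed
  then show ?thesis
    using R by (auto simp: self_dual_algebra_norm_def self_dual_norm_def V0_def inv E.val_mult simp flip: j_mult)
qed

text \<open>Replacing \<open>y\<close> by \<open>\<Phi> x y \<cdot> y\<close> makes the hermitian form take its value in \<open>F\<close>, where
  the trace is multiplication by the unit 2.\<close>

lemma hermitian_trace_le_iff:
  assumes R: "rational_norm vE scE W \<gamma>" and x: "x \<in> W"
  shows "(\<forall>y\<in>W - {0}. m + \<gamma> y \<le> vF' (B x y)) \<longleftrightarrow> (\<forall>y\<in>W - {0}. m + \<gamma> y \<le> vE (\<Phi> x y))"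
proof
  assume *: "\<forall>y\<in>W - {0}. m + \<gamma> y \<le> vF' (B x y)"
  show "\<forall>y\<in>W - {0}. m + \<gamma> y \<le> vE (\<Phi> x y)"
  proof
    fix y assume y: "y \<in> W - {0}"
    show "m + \<gamma> y \<le> vE (\<Phi> x y)"
    proof (cases "\<Phi> x y = 0")
      case False
      then obtain n where n: "vE (\<Phi> x y) = ereal (of_int n)" by (rule E.val_finite)
      obtain r where r: "\<gamma> y = ereal r" by (rule rational_norm_finite[OF R]) (use y in auto)
      let ?y = "j (\<Phi> x y) * y"
      have "scE (\<Phi> x y) y \<noteq> 0" using False y by (simp del: scE)
      then have "?y \<in> W - {0}" using y by (simp add: W_mult scE)
      then have "m + \<gamma> ?y \<le> vF' (B x ?y)" using * by blast
      moreover have "\<gamma> ?y = vE (\<Phi> x y) + \<gamma> y"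
        using rational_norm_scale[OF R, of y "\<Phi> x y"] y by (simp add: scE)
      moreover have "vF' (B x ?y) = vE (\<Phi> x y) + vE (\<Phi> x y)"
      proof -
        have "\<iota> (B x ?y) = 2 * (\<Phi> x y * \<sigma> (\<Phi> x y))"
          by (simp add: \<iota>_polar \<Phi>_mult_right \<sigma>_mult mult.commute)
        then show ?thesis by (simp add: E.val_mult vE_2 vE_\<sigma>)
      qed
      ultimately show ?thesis by (cases m) (auto simp: n r)
    qed simp
  qed
next
  assume *: "\<forall>y\<in>W - {0}. m + \<gamma> y \<le> vE (\<Phi> x y)"
  show "\<forall>y\<in>W - {0}. m + \<gamma> y \<le> vF' (B x y)"
    unfolding \<iota>_polar using * by (auto intro: E.val_ge_add simp: vE_\<sigma>)
qed

text \<open>Pairing \<open>x\<close> in \<open>X\<close> with an arbitrary vector sees only its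
  component in \<open>X\<close>, whose norm is at least as large, so testing against
  \<open>X\<close> is already the strongest condition.\<close>

lemma self_dual_norm_restrict:
  assumes N: "self_dual_norm vF' sc B UNIV \<gamma>"
    and dec: "\<And>y. \<exists>y1\<in>X. \<exists>y2\<in>Y. y = y1 + y2"
    and orth: "\<And>x y. x \<in> X \<Longrightarrow> y \<in> Y \<Longrightarrow> B x y = 0"
    and le: "\<And>x y. x \<in> X \<Longrightarrow> y \<in> Y \<Longrightarrow> \<gamma> (x + y) \<le> \<gamma> x"
  shows "self_dual_norm vF' sc B X \<gamma>"
proof -
  have A: "rational_norm vF' sc UNIV \<gamma>" using N by (simp add: self_dual_norm_def)
  have R: "rational_norm vF' sc X \<gamma>"
    by (rule rational_norm_transfer[OF A subset_UNIV]) (rule rational_norm_scale[OF A UNIV_I])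
  have "self_dual vF' B X \<gamma>"
    unfolding self_dual_iff[OF R]
  proof (intro ballI allI)
    fix x m assume x: "x \<in> X"
    have "(\<forall>y\<in>UNIV - {0}. m + \<gamma> y \<le> vF' (B x y)) \<longleftrightarrow> (\<forall>y\<in>X - {0}. m + \<gamma> y \<le> vF' (B x y))"
    proof (intro iffI ballI)
      fix y assume *: "\<forall>y\<in>X - {0}. m + \<gamma> y \<le> vF' (B x y)"
      obtain y1 y2 where y: "y1 \<in> X" "y2 \<in> Y" "y = y1 + y2" using dec by blast
      have B: "B x y = B x y1" using y x by (simp add: polar_add_right orth)
      show "m + \<gamma> y \<le> vF' (B x y)"
      proof (cases "y1 = 0")
        case False
        have "m + \<gamma> y \<le> m + \<gamma> y1" using le y by (intro add_left_mono) simp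
        also have "\<dots> \<le> vF' (B x y1)" using * False y by blast
        finally show ?thesis by (simp add: B)
      qed (simp add: B)
    qed blast
    then show "m \<le> \<gamma> x \<longleftrightarrow> (\<forall>y\<in>X - {0}. m + \<gamma> y \<le> vF' (B x y))"
      using self_dual_le_iff[OF N, of x m] by simp
  qed
  then show ?thesis using R by (simp add: self_dual_norm_def)
qed

lemma polar_W_V0: "w \<in> W \<Longrightarrow> y \<in> V0 \<Longrightarrow> B w y = 0"
  by (simp add: W_def orth_complement_def)

lemma split_self_dual_norm_V0:
  assumes "self_dual_norm vF' sc B UNIV \<gamma>" "split_by V0 W \<gamma>"
  shows "self_dual_norm vF' sc B V0 \<gamma>"
proof (rule self_dual_norm_restrict[OF assms(1), of V0 W])
  show "\<exists>y1\<in>V0. \<exists>y2\<in>W. y = y1 + y2" for y using decompose[of y] by (metis V0_def rangeI)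
  show "B x y = 0" if "x \<in> V0" "y \<in> W" for x y using that polar_W_V0 by (metis polar_commute)
  show "\<gamma> (x + y) \<le> \<gamma> x" if "x \<in> V0" "y \<in> W" for x y using assms(2) that by (simp add: split_by_def)
qed

lemma split_self_dual_norm_W:
  assumes "self_dual_norm vF' sc B UNIV \<gamma>" "split_by V0 W \<gamma>"
  shows "self_dual_norm vF' sc B W \<gamma>"
proof (rule self_dual_norm_restrict[OF assms(1), of W V0])
  show "\<exists>y1\<in>W. \<exists>y2\<in>V0. y = y1 + y2" for y using decompose[of y] by (metis V0_def rangeI add.commute)
  show "B x y = 0" if "x \<in> W" "y \<in> V0" for x y using that by (rule polar_W_V0)
  show "\<gamma> (x + y) \<le> \<gamma> x" if "x \<in> W" "y \<in> V0" for x y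
    using assms(2) that by (simp add: split_by_def add.commute[of x y])
qed

text \<open>On \<open>V0\<close> the norm is \<open>vE\<close>. The algebra inequality for
  multiplication by \<open>j c\<close> and by its inverse therefore gives exact homogeneity over the
  extension.\<close>

lemma self_dual_algebra_norm_restrict:
  assumes A: "self_dual_algebra_norm vF' sc Q UNIV \<gamma>" and S: "split_by V0 W \<gamma>"
  shows "self_dual_norm vE scE \<Phi> W \<gamma>"
proof -
  have N: "self_dual_norm vF' sc B UNIV \<gamma>" and mult: "\<gamma> x + \<gamma> y \<le> \<gamma> (x * y)" for x y
    using A by (auto simp: self_dual_algebra_norm_def)
  have NW: "self_dual_norm vF' sc B W \<gamma>" by (rule split_self_dual_norm_W[OF N S])
  then have RW: "rational_norm vF' sc W \<gamma>" by (simp add: self_dual_norm_def)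
  have j: "\<gamma> (j c) = vE c" for c
    by (rule self_dual_norm_V0_unique[OF split_self_dual_norm_V0[OF N S]])
  have scale: "\<gamma> (scE c w) = vE c + \<gamma> w" if w: "w \<in> W" for c w
  proof (cases "c = 0 \<or> w = 0")
    case True
    have "\<gamma> 0 = \<infinity>" using rational_norm_eq_PInfty_iff[OF RW, of 0] by simp
    then show ?thesis using True by (auto simp: scE)
  next
    case False
    then have c: "c \<noteq> 0" and w0: "w \<noteq> 0" by auto
    obtain n where n: "vE c = ereal (of_int n)" using E.val_finite[OF c] .
    obtain r where r: "\<gamma> w = ereal r" using rational_norm_finite[OF RW w w0] .
    have le: "vE c + \<gamma> w \<le> \<gamma> (scE c w)" using mult[of "j c" w] by (simp add: j scE)
    have "scE (inverse c) (scE c w) = w" using c by (simp del: scE)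
    then have "j (inverse c) * scE c w = w" by (simp only: scE[of "inverse c"])
    then have "- vE c + \<gamma> (scE c w) \<le> \<gamma> w"
      using mult[of "j (inverse c)" "scE c w"] c by (simp add: j E.val_inverse)
    then show ?thesis using le by (cases "\<gamma> (scE c w)") (auto simp: n r)
  qed
  have R: "rational_norm vE scE W \<gamma>"
    by (rule rational_norm_transfer[OF RW subset_refl scale])
  have "self_dual vE \<Phi> W \<gamma>"
    unfolding self_dual_iff[OF R]
    using self_dual_le_iff[OF NW] hermitian_trace_le_iff[OF R] by simp
  then show ?thesis using R by (simp add: self_dual_norm_def)
qed

text \<open>By self-duality it suffices to bound \<open>vE (\<Phi> (cross x y) z)\<close> from below, and the norm of this
  element of \<open>E\<close> is the Gram determinant of \<open>x, y, z\<close>.\<close>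

lemma self_dual_norm_cross:
  assumes N: "self_dual_norm vE scE \<Phi> W \<gamma>" and x: "x \<in> W" and y: "y \<in> W"
  shows "\<gamma> x + \<gamma> y \<le> \<gamma> (cross x y)"
proof -
  have R: "rational_norm vE scE W \<gamma>" using N by (simp add: self_dual_norm_def)
  show ?thesis
  proof (cases "x = 0 \<or> y = 0")
    case True
    have "\<gamma> 0 = \<infinity>" using rational_norm_eq_PInfty_iff[OF R, of 0] by simp
    then show ?thesis using True by (auto simp: cross_def)
  next
    case False
    then have x0: "x \<noteq> 0" and y0: "y \<noteq> 0" by auto
    obtain p where p: "\<gamma> x = ereal p" using rational_norm_finite[OF R x x0] .
    obtain q where q: "\<gamma> y = ereal q" using rational_norm_finite[OF R y y0] .
    define u where "u = cross x y"
    have u: "u \<in> W" using x y by (simp add: u_def cross_mem)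
    have "ereal (p + q) \<le> \<gamma> u"
      unfolding self_dual_le_iff[OF N u]
    proof
      fix z assume z': "z \<in> W - {0}"
      then have z: "z \<in> W" by simp
      obtain r where r: "\<gamma> z = ereal r" by (rule rational_norm_finite[OF R]) (use z' in auto)
      note le = self_dual_W_add_le[OF N]
      have "vE (\<Phi> x x * \<Phi> y y) \<ge> ereal (2 * p + 2 * q)"
        using add_mono[OF le[OF x x] le[OF y y]] by (simp add: E.val_mult p q)
      moreover have "vE (\<Phi> x y * \<sigma> (\<Phi> x y)) \<ge> ereal (2 * p + 2 * q)"
        using add_mono[OF le[OF x y] le[OF x y]] by (simp add: E.val_mult vE_\<sigma> p q)
      ultimately have uu: "ereal (2 * p + 2 * q) \<le> vE (\<Phi> u u)"
        unfolding u_def \<Phi>_cross_cross[OF x y] by (rule E.val_ge_diff)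
      have 1: "ereal (2 * p + 2 * q + 2 * r) \<le> vE (\<Phi> u u * \<Phi> z z)"
        using add_mono[OF uu le[OF z z]] by (simp add: E.val_mult r)
      \<comment> \<open>The double product is a combination of \<open>x\<close> and \<open>y\<close>
        with coefficients controlled by duality, so its norm can be bounded without knowing that of
        \<open>u\<close>.\<close>
      define t where "t = cross u z"
      have t: "t = scE (\<Phi> x z) y + scE (- \<Phi> y z) x"
        using cross_cross[OF x y z] by (simp add: t_def u_def scE j_minus mult_minus_left)
      have tW: "t \<in> W" using u z by (simp add: t_def cross_mem)
      have "ereal (p + q + r) \<le> \<gamma> t" unfolding t
      proof (rule rational_norm_add[OF R])
        show "scE (\<Phi> x z) y \<in> W" "scE (- \<Phi> y z) x \<in> W" using x y by (simp_all add: scE W_mult)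
        show "ereal (p + q + r) \<le> \<gamma> (scE (\<Phi> x z) y)"
          using add_right_mono[OF le[OF x z], of "\<gamma> y"]
          by (simp add: rational_norm_scale[OF R y] p q r ac_simps)
        show "ereal (p + q + r) \<le> \<gamma> (scE (- \<Phi> y z) x)"
          using add_right_mono[OF le[OF y z], of "\<gamma> x"]
          by (simp add: rational_norm_scale[OF R x] p q r ac_simps del: EV.scale_minus_left)
      qed
      then have "ereal (p + q + r) + ereal (p + q + r) \<le> \<gamma> t + \<gamma> t" by (intro add_mono)
      also have "\<dots> \<le> vE (\<Phi> t t)" by (rule le[OF tW tW])
      finally have 2: "ereal (2 * p + 2 * q + 2 * r) \<le> vE (\<Phi> t t)" by (simp add: algebra_simps)
      \<comment> \<open>The left side has twice the valuation of \<open>\<Phi> u z\<close>, so a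
        bound for it can be halved.\<close>
      have "\<Phi> u z * \<sigma> (\<Phi> u z) = \<Phi> u u * \<Phi> z z - \<Phi> t t"
        using \<Phi>_cross_cross[OF u z] by (simp add: t_def)
      then have "ereal (2 * p + 2 * q + 2 * r) \<le> vE (\<Phi> u z * \<sigma> (\<Phi> u z))"
        using E.val_ge_diff[OF 1 2] by simp
      then show "ereal (p + q) + \<gamma> z \<le> vE (\<Phi> u z)"
        by (cases "vE (\<Phi> u z)") (auto simp: E.val_mult vE_\<sigma> r)
    qed
    then show ?thesis by (simp add: u_def p q)
  qed
qed

text \<open>The decomposition is orthogonal and \<gamma> is the minimum over the components, so
  duality can be tested on \<open>V0\<close> and \<open>W\<close> separately. Among the products of
  components, only that of two vectors of \<open>W\<close> needs the duality of \<delta>; the others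
  follow from homogeneity and the invariance of \<open>vE\<close> under \<sigma>.\<close>

lemma self_dual_algebra_norm_extend:
  assumes N: "self_dual_norm vE scE \<Phi> W \<delta>"
    and \<gamma>: "\<And>c w. w \<in> W \<Longrightarrow> \<gamma> (j c + w) = min (vE c) (\<delta> w)"
  shows "self_dual_algebra_norm vF' sc Q UNIV \<gamma>"
proof -
  have RW: "rational_norm vE scE W \<delta>" using N by (simp add: self_dual_norm_def)
  have \<delta>0: "\<delta> 0 = \<infinity>" using rational_norm_eq_PInfty_iff[OF RW, of 0] by simp
  have dec: "\<exists>a w. w \<in> W \<and> x = j a + w" for x using decompose[of x] by metis
  have min_add: "min (c + a) (c + b) = c + min a b" for a b c :: ereal
    by (cases a b rule: linorder_le_cases) (simp_all add: min_absorb1 min_absorb2 add_left_mono)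
  have min_PInf: "min a b = \<infinity> \<longleftrightarrow> a = \<infinity> \<and> b = \<infinity>" for a b :: ereal
    by (cases a; cases b) (auto simp: min_def)
  have R: "rational_norm vF' sc UNIV \<gamma>"
    unfolding rational_norm_def
  proof (intro conjI ballI allI)
    fix x obtain a w where x: "w \<in> W" "x = j a + w" using dec by blast
    show "\<gamma> x = \<infinity> \<or> (\<exists>q::rat. \<gamma> x = ereal (of_rat q))"
      using vE_rational[of a] rational_norm_rational[OF RW x(1)] by (simp add: x \<gamma> min_def)
    show "\<gamma> (sc c x) = vF' c + \<gamma> x" for c
    proof -
      have "sc c x = j (\<iota> c * a) + scE (\<iota> c) w"
        by (simp add: x scale_right_distrib sc_j scE j_\<iota>_mult)
      moreover have "scE (\<iota> c) w \<in> W" using x by (simp add: scE W_mult)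
      ultimately have "\<gamma> (sc c x) = min (vE (\<iota> c * a)) (\<delta> (scE (\<iota> c) w))" by (simp only: \<gamma>)
      then show ?thesis
        by (simp add: rational_norm_scale[OF RW x(1)] E.val_mult min_add x(2) \<gamma>[OF x(1)])
    qed
    have "j a + w = 0 \<longleftrightarrow> a = 0 \<and> w = 0"
    proof
      assume 0: "j a + w = 0"
      have "\<Phi> (j a + w) 1 = a" using x(1) \<Phi>_j[of a 1] by (simp add: \<Phi>_add_left W_iff)
      then show "a = 0 \<and> w = 0" using 0 by auto
    qed simp
    then show "\<gamma> x = \<infinity> \<longleftrightarrow> x = 0"
      using rational_norm_eq_PInfty_iff[OF RW x(1)] by (simp add: x \<gamma> E.val_eq_PInfty_iff min_PInf)
    fix y obtain b w' where y: "w' \<in> W" "y = j b + w'" using dec by blast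
    have "min (\<gamma> x) (\<gamma> y) \<le> min (vE a) (vE b)" by (intro min.mono) (simp_all add: x y \<gamma>)
    also have "\<dots> \<le> vE (a + b)" by (rule E.val_add)
    finally have 1: "min (\<gamma> x) (\<gamma> y) \<le> vE (a + b)" .
    have "min (\<gamma> x) (\<gamma> y) \<le> min (\<delta> w) (\<delta> w')" by (intro min.mono) (simp_all add: x y \<gamma>)
    also have "\<dots> \<le> \<delta> (w + w')" by (rule rational_norm_add[OF RW x(1) y(1)]) auto
    finally have 2: "min (\<gamma> x) (\<gamma> y) \<le> \<delta> (w + w')" .
    have "x + y = j (a + b) + (w + w')" by (simp add: x y j_add)
    then have "\<gamma> (x + y) = min (vE (a + b)) (\<delta> (w + w'))" by (simp only: \<gamma>[OF W_add[OF x(1) y(1)]])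
    then show "min (\<gamma> x) (\<gamma> y) \<le> \<gamma> (x + y)" using 1 2 by (simp only: min.bounded_iff)
  qed
  have "self_dual vF' B UNIV \<gamma>"
    unfolding self_dual_iff[OF R]
  proof (intro ballI allI)
    fix x m obtain a w where x: "w \<in> W" "x = j a + w" using dec by blast
    have B: "B x (j b + w') = B (j a) (j b) + B w w'" if "w' \<in> W" for b w'
    proof -
      have "B (j a) w' = 0" "B w (j b) = 0"
        using polar_W_V0[OF that, of "j a"] polar_W_V0[OF x(1), of "j b"] by (auto simp: V0_def polar_commute)
      then show ?thesis by (simp add: x polar_distribs)
    qed
    have w: "m \<le> \<delta> w \<longleftrightarrow> (\<forall>y\<in>W - {0}. m + \<delta> y \<le> vF' (B w y))"
      by (simp add: self_dual_le_iff[OF N x(1)] hermitian_trace_le_iff[OF RW x(1)])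
    show "m \<le> \<gamma> x \<longleftrightarrow> (\<forall>y\<in>UNIV - {0}. m + \<gamma> y \<le> vF' (B x y))"
    proof (intro iffI ballI)
      fix y assume "m \<le> \<gamma> x"
      then have m: "m \<le> vE a" "m \<le> \<delta> w" by (simp_all add: x \<gamma>)
      obtain b w' where y: "w' \<in> W" "y = j b + w'" using dec by blast
      show "m + \<gamma> y \<le> vF' (B x y)"
        unfolding y(2) B[OF y(1)] \<iota>_add
      proof (rule E.val_ge_add)
        have "m + \<gamma> (j b + w') \<le> vE a + vE b" using m by (intro add_mono) (simp_all add: \<gamma> y)
        also have "\<dots> \<le> vF' (B (j a) (j b))" by (rule vF'_polar_j)
        finally show "m + \<gamma> (j b + w') \<le> vF' (B (j a) (j b))" .
        show "m + \<gamma> (j b + w') \<le> vF' (B w w')"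
        proof (cases "w' = 0")
          case False
          have "m + \<gamma> (j b + w') \<le> m + \<delta> w'" by (intro add_left_mono) (simp add: \<gamma> y)
          also have "\<dots> \<le> vF' (B w w')" using w m y(1) False by blast
          finally show ?thesis .
        qed simp
      qed
    next
      assume *: "\<forall>y\<in>UNIV - {0}. m + \<gamma> y \<le> vF' (B x y)"
      have "m \<le> vE a"
      proof (rule vE_le_iff[THEN iffD2], intro allI impI)
        fix d :: 'e assume "d \<noteq> 0"
        then have "m + \<gamma> (j d) \<le> vF' (B x (j d))" using * by simp
        then show "m + vE d \<le> vF' (B (j a) (j d))"
          using B[of 0 d] \<gamma>[of 0 d] by (simp add: \<delta>0)
      qed
      moreover have "m \<le> \<delta> w"
        unfolding w
      proof
        fix y assume y: "y \<in> W - {0}"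
        have "m + \<gamma> y \<le> vF' (B x y)" using * y by simp
        then show "m + \<delta> y \<le> vF' (B w y)"
          using B[of y 0] \<gamma>[of y 0] y by simp
      qed
      ultimately show "m \<le> \<gamma> x" by (simp add: x \<gamma>)
    qed
  qed
  moreover have "\<gamma> x + \<gamma> y \<le> \<gamma> (x * y)" for x y
  proof -
    obtain a w where x: "w \<in> W" "x = j a + w" using dec by blast
    obtain b w' where y: "w' \<in> W" "y = j b + w'" using dec by blast
    let ?z = "(scE a w' + scE (\<sigma> b) w) + cross w w'"
    have eq: "x * y = j (a * b - \<Phi> w w') + ?z"
      by (simp add: x y mult_distribs scE j_mult j_diff mult_W_j mult_eq_cross[of w w'])
    have mem: "scE a w' \<in> W" "scE (\<sigma> b) w \<in> W" "cross w w' \<in> W"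
      using x y by (simp_all add: scE W_mult cross_mem)
    have ga: "\<gamma> x \<le> vE a" "\<gamma> x \<le> \<delta> w" "\<gamma> y \<le> vE b" "\<gamma> y \<le> \<delta> w'" by (simp_all add: x y \<gamma>)
    have "\<gamma> x + \<gamma> y \<le> vE (a * b)" unfolding E.val_mult by (intro add_mono ga)
    moreover have ww: "\<gamma> x + \<gamma> y \<le> \<delta> w + \<delta> w'" by (intro add_mono ga)
    then have "\<gamma> x + \<gamma> y \<le> vE (\<Phi> w w')"
      using self_dual_W_add_le[OF N x(1) y(1)] by (rule order_trans)
    ultimately have 1: "\<gamma> x + \<gamma> y \<le> vE (a * b - \<Phi> w w')" by (rule E.val_ge_diff)
    have "\<gamma> x + \<gamma> y \<le> \<delta> (scE a w')"
      unfolding rational_norm_scale[OF RW y(1)] by (intro add_mono ga)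
    moreover have "\<gamma> x + \<gamma> y \<le> \<delta> (scE (\<sigma> b) w)"
      unfolding rational_norm_scale[OF RW x(1)] vE_\<sigma> add.commute[of "\<gamma> x"] by (intro add_mono ga)
    moreover have "\<gamma> x + \<gamma> y \<le> \<delta> (cross w w')"
      using ww self_dual_norm_cross[OF N x(1) y(1)] by (rule order_trans)
    ultimately have 2: "\<gamma> x + \<gamma> y \<le> \<delta> ?z"
      using mem W_add by (intro rational_norm_add[OF RW]) auto
    have "?z \<in> W" using mem by (intro W_add)
    then show ?thesis unfolding eq by (simp only: \<gamma>) (simp only: min.bounded_iff 1 2)
  qed
  ultimately show ?thesis using R by (simp add: self_dual_algebra_norm_def self_dual_norm_def)
qed

section \<open>Return to norms on the scale of \<open>vF\<close>\<close>

lemma rescale_by_ramification: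
  "self_dual_norm vF s h X \<alpha> \<longleftrightarrow> self_dual_norm vF' s h X (\<lambda>x. ereal (real e) * \<alpha> x)"
proof
  have vF': "(\<lambda>a. ereal (of_rat (of_nat e)) * vF a) = vF'" by (simp add: vE_\<iota>)
  assume "self_dual_norm vF s h X \<alpha>"
  from self_dual_norm_rescale[OF _ this, of "of_nat e", unfolded vF']
  show "self_dual_norm vF' s h X (\<lambda>x. ereal (real e) * \<alpha> x)" using e_pos by simp
next
  have q: "real_of_rat (1 / of_nat e) = 1 / real e" by (simp add: of_rat_divide)
  assume "self_dual_norm vF' s h X (\<lambda>x. ereal (real e) * \<alpha> x)"
  from self_dual_norm_rescale[OF _ this, of "1 / of_nat e", unfolded q]
  show "self_dual_norm vF s h X \<alpha>"
    using e_pos by (simp add: vE_\<iota> ereal_mult_inverse_pos(1) del: times_ereal.simps)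
qed

lemma rescale_algebra_norm_by_ramification:
  "self_dual_algebra_norm vF sc Q X \<alpha> \<longleftrightarrow> self_dual_algebra_norm vF' sc Q X (\<lambda>x. ereal (real e) * \<alpha> x)"
  unfolding self_dual_algebra_norm_def rescale_by_ramification[symmetric] using e_pos
  by (simp add: ereal_mult_distrib_pos[symmetric] ereal_mult_le_cancel_pos)

lemma ereal_divide_ramification: "ereal (real e) * (a / ereal (real e)) = a"
  using e_pos by (cases a) auto

lemma j_W_unique:
  assumes "w \<in> W" "w' \<in> W" "j a + w = j b + w'" shows "a = b" "w = w'"
proof -
  have "\<Phi> (j a + w) 1 = a" "\<Phi> (j b + w') 1 = b"
    using assms(1,2) \<Phi>_j[of a 1] \<Phi>_j[of b 1] by (simp_all add: \<Phi>_add_left W_iff)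
  then show "a = b" using assms(3) by metis
  then show "w = w'" using assms(3) by simp
qed

lemma norm_wedge_j_W:
  assumes w: "w \<in> W" shows "norm_wedge V0 W \<alpha> \<beta> (j a + w) = min (\<alpha> (j a)) (\<beta> w)"
  unfolding norm_wedge_def
proof (rule the_equality)
  show "\<exists>x1\<in>V0. \<exists>x2\<in>W. j a + w = x1 + x2 \<and> min (\<alpha> (j a)) (\<beta> w) = min (\<alpha> x1) (\<beta> x2)"
    using w unfolding V0_def by blast
  fix r assume "\<exists>x1\<in>V0. \<exists>x2\<in>W. j a + w = x1 + x2 \<and> r = min (\<alpha> x1) (\<beta> x2)"
  then obtain b w' where "w' \<in> W" "j a + w = j b + w'" "r = min (\<alpha> (j b)) (\<beta> w')"
    by (auto simp: V0_def)
  then show "r = min (\<alpha> (j a)) (\<beta> w)" using j_W_unique[OF w] by metis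
qed

lemma self_dual_norm_V0_value:
  assumes "self_dual_norm vF sc B V0 \<alpha>" shows "\<alpha> (j c) = vE c / ereal (real e)"
proof -
  have "ereal (real e) * \<alpha> (j c) = vE c"
    using assms rescale_by_ramification self_dual_norm_V0_unique by blast
  then show ?thesis using e_pos by (cases "\<alpha> (j c)") (auto simp flip: \<open>_ = vE c\<close>)
qed

lemma split_by_V0_value:
  assumes "self_dual_algebra_norm vF sc Q UNIV \<alpha>" "split_by V0 W \<alpha>"
  shows "\<alpha> (j c) = vE c / ereal (real e)"
proof -
  let ?\<gamma> = "\<lambda>x. ereal (real e) * \<alpha> x"
  have "self_dual_norm vF' sc B UNIV ?\<gamma>"
    using assms(1) unfolding self_dual_algebra_norm_def rescale_by_ramification by blast
  moreover have "split_by V0 W ?\<gamma>"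
    using assms(2) e_pos unfolding split_by_def by (simp add: min_def ereal_mult_le_cancel_pos)
  ultimately have "self_dual_norm vF' sc B V0 ?\<gamma>" by (rule split_self_dual_norm_V0)
  then show ?thesis using rescale_by_ramification self_dual_norm_V0_value by blast
qed

lemma restrict_to_W:
  assumes "self_dual_algebra_norm vF sc Q UNIV \<alpha>" "split_by V0 W \<alpha>"
  shows "self_dual_norm vE scE \<Phi> W (\<lambda>w. ereal (real e) * \<alpha> w)"
proof (rule self_dual_algebra_norm_restrict)
  show "self_dual_algebra_norm vF' sc Q UNIV (\<lambda>w. ereal (real e) * \<alpha> w)"
    using assms(1) by (simp only: rescale_algebra_norm_by_ramification)
  show "split_by V0 W (\<lambda>w. ereal (real e) * \<alpha> w)"
    using assms(2) e_pos unfolding split_by_def by (simp add: min_def ereal_mult_le_cancel_pos)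
qed

lemma ex1_self_dual_algebra_norm_V0:
  "\<exists>\<alpha>0. self_dual_algebra_norm vF sc Q V0 \<alpha>0
     \<and> (\<forall>\<beta>. self_dual_algebra_norm vF sc Q V0 \<beta> \<longrightarrow> (\<forall>x\<in>V0. \<beta> x = \<alpha>0 x))"
proof -
  let ?\<alpha>0 = "\<lambda>x. vE (inv j x) / ereal (real e)"
  have \<alpha>0: "self_dual_algebra_norm vF sc Q V0 ?\<alpha>0"
    unfolding rescale_algebra_norm_by_ramification ereal_divide_ramification
    by (rule self_dual_algebra_norm_V0)
  moreover have "\<beta> x = ?\<alpha>0 x" if \<beta>: "self_dual_algebra_norm vF sc Q V0 \<beta>" and x: "x \<in> V0" for \<beta> x
  proof -
    obtain c where c: "x = j c" using x by (auto simp: V0_def)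
    have "\<gamma> x = vE c / ereal (real e)" if "self_dual_algebra_norm vF sc Q V0 \<gamma>" for \<gamma>
      unfolding c using that by (intro self_dual_norm_V0_value) (simp add: self_dual_algebra_norm_def)
    from this[OF \<beta>] this[OF \<alpha>0] show ?thesis by simp
  qed
  ultimately show ?thesis by blast
qed

text \<open>For uniqueness, splitting reduces the norm to its restrictions to \<open>V0\<close> and
  \<open>W\<close>: the first is forced by duality, the second is prescribed.\<close>

lemma wedge_extension:
  assumes N: "self_dual_norm vE scE \<Phi> W \<alpha>'" and \<alpha>0: "self_dual_algebra_norm vF sc Q V0 \<alpha>0"
  defines "\<alpha> \<equiv> norm_wedge V0 W \<alpha>0 (\<lambda>w. \<alpha>' w / ereal (real e))"
  shows "self_dual_algebra_norm vF sc Q UNIV \<alpha>" "split_by V0 W \<alpha>"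
    "\<forall>w\<in>W. \<alpha> w = \<alpha>' w / ereal (real e)"
    "\<And>\<beta>. self_dual_algebra_norm vF sc Q UNIV \<beta> \<Longrightarrow> split_by V0 W \<beta> \<Longrightarrow>
      \<forall>w\<in>W. \<beta> w = \<alpha>' w / ereal (real e) \<Longrightarrow> \<beta> = \<alpha>"
proof -
  have R: "rational_norm vE scE W \<alpha>'" using N by (simp add: self_dual_norm_def)
  have 0: "\<alpha>' 0 / ereal (real e) = \<infinity>"
    using rational_norm_eq_PInfty_iff[OF R, of 0] e_pos by simp
  have \<alpha>0j: "\<alpha>0 (j c) = vE c / ereal (real e)" for c
    using \<alpha>0 by (intro self_dual_norm_V0_value) (simp add: self_dual_algebra_norm_def)
  have \<alpha>: "\<alpha> (j c + w) = min (vE c / ereal (real e)) (\<alpha>' w / ereal (real e))" if "w \<in> W" for c w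
    unfolding \<alpha>_def norm_wedge_j_W[OF that] \<alpha>0j ..
  have \<alpha>j: "\<alpha> (j c) = vE c / ereal (real e)" for c
    using \<alpha>[of 0 c] by (simp add: 0)
  have \<alpha>W: "\<alpha> w = \<alpha>' w / ereal (real e)" if "w \<in> W" for w
    using \<alpha>[OF that, of 0] e_pos by simp
  then show "\<forall>w\<in>W. \<alpha> w = \<alpha>' w / ereal (real e)" by blast
  show "split_by V0 W \<alpha>"
    using \<alpha> \<alpha>j \<alpha>W by (auto simp: split_by_def V0_def)
  have mult_min: "ereal (real e) * min a b = min (ereal (real e) * a) (ereal (real e) * b)" for a b
    using e_pos by (simp add: min_def ereal_mult_le_cancel_pos)
  show "self_dual_algebra_norm vF sc Q UNIV \<alpha>"
    unfolding rescale_algebra_norm_by_ramification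
    by (rule self_dual_algebra_norm_extend[OF N])
      (simp only: \<alpha> mult_min ereal_divide_ramification)
  fix \<beta> assume \<beta>: "self_dual_algebra_norm vF sc Q UNIV \<beta>" "split_by V0 W \<beta>"
    "\<forall>w\<in>W. \<beta> w = \<alpha>' w / ereal (real e)"
  show "\<beta> = \<alpha>"
  proof
    fix x obtain w where w: "w \<in> W" "x = j (\<Phi> x 1) + w" by (rule decompose)
    have "\<beta> (j (\<Phi> x 1) + w) = min (\<beta> (j (\<Phi> x 1))) (\<beta> w)"
      using \<beta>(2) w(1) by (simp add: split_by_def V0_def)
    also have "\<dots> = \<alpha> (j (\<Phi> x 1) + w)"
      using \<beta>(3) w(1) by (simp add: split_by_V0_value[OF \<beta>(1,2)] \<alpha>)
    finally show "\<beta> x = \<alpha> x" using w(2) by simp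
  qed
qed

end

theorem proposition1p15:
  fixes vF :: "'f::field \<Rightarrow> ereal"
    and sc :: "'f \<Rightarrow> 'v \<Rightarrow> 'v::{ab_group_add,times,one}"
    and Q :: "'v \<Rightarrow> 'f"
    and \<iota> :: "'f \<Rightarrow> 'e::field"
    and j :: "'e \<Rightarrow> 'v"
    and vE :: "'e \<Rightarrow> ereal"
    and e :: nat
    and \<sigma> :: "'e \<Rightarrow> 'e"
    and \<Phi> :: "'v \<Rightarrow> 'v \<Rightarrow> 'e"
    and V0 W :: "'v set"
    and scE :: "'e \<Rightarrow> 'v \<Rightarrow> 'v"
  assumes "nonarch_local_field vF"
    and "residue_char vF \<notin> {2, 3}"
    and "split_octonion_algebra sc Q"
    and "quadratic_composition_subfield sc Q \<iota> j"
    and "V0 = range j"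
    and "W = orth_complement Q V0"
    and "scE = (\<lambda>c x. j c * x)"
    and "normalized_valuation vE"
    and "\<forall>a. vE (\<iota> a) = ereal (real e) * vF a"
    and "nontrivial_automorphism \<iota> \<sigma>"
    and "hermitian_form scE \<sigma> \<Phi>"
    and "\<forall>x y. polar Q x y = quadratic_trace \<iota> \<sigma> (\<Phi> x y)"
  shows
    "\<comment> \<open>(i)\<close>
     (\<forall>f. orthogonal_basis3 scE \<Phi> W f \<longrightarrow> (\<exists>c. c \<noteq> 0 \<and> f 1 * f 2 = scE c (f 3)))
     \<and> (\<forall>L0 b b'. is_lattice vE scE W L0
            \<and> special_basis scE Q \<Phi> W b \<and> special_basis scE Q \<Phi> W b'
          \<longrightarrow> lattice_volume vE scE W L0 (lattice_of vE scE b)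
              = lattice_volume vE scE W L0 (lattice_of vE scE b'))
     \<and> (\<forall>L0. is_lattice vE scE W L0
            \<and> (\<forall>b. special_basis scE Q \<Phi> W b
                   \<longrightarrow> lattice_volume vE scE W L0 (lattice_of vE scE b) = 0)
          \<longrightarrow> (\<forall>\<beta>. self_dual_norm vE scE \<Phi> W \<beta> \<longrightarrow> norm_volume vE scE W L0 \<beta> = 0))
     \<and> \<comment> \<open>(ii)\<close>
     (\<forall>\<alpha>. self_dual_algebra_norm vF sc Q UNIV \<alpha> \<and> split_by V0 W \<alpha>
        \<longrightarrow> self_dual_norm vE scE \<Phi> W (\<lambda>w. ereal (real e) * \<alpha> w))
     \<and> \<comment> \<open>(iii)\<close>
     (\<exists>\<alpha>0. self_dual_algebra_norm vF sc Q V0 \<alpha>0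
        \<and> (\<forall>\<beta>. self_dual_algebra_norm vF sc Q V0 \<beta> \<longrightarrow> (\<forall>x\<in>V0. \<beta> x = \<alpha>0 x)))
     \<and> (\<forall>\<alpha>' \<alpha>0. self_dual_norm vE scE \<Phi> W \<alpha>' \<and> self_dual_algebra_norm vF sc Q V0 \<alpha>0
        \<longrightarrow> (let \<alpha> = norm_wedge V0 W \<alpha>0 (\<lambda>w. \<alpha>' w / ereal (real e)) in
               self_dual_algebra_norm vF sc Q UNIV \<alpha>
             \<and> split_by V0 W \<alpha>
             \<and> (\<forall>w\<in>W. \<alpha> w = \<alpha>' w / ereal (real e))
             \<and> (\<forall>\<beta>. self_dual_algebra_norm vF sc Q UNIV \<beta> \<and> split_by V0 W \<beta>
                      \<and> (\<forall>w\<in>W. \<beta> w = \<alpha>' w / ereal (real e))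
                    \<longrightarrow> \<beta> = \<alpha>)))"
proof -
  \<comment> \<open>The isotropic vector also shows that the algebra is nonzero, which the locale
    requires.\<close>
  obtain x0 :: 'v where x0: "x0 \<noteq> 0" "Q x0 = 0"
    using assms(3) by (auto simp: split_octonion_algebra_def)
  interpret hermitian_composition_alg sc Q vF \<iota> j vE e \<sigma> \<Phi> V0 W scE
    using assms x0 by unfold_locales (auto simp: split_octonion_algebra_def)
  show ?thesis
    unfolding Let_def
  proof (intro conjI allI impI)
    show "\<exists>c. c \<noteq> 0 \<and> f 1 * f 2 = scE c (f 3)" if "orthogonal_basis3 scE \<Phi> W f" for f
      using that by (rule orthogonal_basis_mult)
    show "lattice_volume vE scE W L0 (lattice_of vE scE b) = lattice_volume vE scE W L0 (lattice_of vE scE b')"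
      if "is_lattice vE scE W L0 \<and> special_basis scE Q \<Phi> W b \<and> special_basis scE Q \<Phi> W b'" for L0 b b'
      using that lattice_volume_special_basis by metis
    show "norm_volume vE scE W L0 \<beta> = 0"
      if "is_lattice vE scE W L0 \<and> (\<forall>b. special_basis scE Q \<Phi> W b
          \<longrightarrow> lattice_volume vE scE W L0 (lattice_of vE scE b) = 0)"
        and "self_dual_norm vE scE \<Phi> W \<beta>" for L0 \<beta>
      by (rule norm_volume_self_dual[OF x0]) (use that in auto)
    show "self_dual_norm vE scE \<Phi> W (\<lambda>w. ereal (real e) * \<alpha> w)"
      if "self_dual_algebra_norm vF sc Q UNIV \<alpha> \<and> split_by V0 W \<alpha>" for \<alpha>
      by (rule restrict_to_W) (use that in auto)
  next
    fix \<alpha>' \<alpha>0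
    assume *: "self_dual_norm vE scE \<Phi> W \<alpha>' \<and> self_dual_algebra_norm vF sc Q V0 \<alpha>0"
    note ext = wedge_extension[OF conjunct1[OF *] conjunct2[OF *]]
    let ?\<alpha> = "norm_wedge V0 W \<alpha>0 (\<lambda>w. \<alpha>' w / ereal (real e))"
    show "self_dual_algebra_norm vF sc Q UNIV ?\<alpha>" "split_by V0 W ?\<alpha>"
      "\<forall>w\<in>W. ?\<alpha> w = \<alpha>' w / ereal (real e)"
      by (rule ext)+
    show "\<beta> = ?\<alpha>" if "self_dual_algebra_norm vF sc Q UNIV \<beta> \<and> split_by V0 W \<beta>
        \<and> (\<forall>w\<in>W. \<beta> w = \<alpha>' w / ereal (real e))" for \<beta>
      by (rule ext(4)) (use that in auto)
  qed (rule ex1_self_dual_algebra_norm_V0)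
qed

end
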